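(* Let $\Omega\subset\mathbb{R}^N$ ($N\ge 1$) be a bounded domain with smooth boundary $\partial\Omega$, and let $\lambda_0>0$ be the first Dirichlet eigenvalue of the Laplacian on $\Omega$. Let $f:\mathbb{R}\to\mathbb{R}$ be locally Lipschitz continuous with $f(0)=0$ and $f(u)>0$ for all $u>0$. Let $u_0\in C^1(\overline{\Omega})$ be non-negative with $u_0=0$ on $\partial\Omega$. Suppose there are constants $\alpha,\beta,\gamma>0$ with $0<\beta\le \frac{(\alpha-2)\lambda_0}{2}$ such that $$\alpha\int_0^{u} f(s)\,ds\le u f(u)+\beta u^2+\gamma\qquad\text{for all } u>0 .$$ If the initial data $u_0$ satisfies, with this same constant $\gamma$, $$-\frac12\int_\Omega |\nabla u_0(x)|^2\,dx+\int_\Omega\left[\int_0^{u_0(x)} f(s)\,ds-\gamma\right]dx>0,$$ then the nonnegative classical solution $u$ of the problem $$\begin{cases} u_t(x,t)=\Delta u(x,t)+f(u(x,t)), & (x,t)\in\Omega\times(0,+\infty),\\ u(x,t)=0, & (x,t)\in\partial\Omega\times[0,+\infty),\\ u(x,0)=u_0(x)\ge 0, & x\in\overline{\Omega},\end{cases}$$ blows up at a finite time $T^*$, in the sense that $$\lim_{t\to T^*}\int_0^t\int_\Omega u^2(x,s)\,dx\,ds=+\infty .$$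
   Context: The first eigenvalue $\lambda_0>0$ is that of the problem $-\Delta\phi_0=\lambda_0\phi_0$ in $\Omega$, $\phi_0=0$ on $\partial\Omega$; it is given by $$\lambda_0=\min_{u\in\mathcal{A}}\frac{\int_\Omega|\nabla u(x)|^2dx}{\int_\Omega |u(x)|^2dx},\qquad \mathcal{A}=\{u\in C^2(\Omega): u\not\equiv 0,\ u=0\text{ on }\partial\Omega\}.$$ It is taken as known that the initial-boundary value problem has a classical solution.
   Formalization: The solution is taken on [0,T), T ≤ ∞, and is assumed to continue past any finite time up to which ∫∫u² stays bounded; what is proved is that T = ∞ is impossible. At the maximal existence time the stated limit can fail (f(u)=u^5, N=1). *)

theory Defs
  imports "HOL-Analysis.Analysis"
begin

section \<open>Differential operators and smoothness classes\<close>

definition partial_deriv :: "'a::euclidean_space \<Rightarrow> ('a \<Rightarrow> real) \<Rightarrow> 'a \<Rightarrow> real" where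
  "partial_deriv b v x = frechet_derivative v (at x) b"

definition gradient :: "('a::euclidean_space \<Rightarrow> real) \<Rightarrow> 'a \<Rightarrow> 'a" where
  "gradient v x = (\<Sum>b\<in>Basis. partial_deriv b v x *\<^sub>R b)"

definition laplacian :: "('a::euclidean_space \<Rightarrow> real) \<Rightarrow> 'a \<Rightarrow> real" where
  "laplacian v x = (\<Sum>b\<in>Basis. partial_deriv b (partial_deriv b v) x)"

text \<open>The class \<open>C\<^sup>k(\<Omega>)\<close>; meaningful for open \<open>\<Omega>\<close> only, since derivatives are taken
  at points of the whole space.\<close>

fun Ck_on :: "nat \<Rightarrow> ('a::euclidean_space \<Rightarrow> real) \<Rightarrow> 'a set \<Rightarrow> bool" where
  "Ck_on 0 v \<Omega> \<longleftrightarrow> continuous_on \<Omega> v"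
| "Ck_on (Suc k) v \<Omega> \<longleftrightarrow>
     (\<forall>x\<in>\<Omega>. v differentiable (at x)) \<and> (\<forall>b\<in>Basis. Ck_on k (partial_deriv b v) \<Omega>)"

text \<open>The class \<open>C\<^sup>1\<close> of the closure of an open set: the function and its gradient on \<open>\<Omega>\<close>
  extend continuously to the closure.\<close>

definition C1_closure :: "('a::euclidean_space \<Rightarrow> real) \<Rightarrow> 'a set \<Rightarrow> bool" where
  "C1_closure v \<Omega> \<longleftrightarrow> Ck_on 1 v \<Omega> \<and> continuous_on (closure \<Omega>) v \<and>
     (\<exists>G. continuous_on (closure \<Omega>) G \<and> (\<forall>x\<in>\<Omega>. gradient v x = G x))"


section \<open>Bounded domains with smooth boundary\<close>

text \<open>The boundary is smooth if near each of its points the set is a strict sublevel set of a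
  \<open>C\<^sup>\<infinity>\<close> function without critical points, whose zero set is the boundary.\<close>

definition smooth_boundary :: "'a::euclidean_space set \<Rightarrow> bool" where
  "smooth_boundary \<Omega> \<longleftrightarrow> (\<forall>p\<in>frontier \<Omega>. \<exists>U \<rho>. open U \<and> p \<in> U \<and> (\<forall>k. Ck_on k \<rho> U) \<and>
     (\<forall>x\<in>U. gradient \<rho> x \<noteq> 0) \<and>
     \<Omega> \<inter> U = {x\<in>U. \<rho> x < 0} \<and> frontier \<Omega> \<inter> U = {x\<in>U. \<rho> x = 0})"

definition bounded_smooth_domain :: "'a::euclidean_space set \<Rightarrow> bool" where
  "bounded_smooth_domain \<Omega> \<longleftrightarrow>
     open \<Omega> \<and> connected \<Omega> \<and> \<Omega> \<noteq> {} \<and> bounded \<Omega> \<and> smooth_boundary \<Omega>"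


section \<open>The first Dirichlet eigenvalue\<close>

text \<open>The class \<open>\<A>\<close> of competitors; the boundary condition is understood for functions that
  are continuous up to the boundary.\<close>

definition admissible :: "'a::euclidean_space set \<Rightarrow> ('a \<Rightarrow> real) set" where
  "admissible \<Omega> = {v. Ck_on 2 v \<Omega> \<and> continuous_on (closure \<Omega>) v \<and>
     (\<forall>x\<in>frontier \<Omega>. v x = 0) \<and> (\<exists>x\<in>\<Omega>. v x \<noteq> 0)}"

text \<open>Competitors may have infinite Dirichlet energy. The quotient is therefore formed in the
  extended nonnegative reals, where it is then \<open>\<infinity>\<close>; the Bochner integral would give \<open>0\<close>.\<close>

definition rayleigh_quotient :: "'a::euclidean_space set \<Rightarrow> ('a \<Rightarrow> real) \<Rightarrow> ennreal" where
  "rayleigh_quotient \<Omega> v =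
     (\<integral>\<^sup>+x\<in>\<Omega>. ennreal ((norm (gradient v x))\<^sup>2) \<partial>lborel) / (\<integral>\<^sup>+x\<in>\<Omega>. ennreal ((v x)\<^sup>2) \<partial>lborel)"

definition first_dirichlet_eigenvalue :: "'a::euclidean_space set \<Rightarrow> real \<Rightarrow> bool" where
  "first_dirichlet_eigenvalue \<Omega> lam\<^sub>0 \<longleftrightarrow>
     (\<exists>\<phi>\<in>admissible \<Omega>. (\<forall>x\<in>\<Omega>. - laplacian \<phi> x = lam\<^sub>0 * \<phi> x) \<and>
        rayleigh_quotient \<Omega> \<phi> = ennreal lam\<^sub>0) \<and>
     (\<forall>v\<in>admissible \<Omega>. ennreal lam\<^sub>0 \<le> rayleigh_quotient \<Omega> v)"


section \<open>Classical solutions\<close>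

text \<open>The class \<open>C\<^sup>2\<^sup>,\<^sup>1(\<Omega> \<times> (0,T))\<close>, with \<open>0 < T \<le> \<infinity>\<close>.\<close>

definition C21_on :: "'a::euclidean_space set \<Rightarrow> ereal \<Rightarrow> ('a \<Rightarrow> real \<Rightarrow> real) \<Rightarrow> bool" where
  "C21_on \<Omega> T u \<longleftrightarrow> (let Q = \<Omega> \<times> {t. 0 < t \<and> ereal t < T} in
     continuous_on Q (\<lambda>(x, t). u x t) \<and>
     (\<forall>(x, t)\<in>Q. u x differentiable (at t)) \<and>
     continuous_on Q (\<lambda>(x, t). deriv (u x) t) \<and>
     (\<forall>t. 0 < t \<and> ereal t < T \<longrightarrow> Ck_on 2 (\<lambda>y. u y t) \<Omega>) \<and>
     (\<forall>i\<in>Basis. continuous_on Q (\<lambda>(x, t). partial_deriv i (\<lambda>y. u y t) x)) \<and>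
     (\<forall>i\<in>Basis. \<forall>j\<in>Basis.
        continuous_on Q (\<lambda>(x, t). partial_deriv i (partial_deriv j (\<lambda>y. u y t)) x)))"

definition nonneg_classical_solution ::
  "'a::euclidean_space set \<Rightarrow> ereal \<Rightarrow> (real \<Rightarrow> real) \<Rightarrow> ('a \<Rightarrow> real) \<Rightarrow> ('a \<Rightarrow> real \<Rightarrow> real) \<Rightarrow> bool"
where
  "nonneg_classical_solution \<Omega> T f u\<^sub>0 u \<longleftrightarrow>
     C21_on \<Omega> T u \<and>
     continuous_on (closure \<Omega> \<times> {t. 0 \<le> t \<and> ereal t < T}) (\<lambda>(x, t). u x t) \<and>
     (\<forall>x\<in>closure \<Omega>. \<forall>t. 0 \<le> t \<and> ereal t < T \<longrightarrow> 0 \<le> u x t) \<and>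
     (\<forall>x\<in>\<Omega>. \<forall>t. 0 < t \<and> ereal t < T \<longrightarrow>
        deriv (u x) t = laplacian (\<lambda>y. u y t) x + f (u x t)) \<and>
     (\<forall>x\<in>frontier \<Omega>. \<forall>t. 0 \<le> t \<and> ereal t < T \<longrightarrow> u x t = 0) \<and>
     (\<forall>x\<in>closure \<Omega>. u x 0 = u\<^sub>0 x)"

definition spacetime_sq_integral ::
  "'a::euclidean_space set \<Rightarrow> ('a \<Rightarrow> real \<Rightarrow> real) \<Rightarrow> real \<Rightarrow> real" where
  "spacetime_sq_integral \<Omega> u t = (LINT s:{0..t}|lborel. LINT x:\<Omega>|lborel. (u x s)\<^sup>2)"

text \<open>The lifespan \<open>T \<le> \<infinity>\<close> of a solution of the problem posed for all times \<open>t > 0\<close>: the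
  solution lives beyond every finite time up to which the space-time integral of \<open>u\<^sup>2\<close> stays
  bounded. For \<open>T = \<infinity>\<close> (the problem on \<open>\<Omega> \<times> (0,\<infinity>)\<close> taken literally) this is no restriction.
  Non-extendability as a classical solution would not be the right notion of lifespan: for
  \<open>f(u) = u\<^sup>5\<close> on an interval there are solutions with
  \<open>sup u(\<cdot>,t) \<le> C (T - t)\<^bsup>-1/4\<^esup> \<rightarrow> \<infinity>\<close>, for which \<open>\<integral>\<^bsub>0\<^esub>\<^bsup>T\<^esup>\<integral>\<^bsub>\<Omega>\<^esub> u\<^sup>2\<close> is finite.\<close>

definition lives_until_blow_up ::
  "'a::euclidean_space set \<Rightarrow> ereal \<Rightarrow> ('a \<Rightarrow> real \<Rightarrow> real) \<Rightarrow> bool" where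
  "lives_until_blow_up \<Omega> T u \<longleftrightarrow>
     (\<forall>S. ereal S \<le> T \<and> bdd_above (spacetime_sq_integral \<Omega> u ` {0..<S}) \<longrightarrow> ereal S < T)"

end

theory Submission
  imports Defs
begin

text \<open>The proof is Levine's concavity method. Write \<open>F\<close> for the primitive of \<open>f\<close>, \<open>J(t)\<close> for
\<open>- 1/2 \<integral>|\<nabla>u|\<^sup>2 + \<integral>(F(u) - \<gamma>)\<close> and \<open>a(t) = \<integral>u\<^sup>2\<close>. Testing the equation with \<open>u\<^sub>t\<close> gives
\<open>J' = \<integral>u\<^sub>t\<^sup>2\<close>; testing it with \<open>u\<close>, the growth condition on \<open>f\<close> and the Poincare inequality with constant
\<open>\<lambda>\<^sub>0\<close> give \<open>a' \<ge> 2 \<alpha> J\<close>. As \<open>\<alpha> > 2\<close> and \<open>J(0) > 0\<close>, the Cauchy-Schwarz inequality makes a negative power of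
\<open>M + \<integral>\<^sub>0\<^sup>t a\<close> concave for a suitable constant \<open>M\<close>, so it reaches \<open>0\<close> in finite time
(\<open>concavity_contradiction\<close>). Hence no solution can live for all times, and for a finite lifespan
the blow-up of the increasing function \<open>\<integral>\<^sub>0\<^sup>t\<integral>u\<^sup>2\<close> is what the notion of lifespan says.

The difficulty is that a classical solution is merely continuous up to the parabolic boundary:
neither \<open>\<nabla>u\<close> nor \<open>u\<^sub>t\<close> is known to be integrable, \<open>u\<^sub>t\<close> need not be differentiable in space, and the
initial gradient need not be attained. No regularity theory is used to overcome this. Instead \<open>u\<close> is
replaced by its average \<open>U(t) = (1/h) \<integral>\<^sub>t\<^bsup>t+h\<^esup> u\<close>. Its time derivative
\<open>D(t) = (u(t+h) - u(t)) / h\<close> is continuous up to the boundary, and so is its Laplacian,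
since \<open>- \<Delta>U = G - D\<close> with \<open>G\<close> the average of \<open>f(u)\<close>. Three observations carry the energy argument over to \<open>U\<close>.

\<^item> For a nonnegative function \<open>v\<close> with zero boundary values and bounded Laplacian, Green's identity
  holds without any boundary regularity. A nonnegative test function \<open>w\<close> can be truncated to a
  compactly supported one, and \<open>\<nabla>w = 0\<close> wherever \<open>w = 0\<close>, because such points are interior minima.
  The outcome is the convexity inequality \<open>dirichlet_convexity\<close> for the Dirichlet energy.

\<^item> Convexity alone determines the time derivative of the energy of \<open>U\<close>: the increment of the energy
  is squeezed between two expressions whose difference quotients have the same limit (\<open>energy_has_derivative\<close>).

\<^item> Convexity also controls the energy at time \<open>0\<close>: for suitable arbitrarily small \<open>h\<close> the
  average over \<open>[0,h]\<close> has energy at most that of \<open>u\<^sub>0\<close> up to an arbitrarily small error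
  (\<open>initial_energy_of_averages\<close>).

The concavity argument runs on a time interval whose length is fixed in advance, so \<open>h\<close> can
be chosen so small that all errors are absorbed by the strict inequalities \<open>\<alpha> > 2\<close> and \<open>J(0) > 0\<close>
(\<open>smoothed_flow_contradiction\<close>).\<close>

section \<open>Integration by parts and truncation\<close>

lemma compact_support_bounded:
  fixes h :: "'a::euclidean_space \<Rightarrow> real"
  assumes K: "compact K" and h: "continuous_on UNIV h" "\<And>x. x \<notin> K \<Longrightarrow> h x = 0"
  obtains B where "\<And>x. \<bar>h x\<bar> \<le> B"
proof -
  have "bounded (h ` K)"
    using K h by (intro compact_imp_bounded compact_continuous_image)
      (auto intro: continuous_on_subset)
  then obtain B where "\<And>x. x \<in> K \<Longrightarrow> \<bar>h x\<bar> \<le> B"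
    by (auto simp: bounded_iff)
  then have "\<bar>h x\<bar> \<le> max 0 B" for x
    using h(2)[of x] by (cases "x \<in> K") (auto simp: le_max_iff_disj)
  then show ?thesis by (rule that)
qed

lemma integrable_compact_support:
  fixes g :: "'a::euclidean_space \<Rightarrow> real"
  assumes K: "compact K" and g_cont: "continuous_on UNIV g" and g_zero: "\<And>x. x \<notin> K \<Longrightarrow> g x = 0"
  shows "integrable lborel g"
proof -
  obtain C where C: "\<And>x. \<bar>g x\<bar> \<le> C"
    using compact_support_bounded[OF K g_cont g_zero] by blast
  have Ki: "integrable lborel (\<lambda>x. indicat_real K x * C)"
    using emeasure_compact_finite[OF K] K by (intro integrable_mult_left integrable_real_indicator)
      (auto simp: borel_compact)
  show ?thesis
  proof (rule Bochner_Integration.integrable_bound[OF Ki])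
    show "g \<in> borel_measurable lborel"
      using borel_measurable_continuous_onI[OF g_cont] by simp
    show "AE x in lborel. norm (g x) \<le> norm (indicat_real K x * C)"
      using C g_zero by (intro AE_I2) (auto simp: indicator_def intro: order_trans[OF _ abs_ge_self])
  qed
qed

text \<open>Translation invariance of Lebesgue measure makes the integral of every difference quotient
  vanish; the difference quotients are dominated because the derivative is bounded with compact
  support.\<close>

lemma integral_directional_derivative_eq_0:
  fixes g g' :: "'a::euclidean_space \<Rightarrow> real" and b :: 'a
  assumes K: "compact K"
    and g_cont: "continuous_on UNIV g" and g'_cont: "continuous_on UNIV g'"
    and g_zero: "\<And>x. x \<notin> K \<Longrightarrow> g x = 0" and g'_zero: "\<And>x. x \<notin> K \<Longrightarrow> g' x = 0"
    and der: "\<And>x. ((\<lambda>s. g (x + s *\<^sub>R b)) has_real_derivative g' x) (at 0)"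
  shows "(LINT x|lborel. g' x) = 0"
proof -
  obtain B where B: "\<And>x. \<bar>g' x\<bar> \<le> B"
    using compact_support_bounded[OF K g'_cont g'_zero] by blast
  have B0: "0 \<le> B" using B[of undefined] by linarith
  have g_int: "integrable lborel g"
    by (rule integrable_compact_support[OF K g_cont g_zero])
  define K' where "K' = {x + y | x y. x \<in> K \<and> y \<in> cball 0 (norm b)}"
  have K': "compact K'"
    unfolding K'_def by (intro compact_sums K compact_cball)
  define q where "q n x = (g (x + (1 / real (Suc n)) *\<^sub>R b) - g x) * real (Suc n)" for n x
  have der': "((\<lambda>s. g (x + s *\<^sub>R b)) has_real_derivative g' (x + s *\<^sub>R b)) (at s)" for x s
    using der[of "x + s *\<^sub>R b"] DERIV_shift[of "\<lambda>r. g (x + r *\<^sub>R b)" "g' (x + s *\<^sub>R b)" 0 s]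
    by (simp add: algebra_simps)
  have q_bound: "\<bar>q n x\<bar> \<le> B" for n x
  proof -
    define r where "r = 1 / real (Suc n)"
    have r: "0 < r" by (simp add: r_def)
    \<comment> \<open>the mean value theorem on the segment keeps the quotients below the bound for \<open>g'\<close>\<close>
    obtain z where z: "g (x + r *\<^sub>R b) - g (x + 0 *\<^sub>R b) = (r - 0) * g' (x + z *\<^sub>R b)"
      using MVT2[OF r, of "\<lambda>s. g (x + s *\<^sub>R b)" "\<lambda>s. g' (x + s *\<^sub>R b)"] der' by blast
    have "q n x = g' (x + z *\<^sub>R b)"
      using z r by (simp add: q_def r_def field_simps)
    then show ?thesis using B by simp
  qed
  have q_zero: "q n x = 0" if "x \<notin> K'" for n x
  proof -
    have "x + (1 / real (Suc n)) *\<^sub>R b \<notin> K"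
    proof
      assume *: "x + (1 / real (Suc n)) *\<^sub>R b \<in> K"
      have "1 / real (Suc n) * norm b \<le> 1 * norm b"
        by (intro mult_right_mono) auto
      then have "- ((1 / real (Suc n)) *\<^sub>R b) \<in> cball 0 (norm b)" by simp
      with * have "x + (1 / real (Suc n)) *\<^sub>R b + - ((1 / real (Suc n)) *\<^sub>R b) \<in> K'"
        unfolding K'_def by blast
      with that show False by simp
    qed
    moreover have "x \<notin> K"
    proof
      assume "x \<in> K"
      moreover have "0 \<in> cball (0::'a) (norm b)" by simp
      ultimately have "x + 0 \<in> K'" unfolding K'_def by blast
      with that show False by simp
    qed
    ultimately show ?thesis by (simp add: q_def g_zero)
  qed
  have shift: "integrable lborel (\<lambda>x. g (x + c)) \<and> (LINT x|lborel. g (x + c)) = (LINT x|lborel. g x)" for c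
  proof -
    have "integrable (distr lborel borel ((+) c)) g"
      using g_int by (simp add: lborel_distr_plus)
    then have "integrable lborel (\<lambda>x. g (c + x))"
      by (subst (asm) integrable_distr_eq) (auto simp: borel_measurable_continuous_onI[OF g_cont])
    moreover have "(LINT x|lborel. g x) = (LINT x|distr lborel borel ((+) c). g x)"
      by (simp add: lborel_distr_plus)
    moreover have "\<dots> = (LINT x|lborel. g (c + x))"
      by (subst integral_distr) (auto simp: borel_measurable_continuous_onI[OF g_cont])
    ultimately show ?thesis by (simp add: add.commute)
  qed
  have q_int: "(LINT x|lborel. q n x) = 0" for n
    unfolding q_def using shift[of "(1 / real (Suc n)) *\<^sub>R b"] g_int by simp
  have "(\<lambda>n. LINT x|lborel. q n x) \<longlonglongrightarrow> (LINT x|lborel. g' x)"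
  proof (rule integral_dominated_convergence[where w = "\<lambda>x. indicat_real K' x * B"])
    show "g' \<in> borel_measurable lborel"
      using borel_measurable_continuous_onI[OF g'_cont] by simp
    show "q n \<in> borel_measurable lborel" for n
    proof -
      have "continuous_on UNIV (q n)"
        unfolding q_def by (intro continuous_intros continuous_on_compose2[OF g_cont]) auto
      then show ?thesis using borel_measurable_continuous_onI by simp
    qed
    show "integrable lborel (\<lambda>x. indicat_real K' x * B)"
      using emeasure_compact_finite[OF K'] K' by (intro integrable_mult_left integrable_real_indicator)
        (auto simp: borel_compact)
    show "AE x in lborel. norm (q n x) \<le> indicat_real K' x * B" for n
      using q_bound q_zero by (intro AE_I2) (auto simp: indicator_def)
    show "AE x in lborel. (\<lambda>n. q n x) \<longlonglongrightarrow> g' x"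
    proof (intro AE_I2)
      fix x
      have "((\<lambda>h. (g (x + (0 + h) *\<^sub>R b) - g (x + 0 *\<^sub>R b)) / h) \<longlongrightarrow> g' x) (at 0)"
        using der[of x] unfolding DERIV_def by simp
      moreover have "filterlim (\<lambda>n. 1 / real (Suc n)) (at 0) sequentially"
        using LIMSEQ_inverse_real_of_nat by (simp add: filterlim_at divide_inverse)
      ultimately have "(\<lambda>n. (g (x + (0 + 1 / real (Suc n)) *\<^sub>R b) - g (x + 0 *\<^sub>R b)) / (1 / real (Suc n)))
          \<longlonglongrightarrow> g' x"
        by (rule filterlim_compose)
      then show "(\<lambda>n. q n x) \<longlonglongrightarrow> g' x"
        by (simp add: q_def)
    qed
  qed
  then show ?thesis
    using q_int by (simp add: LIMSEQ_const_iff)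
qed

text \<open>For \<open>s > e\<close> this is \<open>(s - e)\<^sup>2 / s\<close>. It is a continuously
  differentiable truncation that vanishes for \<open>s \<le> e\<close>, and its derivative
  \<open>1 - (e/s)\<^sup>2\<close> lies in \<open>[0,1]\<close> and increases to \<open>1\<close>
  as \<open>e\<close> decreases to \<open>0\<close>. The form with \<open>max\<close> has a
  denominator that never vanishes.\<close>

definition soft_threshold :: "real \<Rightarrow> real \<Rightarrow> real" where
  "soft_threshold e s = (max 0 (s - e))\<^sup>2 / (max 0 (s - e) + e)"

definition soft_threshold_deriv :: "real \<Rightarrow> real \<Rightarrow> real" where
  "soft_threshold_deriv e s = 1 - (e / (max 0 (s - e) + e))\<^sup>2"

lemma soft_threshold_has_derivative:
  assumes e: "0 < e"
  shows "(soft_threshold e has_real_derivative soft_threshold_deriv e s) (at s)"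
proof -
  consider "s < e" | "s = e" | "e < s" by linarith
  then show ?thesis
  proof cases
    case 1
    have "((\<lambda>_. 0) has_real_derivative soft_threshold_deriv e s) (at s)"
      using 1 e by (simp add: soft_threshold_deriv_def)
    then show ?thesis
      by (rule has_field_derivative_transform_within_open[where S = "{..<e}"])
        (use 1 in \<open>auto simp: soft_threshold_def\<close>)
  next
    case 2
    have "((\<lambda>y. soft_threshold e y / (y - e)) \<longlongrightarrow> 0) (at e)"
    proof (rule Lim_null_comparison)
      show "\<forall>\<^sub>F y in at e. norm (soft_threshold e y / (y - e)) \<le> \<bar>y - e\<bar> / e"
      proof (intro always_eventually allI)
        fix y :: real
        show "norm (soft_threshold e y / (y - e)) \<le> \<bar>y - e\<bar> / e"
        proof (cases "e < y")
          case True
          then have "soft_threshold e y / (y - e) = (y - e) / y"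
            by (simp add: soft_threshold_def power2_eq_square)
          also have "\<dots> \<le> (y - e) / e"
            using True e by (intro divide_left_mono) auto
          finally show ?thesis
            using True e by (simp add: soft_threshold_def)
        qed (use e in \<open>simp add: soft_threshold_def\<close>)
      qed
      have "((\<lambda>y. \<bar>y - e\<bar> / e) \<longlongrightarrow> \<bar>e - e\<bar> / e) (at e)"
        using e by (intro tendsto_intros) auto
      then show "((\<lambda>y. \<bar>y - e\<bar> / e) \<longlongrightarrow> 0) (at e)" by simp
    qed
    then show ?thesis
      using 2 e by (simp add: has_field_derivative_iff soft_threshold_def soft_threshold_deriv_def)
  next
    case 3
    have "((\<lambda>y. (y - e)\<^sup>2 / y) has_real_derivative 1 - (e / s)\<^sup>2) (at s)"
      using 3 e by (auto intro!: derivative_eq_intros simp: power2_eq_square field_simps)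
    then have "((\<lambda>y. (y - e)\<^sup>2 / y) has_real_derivative soft_threshold_deriv e s) (at s)"
      using 3 by (simp add: soft_threshold_deriv_def)
    then show ?thesis
      by (rule has_field_derivative_transform_within_open[where S = "{e<..}"])
        (use 3 in \<open>auto simp: soft_threshold_def\<close>)
  qed
qed

lemma soft_threshold_deriv_continuous:
  "0 < e \<Longrightarrow> continuous_on UNIV (soft_threshold_deriv e)"
  unfolding soft_threshold_deriv_def by (intro continuous_intros) (auto simp: add_nonneg_eq_0_iff)

lemma soft_threshold_eq_0: "s \<le> e \<Longrightarrow> soft_threshold e s = 0"
  and soft_threshold_deriv_eq_0: "s \<le> e \<Longrightarrow> 0 < e \<Longrightarrow> soft_threshold_deriv e s = 0"
  by (auto simp: soft_threshold_def soft_threshold_deriv_def)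

lemma soft_threshold_bounds:
  assumes "0 < e" "0 \<le> s"
  shows "0 \<le> soft_threshold e s" "soft_threshold e s \<le> s"
proof -
  show "0 \<le> soft_threshold e s"
    using assms by (auto simp: soft_threshold_def)
  have "(s - e) * (s - e) \<le> s * s" if "e \<le> s"
    using that assms by (intro mult_mono) auto
  then show "soft_threshold e s \<le> s"
    using assms by (auto simp: soft_threshold_def max_def power2_eq_square field_simps)
qed

lemma soft_threshold_deriv_bounds:
  assumes "0 < e"
  shows "0 \<le> soft_threshold_deriv e s" "soft_threshold_deriv e s \<le> 1"
  using assms by (auto simp: soft_threshold_deriv_def abs_square_le_1)

lemma soft_threshold_deriv_antimono:
  assumes "0 < e" "e \<le> e'"
  shows "soft_threshold_deriv e' s \<le> soft_threshold_deriv e s"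
proof -
  have "e / (max 0 (s - e) + e) \<le> e' / (max 0 (s - e') + e')"
  proof (cases "s \<le> e'")
    case True
    then show ?thesis using assms by (simp add: max_def)
  next
    case False
    then show ?thesis using assms by (simp add: divide_right_mono)
  qed
  then have "(e / (max 0 (s - e) + e))\<^sup>2 \<le> (e' / (max 0 (s - e') + e'))\<^sup>2"
    using assms by (intro power_mono) auto
  then show ?thesis by (simp add: soft_threshold_deriv_def)
qed

lemma soft_threshold_tendsto:
  assumes s: "0 \<le> s"
  shows "(\<lambda>n. soft_threshold (1 / real (Suc n)) s) \<longlonglongrightarrow> s"
proof (cases "s = 0")
  case True
  then show ?thesis by (simp add: soft_threshold_eq_0)
next
  case False
  have e: "(\<lambda>n. 1 / real (Suc n)) \<longlonglongrightarrow> 0"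
    using LIMSEQ_inverse_real_of_nat by (simp add: divide_inverse)
  have "(\<lambda>n. soft_threshold (1 / real (Suc n)) s) \<longlonglongrightarrow> (max 0 (s - 0))\<^sup>2 / (max 0 (s - 0) + 0)"
    unfolding soft_threshold_def using False s by (intro tendsto_intros e) auto
  then show ?thesis using False s by (simp add: power2_eq_square)
qed

lemma soft_threshold_deriv_tendsto:
  assumes s: "0 < s"
  shows "(\<lambda>n. soft_threshold_deriv (1 / real (Suc n)) s) \<longlonglongrightarrow> 1"
proof -
  have e: "(\<lambda>n. 1 / real (Suc n)) \<longlonglongrightarrow> 0"
    using LIMSEQ_inverse_real_of_nat by (simp add: divide_inverse)
  have "(\<lambda>n. soft_threshold_deriv (1 / real (Suc n)) s)
      \<longlonglongrightarrow> 1 - (0 / (max 0 (s - 0) + 0))\<^sup>2"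
    unfolding soft_threshold_deriv_def using s by (intro tendsto_intros e) auto
  then show ?thesis by simp
qed

section \<open>Green's identity and the Dirichlet energy\<close>

lemma Ck_on_1_iff:
  "Ck_on 1 v \<Omega> \<longleftrightarrow>
    (\<forall>x\<in>\<Omega>. v differentiable (at x)) \<and> (\<forall>b\<in>Basis. continuous_on \<Omega> (partial_deriv b v))"
  by (simp add: One_nat_def)

lemma Ck_on_2_iff:
  "Ck_on 2 v \<Omega> \<longleftrightarrow>
    (\<forall>x\<in>\<Omega>. v differentiable (at x)) \<and> (\<forall>b\<in>Basis. Ck_on 1 (partial_deriv b v) \<Omega>)"
  by (simp add: numeral_2_eq_2)

lemma differentiable_imp_continuous_on_at:
  "(\<And>x. x \<in> \<Omega> \<Longrightarrow> v differentiable (at x)) \<Longrightarrow> continuous_on \<Omega> v"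
  by (auto intro!: continuous_at_imp_continuous_on differentiable_imp_continuous_within)

lemma Ck_on_2_imp_1:
  assumes "Ck_on 2 v \<Omega>"
  shows "Ck_on 1 v \<Omega>"
  using assms
  unfolding Ck_on_1_iff Ck_on_2_iff by (auto intro: differentiable_imp_continuous_on_at)

lemma directional_derivative:
  fixes g :: "'a::euclidean_space \<Rightarrow> real"
  assumes "(g has_derivative G) (at x)"
  shows "((\<lambda>s. g (x + s *\<^sub>R b)) has_real_derivative G b) (at 0)"
proof -
  have "((\<lambda>s. x + s *\<^sub>R b) has_derivative (\<lambda>s. s *\<^sub>R b)) (at 0)"
    by (auto intro!: derivative_eq_intros)
  moreover have "(g has_derivative G) (at (x + 0 *\<^sub>R b))" using assms by simp
  ultimately have "((\<lambda>s. g (x + s *\<^sub>R b)) has_derivative (\<lambda>s. G (s *\<^sub>R b))) (at 0)"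
    by (rule has_derivative_compose)
  moreover have "(\<lambda>s. G (s *\<^sub>R b)) = (*) (G b)"
    using has_derivative_linear[OF assms] by (auto simp: linear_cmul mult.commute)
  ultimately show ?thesis
    by (simp add: has_field_derivative_def)
qed

text \<open>The test functions. Nonnegativity is what allows truncation from one side, and it forces the
  gradient to vanish at interior zeros.\<close>

definition nonneg_zero_trace :: "'a::euclidean_space set \<Rightarrow> ('a \<Rightarrow> real) \<Rightarrow> bool" where
  "nonneg_zero_trace \<Omega> v \<longleftrightarrow>
     continuous_on (closure \<Omega>) v \<and> (\<forall>x\<in>frontier \<Omega>. v x = 0) \<and> (\<forall>x\<in>\<Omega>. 0 \<le> v x)"

text \<open>The set where \<open>w \<ge> e\<close> is a compact subset of \<open>\<Omega>\<close>, since
  \<open>w\<close> vanishes on the frontier. Hence the product of the truncated \<open>w\<close>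
  with \<open>h\<close>, extended by zero, is continuously differentiable with compact support,
  whatever the behaviour of \<open>h\<close> near the boundary.\<close>

lemma truncated_integration_by_parts:
  fixes w h :: "'a::euclidean_space \<Rightarrow> real"
  assumes \<Omega>: "open \<Omega>" "bounded \<Omega>"
    and w: "nonneg_zero_trace \<Omega> w" "Ck_on 1 w \<Omega>"
    and h: "Ck_on 1 h \<Omega>" and e: "0 < e" and b: "b \<in> Basis"
  shows "set_integrable lborel \<Omega> (\<lambda>x. soft_threshold_deriv e (w x) * (partial_deriv b w x * h x))"
    (is "set_integrable _ _ ?A")
    and "set_integrable lborel \<Omega> (\<lambda>x. soft_threshold e (w x) * partial_deriv b h x)"
    (is "set_integrable _ _ ?B")
    and "(LINT x:\<Omega>|lborel. soft_threshold_deriv e (w x) * (partial_deriv b w x * h x)) =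
      - (LINT x:\<Omega>|lborel. soft_threshold e (w x) * partial_deriv b h x)"
proof -
  define K where "K = {x \<in> closure \<Omega>. e \<le> w x}"
  have w_cont: "continuous_on (closure \<Omega>) w"
    using w by (simp add: nonneg_zero_trace_def)
  have "closed K"
    unfolding K_def using w_cont by (intro continuous_on_closed_Collect_le continuous_intros) auto
  moreover have "bounded K"
    using \<Omega> by (auto simp: K_def intro: bounded_subset[OF bounded_closure])
  ultimately have K: "compact K" by (simp add: compact_eq_bounded_closed)
  have "x \<in> \<Omega>" if "x \<in> K" for x
  proof (rule ccontr)
    assume "x \<notin> \<Omega>"
    then have "x \<in> frontier \<Omega>"
      using that \<Omega> by (auto simp: K_def frontier_def interior_open)
    then show False
      using that w e by (auto simp: K_def nonneg_zero_trace_def)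
  qed
  then have K\<Omega>: "K \<subseteq> \<Omega>" by blast
  have outside: "w x \<le> e" if "x \<in> \<Omega>" "x \<notin> K" for x
    using that closure_subset[of \<Omega>] by (auto simp: K_def)
  have \<Omega>_cont: "continuous_on \<Omega> w"
    using w_cont closure_subset continuous_on_subset by blast
  have extend: "continuous_on UNIV (\<lambda>x. indicat_real \<Omega> x *\<^sub>R F x)"
    if "continuous_on \<Omega> F" "\<And>x. x \<in> \<Omega> \<Longrightarrow> x \<notin> K \<Longrightarrow> F x = 0" for F :: "'a \<Rightarrow> real"
  proof -
    have "continuous_on \<Omega> (\<lambda>x. indicat_real \<Omega> x *\<^sub>R F x)"
      using that(1) by (rule continuous_on_eq) auto
    moreover have "continuous_on (- K) (\<lambda>x. indicat_real \<Omega> x *\<^sub>R F x)"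
      by (rule continuous_on_eq[OF continuous_on_const[of _ 0]]) (auto simp: indicator_def that)
    ultimately have "continuous_on (\<Omega> \<union> - K) (\<lambda>x. indicat_real \<Omega> x *\<^sub>R F x)"
      using \<open>closed K\<close> \<Omega> by (intro continuous_on_open_Un) auto
    moreover have "\<Omega> \<union> - K = UNIV" using K\<Omega> by auto
    ultimately show ?thesis by simp
  qed
  have int: "set_integrable lborel \<Omega> F"
    if "continuous_on \<Omega> F" "\<And>x. x \<in> \<Omega> \<Longrightarrow> x \<notin> K \<Longrightarrow> F x = 0" for F :: "'a \<Rightarrow> real"
    unfolding set_integrable_def using that K\<Omega>
    by (intro integrable_compact_support[OF K extend]) (auto simp: indicator_def)
  have h_cont: "continuous_on \<Omega> h"
    using h by (auto simp: Ck_on_1_iff intro: differentiable_imp_continuous_on_at)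
  have T_cont: "continuous_on \<Omega> (\<lambda>x. soft_threshold e (w x))"
    by (rule continuous_on_compose2[OF DERIV_continuous_on[of UNIV] \<Omega>_cont])
      (auto intro: soft_threshold_has_derivative[OF e] has_field_derivative_at_within)
  have T'_cont: "continuous_on \<Omega> (\<lambda>x. soft_threshold_deriv e (w x))"
    by (rule continuous_on_compose2[OF soft_threshold_deriv_continuous[OF e] \<Omega>_cont]) auto
  have A_cont: "continuous_on \<Omega> ?A" and B_cont: "continuous_on \<Omega> ?B"
    using w h b by (auto simp: Ck_on_1_iff intro!: continuous_intros T_cont T'_cont h_cont)
  have A_zero: "?A x = 0" and B_zero: "?B x = 0" and Th_zero: "soft_threshold e (w x) * h x = 0"
    if "x \<in> \<Omega>" "x \<notin> K" for x
    using outside[OF that] e by (simp_all add: soft_threshold_eq_0 soft_threshold_deriv_eq_0)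
  show A: "set_integrable lborel \<Omega> ?A" and B: "set_integrable lborel \<Omega> ?B"
    using int A_cont A_zero B_cont B_zero by blast+
  have "(LINT x|lborel. indicat_real \<Omega> x *\<^sub>R (?A x + ?B x)) = 0"
  proof (rule integral_directional_derivative_eq_0[OF K,
      where g = "\<lambda>x. indicat_real \<Omega> x *\<^sub>R (soft_threshold e (w x) * h x)" and b = b])
    show "continuous_on UNIV (\<lambda>x. indicat_real \<Omega> x *\<^sub>R (soft_threshold e (w x) * h x))"
      using Th_zero by (intro extend continuous_intros T_cont h_cont)
    show "continuous_on UNIV (\<lambda>x. indicat_real \<Omega> x *\<^sub>R (?A x + ?B x))"
      by (intro extend continuous_on_add A_cont B_cont) (simp only: A_zero B_zero add_0_left not_False_eq_True)
    show "indicat_real \<Omega> x *\<^sub>R (soft_threshold e (w x) * h x) = 0" if "x \<notin> K" for x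
      using Th_zero[of x] that by (auto simp: indicator_def)
    show "indicat_real \<Omega> x *\<^sub>R (?A x + ?B x) = 0" if "x \<notin> K" for x
      using A_zero[of x] B_zero[of x] that by (auto simp: indicator_def)
    show "((\<lambda>s. indicat_real \<Omega> (x + s *\<^sub>R b) *\<^sub>R (soft_threshold e (w (x + s *\<^sub>R b)) * h (x + s *\<^sub>R b)))
        has_real_derivative indicat_real \<Omega> x *\<^sub>R (?A x + ?B x)) (at 0)" for x
    proof (cases "x \<in> \<Omega>")
      case True
      have dw: "(w has_derivative frechet_derivative w (at x)) (at x)"
        and dh: "(h has_derivative frechet_derivative h (at x)) (at x)"
        using True w h by (auto simp: Ck_on_1_iff frechet_derivative_works[symmetric])
      have "((\<lambda>x. soft_threshold e (w x)) has_derivative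
          (\<lambda>y. frechet_derivative w (at x) y * soft_threshold_deriv e (w x))) (at x)"
        using DERIV_compose_FDERIV[OF soft_threshold_has_derivative[OF e] dw] .
      from has_derivative_mult[OF this dh]
      have "((\<lambda>x. indicat_real \<Omega> x *\<^sub>R (soft_threshold e (w x) * h x)) has_derivative
         (\<lambda>y. soft_threshold e (w x) * frechet_derivative h (at x) y +
           frechet_derivative w (at x) y * soft_threshold_deriv e (w x) * h x)) (at x)"
        by (rule has_derivative_transform_within_open[OF _ \<Omega>(1) True]) auto
      from directional_derivative[OF this, of b] show ?thesis
        using True by (simp add: partial_deriv_def algebra_simps)
    next
      case False
      then have "x \<in> - K" using K\<Omega> by auto
      moreover have "open (- K)" using \<open>closed K\<close> by auto
      ultimately have "((\<lambda>x. indicat_real \<Omega> x *\<^sub>R (soft_threshold e (w x) * h x)) has_derivative (\<lambda>_. 0)) (at x)"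
        using Th_zero
        by (intro has_derivative_transform_within_open[OF has_derivative_const[of 0]])
          (auto simp: indicator_def)
      from directional_derivative[OF this, of b] show ?thesis
        using False by simp
    qed
  qed
  then have "(LINT x:\<Omega>|lborel. ?A x + ?B x) = 0"
    by (simp add: set_lebesgue_integral_def)
  then show "(LINT x:\<Omega>|lborel. ?A x) = - (LINT x:\<Omega>|lborel. ?B x)"
    using set_integral_add[OF A B] by simp
qed

lemma gradient_inner:
  "gradient v x \<bullet> gradient w x = (\<Sum>b\<in>Basis. partial_deriv b v x * partial_deriv b w x)"
  by (simp add: gradient_def inner_sum_left inner_sum_right inner_Basis if_distrib[of "(*) _"]
      sum.delta' cong: if_cong) (simp add: mult.commute)

lemma borel_measurable_open_indicator:
  fixes F :: "'a::euclidean_space \<Rightarrow> real"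
  assumes "open \<Omega>" "continuous_on \<Omega> F"
  shows "(\<lambda>x. indicat_real \<Omega> x *\<^sub>R F x) \<in> borel_measurable lborel"
  using borel_measurable_continuous_on_indicator[of \<Omega> F] assms by simp

lemma set_integrable_bounded:
  fixes F :: "'a::euclidean_space \<Rightarrow> real"
  assumes "open \<Omega>" "bounded \<Omega>" and F: "continuous_on \<Omega> F" "\<And>x. x \<in> \<Omega> \<Longrightarrow> \<bar>F x\<bar> \<le> B"
  shows "set_integrable lborel \<Omega> F"
  unfolding set_integrable_def
proof (rule Bochner_Integration.integrable_bound[of _ "\<lambda>x. indicat_real \<Omega> x * B"])
  show "integrable lborel (\<lambda>x. indicat_real \<Omega> x * B)"
    using assms emeasure_bounded_finite[of \<Omega>]
    by (intro integrable_mult_left integrable_real_indicator) auto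
  show "(\<lambda>x. indicat_real \<Omega> x *\<^sub>R F x) \<in> borel_measurable lborel"
    using borel_measurable_continuous_on_indicator[of \<Omega> F] assms by simp
  show "AE x in lborel. norm (indicat_real \<Omega> x *\<^sub>R F x) \<le> norm (indicat_real \<Omega> x * B)"
    using F(2) by (intro AE_I2) (auto simp: indicator_def intro: order_trans[OF _ abs_ge_self])
qed

lemma nonneg_zero_trace_bounded:
  assumes "bounded \<Omega>" "nonneg_zero_trace \<Omega> v"
  obtains B where "\<And>x. x \<in> \<Omega> \<Longrightarrow> \<bar>v x\<bar> \<le> B"
proof -
  have "bounded (v ` closure \<Omega>)"
    using assms unfolding nonneg_zero_trace_def
    by (intro compact_imp_bounded compact_continuous_image) (auto simp: compact_closure)
  then show ?thesis
    using that closure_subset[of \<Omega>] by (auto simp: bounded_iff subset_iff)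
qed

lemma nonneg_zero_trace_continuous: "nonneg_zero_trace \<Omega> v \<Longrightarrow> continuous_on \<Omega> v"
  unfolding nonneg_zero_trace_def using closure_subset by (auto intro: continuous_on_subset)

text \<open>Such a point is an interior minimum. Without this fact the limit of the truncated identities
  would only see the set where \<open>v > 0\<close>.\<close>

lemma gradient_eq_0_at_zero:
  assumes "open \<Omega>" "nonneg_zero_trace \<Omega> v" "Ck_on 1 v \<Omega>" "x \<in> \<Omega>" "v x = 0"
  shows "gradient v x = 0"
proof -
  have "frechet_derivative v (at x) = (\<lambda>_. 0)"
    using assms
    by (intro differential_zero_maxmin[of x \<Omega> v])
      (auto simp: nonneg_zero_trace_def Ck_on_1_iff frechet_derivative_works[symmetric])
  then show ?thesis by (simp add: gradient_def partial_deriv_def)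
qed

lemma Ck_on_2_laplacian_continuous:
  "Ck_on 2 v \<Omega> \<Longrightarrow> continuous_on \<Omega> (laplacian v)"
  unfolding laplacian_def Ck_on_2_iff Ck_on_1_iff by (auto intro!: continuous_intros)

lemma gradient_continuous:
  "Ck_on 1 v \<Omega> \<Longrightarrow> continuous_on \<Omega> (gradient v)"
  unfolding gradient_def Ck_on_1_iff by (auto intro!: continuous_intros)

lemma truncated_green:
  fixes v w :: "'a::euclidean_space \<Rightarrow> real"
  assumes \<Omega>: "open \<Omega>" "bounded \<Omega>"
    and w: "nonneg_zero_trace \<Omega> w" "Ck_on 1 w \<Omega>"
    and v: "Ck_on 2 v \<Omega>" and e: "0 < e"
  shows "set_integrable lborel \<Omega> (\<lambda>x. soft_threshold_deriv e (w x) * (gradient w x \<bullet> gradient v x))"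
    and "(LINT x:\<Omega>|lborel. soft_threshold_deriv e (w x) * (gradient w x \<bullet> gradient v x)) =
      - (LINT x:\<Omega>|lborel. soft_threshold e (w x) * laplacian v x)"
proof -
  have h: "Ck_on 1 (partial_deriv b v) \<Omega>" if "b \<in> Basis" for b
    using v that by (simp add: Ck_on_2_iff)
  note ibp = truncated_integration_by_parts[OF \<Omega> w h e]
  have L: "indicat_real \<Omega> x *\<^sub>R (soft_threshold_deriv e (w x) * (gradient w x \<bullet> gradient v x)) =
      (\<Sum>b\<in>Basis. indicat_real \<Omega> x *\<^sub>R
        (soft_threshold_deriv e (w x) * (partial_deriv b w x * partial_deriv b v x)))" for x
    by (simp add: gradient_inner sum_distrib_left)
  have R: "indicat_real \<Omega> x *\<^sub>R (soft_threshold e (w x) * laplacian v x) =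
      (\<Sum>b\<in>Basis. indicat_real \<Omega> x *\<^sub>R
        (soft_threshold e (w x) * partial_deriv b (partial_deriv b v) x))" for x
    by (simp add: laplacian_def sum_distrib_left)
  show "set_integrable lborel \<Omega> (\<lambda>x. soft_threshold_deriv e (w x) * (gradient w x \<bullet> gradient v x))"
    unfolding set_integrable_def L
    using ibp(1) by (intro Bochner_Integration.integrable_sum) (simp add: set_integrable_def)
  show "(LINT x:\<Omega>|lborel. soft_threshold_deriv e (w x) * (gradient w x \<bullet> gradient v x)) =
      - (LINT x:\<Omega>|lborel. soft_threshold e (w x) * laplacian v x)"
    unfolding set_lebesgue_integral_def L R
    using ibp
    by (subst (1 2) Bochner_Integration.integral_sum)
      (auto simp: set_integrable_def set_lebesgue_integral_def sum_negf[symmetric] intro!: sum.cong)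
qed

lemma truncated_laplacian_tendsto:
  fixes v w :: "'a::euclidean_space \<Rightarrow> real"
  assumes \<Omega>: "open \<Omega>" "bounded \<Omega>"
    and w: "nonneg_zero_trace \<Omega> w"
    and v: "Ck_on 2 v \<Omega>" and C: "\<And>x. x \<in> \<Omega> \<Longrightarrow> \<bar>laplacian v x\<bar> \<le> C"
  shows "(\<lambda>n. LINT x:\<Omega>|lborel. soft_threshold (1 / real (Suc n)) (w x) * laplacian v x)
    \<longlonglongrightarrow> (LINT x:\<Omega>|lborel. w x * laplacian v x)"
proof -
  obtain B where B: "\<And>x. x \<in> \<Omega> \<Longrightarrow> \<bar>w x\<bar> \<le> B"
    using nonneg_zero_trace_bounded[OF \<Omega>(2) w] by blast
  have w_nonneg: "0 \<le> w x" if "x \<in> \<Omega>" for x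
    using w that by (simp add: nonneg_zero_trace_def)
  have w_cont: "continuous_on \<Omega> w"
    by (rule nonneg_zero_trace_continuous[OF w])
  show ?thesis
    unfolding set_lebesgue_integral_def
  proof (rule integral_dominated_convergence[where w = "\<lambda>x. indicat_real \<Omega> x * (B * C)"])
    show "(\<lambda>x. indicat_real \<Omega> x *\<^sub>R (w x * laplacian v x)) \<in> borel_measurable lborel"
      by (intro borel_measurable_open_indicator \<Omega>(1) continuous_on_mult w_cont
          Ck_on_2_laplacian_continuous[OF v])
    show "(\<lambda>x. indicat_real \<Omega> x *\<^sub>R (soft_threshold (1 / real (Suc n)) (w x) * laplacian v x))
        \<in> borel_measurable lborel" for n
    proof -
      have "continuous_on UNIV (soft_threshold (1 / real (Suc n)))"
        by (rule DERIV_continuous_on)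
          (auto intro!: soft_threshold_has_derivative[THEN has_field_derivative_at_within])
      then have "continuous_on \<Omega> (\<lambda>x. soft_threshold (1 / real (Suc n)) (w x))"
        using w_cont by (rule continuous_on_compose2) auto
      then show ?thesis
        by (intro borel_measurable_open_indicator \<Omega>(1) continuous_on_mult
            Ck_on_2_laplacian_continuous[OF v])
    qed
    show "integrable lborel (\<lambda>x. indicat_real \<Omega> x * (B * C))"
      using \<Omega> emeasure_bounded_finite[of \<Omega>]
      by (intro integrable_mult_left integrable_real_indicator) auto
    show "AE x in lborel. (\<lambda>n. indicat_real \<Omega> x *\<^sub>R
          (soft_threshold (1 / real (Suc n)) (w x) * laplacian v x))
        \<longlonglongrightarrow> indicat_real \<Omega> x *\<^sub>R (w x * laplacian v x)"
    proof (intro AE_I2)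
      fix x
      show "(\<lambda>n. indicat_real \<Omega> x *\<^sub>R (soft_threshold (1 / real (Suc n)) (w x) * laplacian v x))
        \<longlonglongrightarrow> indicat_real \<Omega> x *\<^sub>R (w x * laplacian v x)"
      proof (cases "x \<in> \<Omega>")
        case True
        show ?thesis by (intro tendsto_intros soft_threshold_tendsto w_nonneg True)
      qed simp
    qed
    show "AE x in lborel. norm (indicat_real \<Omega> x *\<^sub>R
        (soft_threshold (1 / real (Suc n)) (w x) * laplacian v x)) \<le> indicat_real \<Omega> x * (B * C)" for n
    proof (intro AE_I2)
      fix x
      have "\<bar>soft_threshold (1 / real (Suc n)) (w x)\<bar> * \<bar>laplacian v x\<bar> \<le> B * C" if x: "x \<in> \<Omega>"
        using B[OF x] C[OF x] w_nonneg[OF x] soft_threshold_bounds[of "1 / real (Suc n)" "w x"]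
        by (intro mult_mono) auto
      then show "norm (indicat_real \<Omega> x *\<^sub>R
        (soft_threshold (1 / real (Suc n)) (w x) * laplacian v x)) \<le> indicat_real \<Omega> x * (B * C)"
        by (auto simp: indicator_def abs_mult)
    qed
  qed
qed

text \<open>Finiteness of the energy is part of the conclusion: the truncated energies increase to it and
  are given by integrals of bounded functions.\<close>

lemma dirichlet_energy:
  fixes v :: "'a::euclidean_space \<Rightarrow> real"
  assumes \<Omega>: "open \<Omega>" "bounded \<Omega>"
    and v: "nonneg_zero_trace \<Omega> v" "Ck_on 2 v \<Omega>"
    and C: "\<And>x. x \<in> \<Omega> \<Longrightarrow> \<bar>laplacian v x\<bar> \<le> C"
  shows "set_integrable lborel \<Omega> (\<lambda>x. (norm (gradient v x))\<^sup>2)"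
    and "(LINT x:\<Omega>|lborel. (norm (gradient v x))\<^sup>2) = - (LINT x:\<Omega>|lborel. v x * laplacian v x)"
proof -
  note v1 = Ck_on_2_imp_1[OF v(2)]
  have v_nonneg: "0 \<le> v x" if "x \<in> \<Omega>" for x
    using v that by (simp add: nonneg_zero_trace_def)
  let ?f = "\<lambda>n x. indicat_real \<Omega> x *\<^sub>R
    (soft_threshold_deriv (1 / real (Suc n)) (v x) * (gradient v x \<bullet> gradient v x))"
  let ?g = "\<lambda>x. indicat_real \<Omega> x *\<^sub>R (norm (gradient v x))\<^sup>2"
  have 1: "integrable lborel (?f n)" for n
    using truncated_green(1)[OF \<Omega> v(1) v1 v(2), of "1 / real (Suc n)"] by (simp add: set_integrable_def)
  have 2: "AE x in lborel. mono (\<lambda>n. ?f n x)"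
  proof (intro AE_I2 monoI)
    fix x and m n :: nat
    assume "m \<le> n"
    then have "1 / real (Suc n) \<le> 1 / real (Suc m)" by (simp add: field_simps)
    then show "?f m x \<le> ?f n x"
      unfolding real_scaleR_def
      by (intro mult_left_mono mult_right_mono soft_threshold_deriv_antimono) auto
  qed
  have 3: "AE x in lborel. (\<lambda>n. ?f n x) \<longlonglongrightarrow> ?g x"
  proof (intro AE_I2)
    fix x
    consider "x \<notin> \<Omega>" | "x \<in> \<Omega>" "v x = 0" | "x \<in> \<Omega>" "0 < v x"
      using v_nonneg[of x] by fastforce
    then show "(\<lambda>n. ?f n x) \<longlonglongrightarrow> ?g x"
    proof cases
      case 2
      then show ?thesis using gradient_eq_0_at_zero[OF \<Omega>(1) v(1) v1] by simp
    next
      case 3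
      then have "(\<lambda>n. ?f n x) \<longlonglongrightarrow> indicat_real \<Omega> x *\<^sub>R (1 * (gradient v x \<bullet> gradient v x))"
        by (intro tendsto_intros soft_threshold_deriv_tendsto)
      then show ?thesis by (simp add: power2_norm_eq_inner)
    qed simp
  qed
  have 4: "(\<lambda>n. integral\<^sup>L lborel (?f n)) \<longlonglongrightarrow> - (LINT x:\<Omega>|lborel. v x * laplacian v x)"
    using tendsto_minus[OF truncated_laplacian_tendsto[OF \<Omega> v C]]
      truncated_green(2)[OF \<Omega> v(1) v1 v(2)]
    by (simp add: set_lebesgue_integral_def)
  have "continuous_on \<Omega> (\<lambda>x. (norm (gradient v x))\<^sup>2)"
    by (intro continuous_intros gradient_continuous v1)
  then have 5: "?g \<in> borel_measurable lborel"
    by (rule borel_measurable_open_indicator[OF \<Omega>(1)])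
  show "set_integrable lborel \<Omega> (\<lambda>x. (norm (gradient v x))\<^sup>2)"
    unfolding set_integrable_def by (rule integrable_monotone_convergence[OF 1 2 3 4 5])
  show "(LINT x:\<Omega>|lborel. (norm (gradient v x))\<^sup>2) = - (LINT x:\<Omega>|lborel. v x * laplacian v x)"
    unfolding set_lebesgue_integral_def[of _ _ "\<lambda>x. (norm (gradient v x))\<^sup>2"]
    by (rule integral_monotone_convergence[OF 1 2 3 4 5])
qed

text \<open>With the energy of \<open>v\<close> known to be finite, the truncated identities pass to the
  limit by dominated convergence.\<close>

lemma green_identity:
  fixes v w :: "'a::euclidean_space \<Rightarrow> real"
  assumes \<Omega>: "open \<Omega>" "bounded \<Omega>"
    and v: "nonneg_zero_trace \<Omega> v" "Ck_on 2 v \<Omega>"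
    and C: "\<And>x. x \<in> \<Omega> \<Longrightarrow> \<bar>laplacian v x\<bar> \<le> C"
    and w: "nonneg_zero_trace \<Omega> w" "Ck_on 1 w \<Omega>"
    and w_energy: "set_integrable lborel \<Omega> (\<lambda>x. (norm (gradient w x))\<^sup>2)"
  shows "set_integrable lborel \<Omega> (\<lambda>x. gradient w x \<bullet> gradient v x)"
    and "(LINT x:\<Omega>|lborel. gradient w x \<bullet> gradient v x) = - (LINT x:\<Omega>|lborel. w x * laplacian v x)"
proof -
  note v1 = Ck_on_2_imp_1[OF v(2)]
  have w_nonneg: "0 \<le> w x" if "x \<in> \<Omega>" for x
    using w that by (simp add: nonneg_zero_trace_def)
  have bound: "\<bar>gradient w x \<bullet> gradient v x\<bar> \<le> (norm (gradient w x))\<^sup>2 + (norm (gradient v x))\<^sup>2" for x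
  proof -
    have "\<bar>gradient w x \<bullet> gradient v x\<bar> \<le> norm (gradient w x) * norm (gradient v x)"
      by (rule Cauchy_Schwarz_ineq2)
    also have "\<dots> \<le> (norm (gradient w x))\<^sup>2 + (norm (gradient v x))\<^sup>2"
      using zero_le_power2[of "norm (gradient w x) - norm (gradient v x)"]
        mult_nonneg_nonneg[OF norm_ge_zero[of "gradient w x"] norm_ge_zero[of "gradient v x"]]
      by (simp only: power2_diff)
    finally show ?thesis .
  qed
  let ?d = "\<lambda>x. indicat_real \<Omega> x *\<^sub>R ((norm (gradient w x))\<^sup>2 + (norm (gradient v x))\<^sup>2)"
  have dom: "integrable lborel ?d"
    using set_integral_add(1)[OF w_energy dirichlet_energy(1)[OF \<Omega> v C]] by (simp add: set_integrable_def)
  have "continuous_on \<Omega> (\<lambda>x. gradient w x \<bullet> gradient v x)"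
    by (intro continuous_intros gradient_continuous v1 w(2))
  then have meas: "(\<lambda>x. indicat_real \<Omega> x *\<^sub>R (gradient w x \<bullet> gradient v x)) \<in> borel_measurable lborel"
    by (rule borel_measurable_open_indicator[OF \<Omega>(1)])
  show "set_integrable lborel \<Omega> (\<lambda>x. gradient w x \<bullet> gradient v x)"
    unfolding set_integrable_def
    by (rule Bochner_Integration.integrable_bound[OF dom meas])
      (use bound in \<open>auto simp: indicator_def intro: order_trans[OF _ abs_ge_self]\<close>)
  have "(\<lambda>n. LINT x:\<Omega>|lborel. soft_threshold_deriv (1 / real (Suc n)) (w x) *
      (gradient w x \<bullet> gradient v x)) \<longlonglongrightarrow> (LINT x:\<Omega>|lborel. gradient w x \<bullet> gradient v x)"
    unfolding set_lebesgue_integral_def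
  proof (rule integral_dominated_convergence[OF meas _ dom])
    show "(\<lambda>x. indicat_real \<Omega> x *\<^sub>R (soft_threshold_deriv (1 / real (Suc n)) (w x) *
        (gradient w x \<bullet> gradient v x))) \<in> borel_measurable lborel" for n
      using truncated_green(1)[OF \<Omega> w v(2), of "1 / real (Suc n)"]
      by (auto simp: set_integrable_def)
    show "AE x in lborel. (\<lambda>n. indicat_real \<Omega> x *\<^sub>R (soft_threshold_deriv (1 / real (Suc n)) (w x) *
        (gradient w x \<bullet> gradient v x))) \<longlonglongrightarrow> indicat_real \<Omega> x *\<^sub>R (gradient w x \<bullet> gradient v x)"
    proof (intro AE_I2)
      fix x
      consider "x \<notin> \<Omega>" | "x \<in> \<Omega>" "w x = 0" | "x \<in> \<Omega>" "0 < w x"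
        using w_nonneg[of x] by fastforce
      then show "(\<lambda>n. indicat_real \<Omega> x *\<^sub>R (soft_threshold_deriv (1 / real (Suc n)) (w x) *
        (gradient w x \<bullet> gradient v x))) \<longlonglongrightarrow> indicat_real \<Omega> x *\<^sub>R (gradient w x \<bullet> gradient v x)"
      proof cases
        case 2
        then show ?thesis using gradient_eq_0_at_zero[OF \<Omega>(1) w] by simp
      next
        case 3
        then have "(\<lambda>n. indicat_real \<Omega> x *\<^sub>R (soft_threshold_deriv (1 / real (Suc n)) (w x) *
            (gradient w x \<bullet> gradient v x))) \<longlonglongrightarrow> indicat_real \<Omega> x *\<^sub>R (1 * (gradient w x \<bullet> gradient v x))"
          by (intro tendsto_intros soft_threshold_deriv_tendsto)
        then show ?thesis by simp
      qed simp
    qed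
    show "AE x in lborel. norm (indicat_real \<Omega> x *\<^sub>R (soft_threshold_deriv (1 / real (Suc n)) (w x) *
        (gradient w x \<bullet> gradient v x))) \<le> ?d x" for n
    proof (intro AE_I2)
      fix x
      have "\<bar>soft_threshold_deriv (1 / real (Suc n)) (w x)\<bar> * \<bar>gradient w x \<bullet> gradient v x\<bar>
          \<le> 1 * ((norm (gradient w x))\<^sup>2 + (norm (gradient v x))\<^sup>2)"
        using soft_threshold_deriv_bounds[of "1 / real (Suc n)" "w x"] bound
        by (intro mult_mono) auto
      then show "norm (indicat_real \<Omega> x *\<^sub>R (soft_threshold_deriv (1 / real (Suc n)) (w x) *
        (gradient w x \<bullet> gradient v x))) \<le> ?d x"
        by (auto simp: indicator_def abs_mult)
    qed
  qed
  then have "(\<lambda>n. - (LINT x:\<Omega>|lborel. soft_threshold (1 / real (Suc n)) (w x) * laplacian v x))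
      \<longlonglongrightarrow> (LINT x:\<Omega>|lborel. gradient w x \<bullet> gradient v x)"
    using truncated_green(2)[OF \<Omega> w v(2)] by simp
  then show "(LINT x:\<Omega>|lborel. gradient w x \<bullet> gradient v x) = - (LINT x:\<Omega>|lborel. w x * laplacian v x)"
    using tendsto_minus[OF truncated_laplacian_tendsto[OF \<Omega> w(1) v(2) C]] LIMSEQ_unique by blast
qed

text \<open>Convexity of the Dirichlet energy at \<open>v\<close>, with \<open>- \<Delta>v\<close> as its
  derivative: \<open>1/2 \<integral>|\<nabla>w|\<^sup>2 \<ge> 1/2 \<integral>|\<nabla>v|\<^sup>2 +
  \<integral>(- \<Delta>v)(w - v)\<close>. In this form it mentions the gradient of
  \<open>w\<close> only.\<close>

lemma dirichlet_convexity:
  fixes v w :: "'a::euclidean_space \<Rightarrow> real"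
  assumes \<Omega>: "open \<Omega>" "bounded \<Omega>"
    and v: "nonneg_zero_trace \<Omega> v" "Ck_on 2 v \<Omega>"
    and C: "\<And>x. x \<in> \<Omega> \<Longrightarrow> \<bar>laplacian v x\<bar> \<le> C"
    and w: "nonneg_zero_trace \<Omega> w" "Ck_on 1 w \<Omega>"
    and w_energy: "set_integrable lborel \<Omega> (\<lambda>x. (norm (gradient w x))\<^sup>2)"
  shows "- (LINT x:\<Omega>|lborel. w x * laplacian v x) \<le>
    ((LINT x:\<Omega>|lborel. (norm (gradient w x))\<^sup>2) - (LINT x:\<Omega>|lborel. v x * laplacian v x)) / 2"
proof -
  note e = dirichlet_energy[OF \<Omega> v C] and g = green_identity[OF \<Omega> v C w w_energy]
  have "2 * (gradient w x \<bullet> gradient v x) \<le> (norm (gradient w x))\<^sup>2 + (norm (gradient v x))\<^sup>2" for x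
    using zero_le_power2[of "norm (gradient w x - gradient v x)"]
    by (simp add: power2_norm_eq_inner inner_diff_left inner_diff_right inner_commute)
  then have "(LINT x:\<Omega>|lborel. 2 * (gradient w x \<bullet> gradient v x))
      \<le> (LINT x:\<Omega>|lborel. (norm (gradient w x))\<^sup>2 + (norm (gradient v x))\<^sup>2)"
    by (intro set_integral_mono set_integral_add set_integrable_mult_right w_energy e g) auto
  then have "2 * (LINT x:\<Omega>|lborel. gradient w x \<bullet> gradient v x)
      \<le> (LINT x:\<Omega>|lborel. (norm (gradient w x))\<^sup>2) + (LINT x:\<Omega>|lborel. (norm (gradient v x))\<^sup>2)"
    by (simp add: set_integral_add[OF w_energy e(1)])
  then show ?thesis using e(2) g(2) by simp
qed

text \<open>The Rayleigh quotient bounds the Dirichlet energy from below; for \<open>v\<close> with bounded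
  Laplacian this energy is finite and equals \<open>- \<integral>v \<Delta>v\<close>.\<close>

lemma poincare_inequality:
  fixes v :: "'a::euclidean_space \<Rightarrow> real"
  assumes \<Omega>: "open \<Omega>" "bounded \<Omega>" and lam: "first_dirichlet_eigenvalue \<Omega> lam" "0 < lam"
    and v: "nonneg_zero_trace \<Omega> v" "Ck_on 2 v \<Omega>"
    and C: "\<And>x. x \<in> \<Omega> \<Longrightarrow> \<bar>laplacian v x\<bar> \<le> C"
  shows "lam * (LINT x:\<Omega>|lborel. (v x)\<^sup>2) \<le> - (LINT x:\<Omega>|lborel. v x * laplacian v x)"
proof -
  note e = dirichlet_energy[OF \<Omega> v C]
  define a where "a = (LINT x:\<Omega>|lborel. (norm (gradient v x))\<^sup>2)"
  define b where "b = (LINT x:\<Omega>|lborel. (v x)\<^sup>2)"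
  have a0: "0 \<le> a" and b0: "0 \<le> b"
    unfolding a_def b_def set_lebesgue_integral_def by (auto intro!: Bochner_Integration.integral_nonneg)
  have "lam * b \<le> a"
  proof (cases "b = 0")
    case False
    then have b: "0 < b" using b0 by simp
    have "\<exists>x\<in>\<Omega>. v x \<noteq> 0"
    proof (rule ccontr)
      assume "\<not> ?thesis"
      then have "b = (LINT x:\<Omega>|lborel. 0)"
        unfolding b_def using \<Omega> by (intro set_lebesgue_integral_cong) auto
      then show False using b by simp
    qed
    then have "v \<in> admissible \<Omega>"
      using v by (simp add: admissible_def nonneg_zero_trace_def)
    then have "ennreal lam \<le> rayleigh_quotient \<Omega> v"
      using lam by (simp add: first_dirichlet_eigenvalue_def)
    also have "\<dots> = ennreal a / ennreal b"
    proof -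
      obtain B where B: "\<And>x. x \<in> \<Omega> \<Longrightarrow> \<bar>v x\<bar> \<le> B"
        using nonneg_zero_trace_bounded[OF \<Omega>(2) v(1)] by blast
      have "set_integrable lborel \<Omega> (\<lambda>x. (v x)\<^sup>2)"
      proof (rule set_integrable_bounded[OF \<Omega>])
        show "continuous_on \<Omega> (\<lambda>x. (v x)\<^sup>2)"
          by (intro continuous_intros nonneg_zero_trace_continuous v)
        show "\<bar>(v x)\<^sup>2\<bar> \<le> B\<^sup>2" if "x \<in> \<Omega>" for x
          using B[OF that] power_mono[of "\<bar>v x\<bar>" B 2] by simp
      qed
      moreover have "(\<integral>\<^sup>+x\<in>\<Omega>. ennreal (F x) \<partial>lborel) = ennreal (LINT x:\<Omega>|lborel. F x)"
        if "set_integrable lborel \<Omega> F" "\<And>x. 0 \<le> F x" for F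
      proof -
        have "(\<integral>\<^sup>+x\<in>\<Omega>. ennreal (F x) \<partial>lborel) = (\<integral>\<^sup>+x. ennreal (indicat_real \<Omega> x *\<^sub>R F x) \<partial>lborel)"
          by (intro nn_integral_cong) (auto simp: indicator_def)
        then show ?thesis
          using that by (simp add: nn_integral_eq_integral set_integrable_def set_lebesgue_integral_def)
      qed
      ultimately show ?thesis
        unfolding rayleigh_quotient_def a_def b_def using e(1) by simp
    qed
    also have "\<dots> = ennreal (a / b)"
      using a0 b by (simp add: divide_ennreal)
    finally have "lam \<le> a / b" using a0 b by (simp add: ennreal_le_iff)
    then show ?thesis using b by (simp add: field_simps)
  qed (use a0 in simp)
  then show ?thesis using e(2) by (simp add: a_def b_def)
qed

section \<open>Locality and scaling of the differential operators\<close>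

lemma has_derivative_cong_open:
  assumes "open \<Omega>" "x \<in> \<Omega>" "\<And>y. y \<in> \<Omega> \<Longrightarrow> v y = w y"
  shows "(v has_derivative D) (at x) \<longleftrightarrow> (w has_derivative D) (at x)"
  using has_derivative_transform_within_open[of v D x UNIV \<Omega> w]
    has_derivative_transform_within_open[of w D x UNIV \<Omega> v] assms by auto

lemma partial_deriv_cong_open:
  assumes "open \<Omega>" "x \<in> \<Omega>" "\<And>y. y \<in> \<Omega> \<Longrightarrow> v y = w y"
  shows "partial_deriv b v x = partial_deriv b w x"
  using has_derivative_cong_open[OF assms] by (simp add: partial_deriv_def frechet_derivative_def)

lemma Ck_on_1_cong_open:
  assumes "open \<Omega>" "\<And>y. y \<in> \<Omega> \<Longrightarrow> v y = w y"
  shows "Ck_on 1 v \<Omega> \<longleftrightarrow> Ck_on 1 w \<Omega>"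
proof -
  have "v differentiable (at x) \<longleftrightarrow> w differentiable (at x)" if "x \<in> \<Omega>" for x
    using has_derivative_cong_open[OF assms(1) that, of v w] assms(2) by (simp add: differentiable_def)
  moreover have "continuous_on \<Omega> (partial_deriv b v) \<longleftrightarrow> continuous_on \<Omega> (partial_deriv b w)" for b
    by (rule continuous_on_cong) (auto intro: partial_deriv_cong_open assms)
  ultimately show ?thesis by (auto simp: Ck_on_1_iff)
qed

lemma Ck_on_2_cong_open:
  assumes "open \<Omega>" "\<And>y. y \<in> \<Omega> \<Longrightarrow> v y = w y"
  shows "Ck_on 2 v \<Omega> \<longleftrightarrow> Ck_on 2 w \<Omega>"
proof -
  have "v differentiable (at x) \<longleftrightarrow> w differentiable (at x)" if "x \<in> \<Omega>" for x
    using has_derivative_cong_open[OF assms(1) that, of v w] assms(2) by (simp add: differentiable_def)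
  moreover have "Ck_on 1 (partial_deriv b v) \<Omega> \<longleftrightarrow> Ck_on 1 (partial_deriv b w) \<Omega>" for b
    by (rule Ck_on_1_cong_open[OF assms(1) partial_deriv_cong_open[OF assms(1) _ assms(2)]])
  ultimately show ?thesis by (auto simp: Ck_on_2_iff)
qed

lemma laplacian_cong_open:
  assumes "open \<Omega>" "x \<in> \<Omega>" "\<And>y. y \<in> \<Omega> \<Longrightarrow> v y = w y"
  shows "laplacian v x = laplacian w x"
  unfolding laplacian_def
  by (intro sum.cong refl partial_deriv_cong_open[OF assms(1,2)] partial_deriv_cong_open[OF assms(1)] assms(3))

lemma gradient_cong_open:
  assumes "open \<Omega>" "x \<in> \<Omega>" "\<And>y. y \<in> \<Omega> \<Longrightarrow> v y = w y"
  shows "gradient v x = gradient w x"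
  unfolding gradient_def using partial_deriv_cong_open[OF assms] by (intro sum.cong) auto

lemma partial_deriv_scale:
  assumes "v differentiable (at x)"
  shows "partial_deriv b (\<lambda>y. c * v y) x = c * partial_deriv b v x"
proof -
  have "((\<lambda>y. c * v y) has_derivative (\<lambda>h. c * frechet_derivative v (at x) h)) (at x)"
    using assms by (intro has_derivative_mult_right) (simp add: frechet_derivative_works)
  from frechet_derivative_at[OF this, symmetric] show ?thesis
    by (simp add: partial_deriv_def)
qed

lemma gradient_scale:
  "v differentiable (at x) \<Longrightarrow> gradient (\<lambda>y. c * v y) x = c *\<^sub>R gradient v x"
  by (simp add: gradient_def partial_deriv_scale scaleR_sum_right)

lemma Ck_on_1_scale:
  assumes "Ck_on 1 v \<Omega>"
  shows "Ck_on 1 (\<lambda>y. c * v y) \<Omega>"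
proof -
  have "continuous_on \<Omega> (partial_deriv b (\<lambda>y. c * v y))" if "b \<in> Basis" for b
  proof -
    have "continuous_on \<Omega> (\<lambda>x. c * partial_deriv b v x)"
      using assms that by (auto simp: Ck_on_1_iff intro!: continuous_intros)
    then show ?thesis
      by (rule continuous_on_eq) (use assms in \<open>simp add: Ck_on_1_iff partial_deriv_scale\<close>)
  qed
  then show ?thesis using assms by (auto simp: Ck_on_1_iff)
qed

section \<open>Time averages of classical solutions\<close>

lemma partial_deriv_integral:
  fixes \<phi> :: "'a::euclidean_space \<Rightarrow> real \<Rightarrow> real"
  assumes \<Omega>: "open \<Omega>"
    and diff: "\<And>x t. x \<in> \<Omega> \<Longrightarrow> t \<in> {a..b} \<Longrightarrow> (\<lambda>y. \<phi> y t) differentiable (at x)"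
    and cont: "continuous_on (\<Omega> \<times> {a..b}) (\<lambda>(x, t). \<phi> x t)"
    and pcont: "\<And>i. i \<in> Basis \<Longrightarrow>
      continuous_on (\<Omega> \<times> {a..b}) (\<lambda>(x, t). partial_deriv i (\<lambda>y. \<phi> y t) x)"
    and x: "x \<in> \<Omega>"
  shows "(\<lambda>x. integral {a..b} (\<phi> x)) differentiable (at x)"
    and "i \<in> Basis \<Longrightarrow> partial_deriv i (\<lambda>x. integral {a..b} (\<phi> x)) x =
      integral {a..b} (\<lambda>t. partial_deriv i (\<lambda>y. \<phi> y t) x)"
proof -
  define D where "D x t = (\<Sum>i\<in>Basis. partial_deriv i (\<lambda>y. \<phi> y t) x *\<^sub>R blinfun_inner_left i)" for x t
  have D_apply: "blinfun_apply (D x t) h = (\<Sum>i\<in>Basis. partial_deriv i (\<lambda>y. \<phi> y t) x * (h \<bullet> i))" for x t h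
    by (simp add: D_def blinfun.sum_left blinfun.scaleR_left blinfun_inner_left.rep_eq inner_commute)
  have D_basis: "blinfun_apply (D x t) i = partial_deriv i (\<lambda>y. \<phi> y t) x" if "i \<in> Basis" for x t i
    using that by (simp add: D_apply inner_Basis if_distrib[of "(*) _"] sum.delta cong: if_cong)
  have D_deriv: "((\<lambda>y. \<phi> y t) has_derivative blinfun_apply (D z t)) (at z)"
    if "z \<in> \<Omega>" "t \<in> {a..b}" for z t
  proof -
    let ?F = "frechet_derivative (\<lambda>y. \<phi> y t) (at z)"
    have F: "((\<lambda>y. \<phi> y t) has_derivative ?F) (at z)"
      using diff[OF that] by (simp add: frechet_derivative_works)
    have "?F h = blinfun_apply (D z t) h" for h
    proof -
      have "?F h = ?F (\<Sum>i\<in>Basis. (h \<bullet> i) *\<^sub>R i)"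
        by (simp add: euclidean_representation)
      also have "\<dots> = (\<Sum>i\<in>Basis. (h \<bullet> i) *\<^sub>R ?F i)"
        using has_derivative_linear[OF F] by (simp add: linear_sum linear_cmul)
      finally show ?thesis by (simp add: D_apply partial_deriv_def mult.commute)
    qed
    then show ?thesis using F by (metis ext)
  qed
  obtain r where r: "0 < r" "ball x r \<subseteq> \<Omega>"
    using \<Omega> x by (auto simp: open_contains_ball)
  have D_cont: "continuous_on (\<Omega> \<times> {a..b}) (\<lambda>(x, t). D x t)"
    unfolding D_def split_beta using pcont by (intro continuous_intros) (auto simp: split_beta)
  have "((\<lambda>x. integral (cbox a b) (\<phi> x)) has_derivative integral (cbox a b) (D x)) (at x within ball x r)"
  proof (rule leibniz_rule)
    show "((\<lambda>x. \<phi> x t) has_derivative blinfun_apply (D z t)) (at z within ball x r)"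
      if "z \<in> ball x r" "t \<in> cbox a b" for z t
      using that r by (intro has_derivative_at_withinI[OF D_deriv]) auto
    show "\<phi> z integrable_on cbox a b" if "z \<in> ball x r" for z
    proof -
      have "continuous_on {a..b} (\<lambda>t. case (z, t) of (x, t) \<Rightarrow> \<phi> x t)"
        using that r by (intro continuous_on_compose2[OF cont] continuous_intros) auto
      then show ?thesis by (simp add: integrable_continuous_real)
    qed
    show "continuous_on (ball x r \<times> cbox a b) (\<lambda>(x, t). D x t)"
      using r by (intro continuous_on_subset[OF D_cont]) auto
  qed (use r in auto)
  then have der: "((\<lambda>x. integral {a..b} (\<phi> x)) has_derivative integral {a..b} (D x)) (at x)"
    using r by (simp add: at_within_open[of x "ball x r"])
  then show "(\<lambda>x. integral {a..b} (\<phi> x)) differentiable (at x)"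
    by (auto simp: differentiable_def)
  assume i: "i \<in> Basis"
  have "continuous_on {a..b} (\<lambda>t. case (x, t) of (x, t) \<Rightarrow> D x t)"
    using x by (intro continuous_on_compose2[OF D_cont] continuous_intros) auto
  then have "D x integrable_on {a..b}" by (simp add: integrable_continuous_real)
  from integral_linear[OF this blinfun.bounded_linear_left[of i]]
  have "integral {a..b} (\<lambda>t. blinfun_apply (D x t) i) = blinfun_apply (integral {a..b} (D x)) i"
    by (simp add: o_def)
  then show "partial_deriv i (\<lambda>x. integral {a..b} (\<phi> x)) x =
      integral {a..b} (\<lambda>t. partial_deriv i (\<lambda>y. \<phi> y t) x)"
    using frechet_derivative_at[OF der] D_basis[OF i] by (simp add: partial_deriv_def)
qed

lemma time_integral_C2:
  fixes u :: "'a::euclidean_space \<Rightarrow> real \<Rightarrow> real"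
  assumes \<Omega>: "open \<Omega>" and u: "C21_on \<Omega> \<infinity> u" and a: "0 < a"
  shows "Ck_on 2 (\<lambda>x. integral {a..b} (u x)) \<Omega>"
    and "x \<in> \<Omega> \<Longrightarrow> laplacian (\<lambda>x. integral {a..b} (u x)) x =
      integral {a..b} (\<lambda>t. laplacian (\<lambda>y. u y t) x)"
proof -
  have sub: "\<Omega> \<times> {a..b} \<subseteq> \<Omega> \<times> {t. 0 < t \<and> ereal t < \<infinity>}" using a by auto
  have c0: "continuous_on (\<Omega> \<times> {a..b}) (\<lambda>(x, t). u x t)"
    by (rule continuous_on_subset[OF _ sub]) (use u in \<open>simp add: C21_on_def Let_def\<close>)
  have c1: "continuous_on (\<Omega> \<times> {a..b}) (\<lambda>(x, t). partial_deriv i (\<lambda>y. u y t) x)"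
    if "i \<in> Basis" for i
    by (rule continuous_on_subset[OF _ sub]) (use u that in \<open>simp add: C21_on_def Let_def\<close>)
  have c2: "continuous_on (\<Omega> \<times> {a..b}) (\<lambda>(x, t). partial_deriv i (partial_deriv j (\<lambda>y. u y t)) x)"
    if "i \<in> Basis" "j \<in> Basis" for i j
    by (rule continuous_on_subset[OF _ sub]) (use u that in \<open>simp add: C21_on_def Let_def\<close>)
  have C2: "Ck_on 2 (\<lambda>y. u y t) \<Omega>" if "t \<in> {a..b}" for t
    using u a that by (simp add: C21_on_def Let_def)
  let ?V = "\<lambda>x. integral {a..b} (u x)"
  let ?W = "\<lambda>j x. integral {a..b} (\<lambda>t. partial_deriv j (\<lambda>y. u y t) x)"
  have V1: "?V differentiable (at x)" and V2: "j \<in> Basis \<Longrightarrow> partial_deriv j ?V x = ?W j x"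
    if "x \<in> \<Omega>" for x j
    using partial_deriv_integral[OF \<Omega> _ c0 c1 that] C2 by (auto simp: Ck_on_2_iff)
  have W1: "?W j differentiable (at x)"
    and W2: "i \<in> Basis \<Longrightarrow> partial_deriv i (?W j) x =
      integral {a..b} (\<lambda>t. partial_deriv i (partial_deriv j (\<lambda>y. u y t)) x)"
    if "x \<in> \<Omega>" "j \<in> Basis" for x i j
    using partial_deriv_integral[OF \<Omega> _ c1[OF that(2)] c2[OF _ that(2)] that(1)] C2 that
    by (auto simp: Ck_on_2_iff Ck_on_1_iff)
  have int: "continuous_on \<Omega> (\<lambda>x. integral {a..b} (\<lambda>t. partial_deriv i (partial_deriv j (\<lambda>y. u y t)) x))"
    if "i \<in> Basis" "j \<in> Basis" for i j
    using integral_continuous_on_param[of \<Omega> a b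
        "\<lambda>x t. partial_deriv i (partial_deriv j (\<lambda>y. u y t)) x"] c2[OF that] by simp
  have "Ck_on 1 (?W j) \<Omega>" if "j \<in> Basis" for j
    unfolding Ck_on_1_iff
    using W1 that int[OF _ that] W2[OF _ that] continuous_on_cong[OF refl, of \<Omega> "partial_deriv _ (?W j)"]
    by fastforce
  then have "Ck_on 1 (partial_deriv j ?V) \<Omega>" if "j \<in> Basis" for j
    using Ck_on_1_cong_open[OF \<Omega>, of "partial_deriv j ?V" "?W j"] V2 that by blast
  then show "Ck_on 2 ?V \<Omega>" using V1 by (simp add: Ck_on_2_iff)
  assume x: "x \<in> \<Omega>"
  have "partial_deriv j (partial_deriv j ?V) x =
      integral {a..b} (\<lambda>t. partial_deriv j (partial_deriv j (\<lambda>y. u y t)) x)" if "j \<in> Basis" for j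
    using partial_deriv_cong_open[OF \<Omega> x, of "partial_deriv j ?V" "?W j"] V2 W2[OF x that that] that
    by simp
  moreover have "(\<lambda>t. partial_deriv j (partial_deriv j (\<lambda>y. u y t)) x) integrable_on {a..b}"
    if "j \<in> Basis" for j
  proof -
    have "continuous_on {a..b}
        (\<lambda>t. case (x, t) of (x, t) \<Rightarrow> partial_deriv j (partial_deriv j (\<lambda>y. u y t)) x)"
      using x by (intro continuous_on_compose2[OF c2[OF that that]] continuous_intros) auto
    then show ?thesis by (simp add: integrable_continuous_real)
  qed
  ultimately show "laplacian ?V x = integral {a..b} (\<lambda>t. laplacian (\<lambda>y. u y t) x)"
    by (simp add: laplacian_def integral_sum)
qed

text \<open>Integrating the equation in time removes the time derivative. The right-hand side is continuous
  up to the boundary, which is not known of the Laplacian of \<open>u\<close> itself.\<close>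

lemma time_integral_laplacian:
  fixes u :: "'a::euclidean_space \<Rightarrow> real \<Rightarrow> real"
  assumes \<Omega>: "open \<Omega>" and u: "nonneg_classical_solution \<Omega> \<infinity> f u\<^sub>0 u"
    and f: "continuous_on UNIV f" and ab: "0 < a" "a \<le> b" and x: "x \<in> \<Omega>"
  shows "laplacian (\<lambda>x. integral {a..b} (u x)) x = u x b - u x a - integral {a..b} (\<lambda>t. f (u x t))"
proof -
  have C21: "C21_on \<Omega> \<infinity> u" using u by (simp add: nonneg_classical_solution_def)
  have der: "(u x has_real_derivative deriv (u x) t) (at t)" if "t \<in> {a..b}" for t
  proof -
    have "u x differentiable (at t)"
      using C21 x ab that by (auto simp: C21_on_def Let_def)
    then show ?thesis by (simp add: DERIV_deriv_iff_real_differentiable)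
  qed
  have "(deriv (u x) has_integral u x b - u x a) {a..b}"
    using ab der
    by (intro fundamental_theorem_of_calculus)
      (auto simp: has_real_derivative_iff_has_vector_derivative[symmetric]
        intro: has_field_derivative_at_within)
  moreover have "((\<lambda>t. f (u x t)) has_integral integral {a..b} (\<lambda>t. f (u x t))) {a..b}"
  proof -
    have "continuous_on {a..b} (u x)"
      by (rule DERIV_continuous_on) (use der has_field_derivative_at_within in blast)
    then have "continuous_on {a..b} (\<lambda>t. f (u x t))"
      by (rule continuous_on_compose2[OF f]) auto
    then show ?thesis by (simp add: integrable_continuous_real integrable_integral)
  qed
  ultimately have "((\<lambda>t. deriv (u x) t - f (u x t)) has_integral
      u x b - u x a - integral {a..b} (\<lambda>t. f (u x t))) {a..b}"
    by (rule has_integral_diff)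
  moreover have "deriv (u x) t - f (u x t) = laplacian (\<lambda>y. u y t) x" if "t \<in> {a..b}" for t
    using u x ab that by (simp add: nonneg_classical_solution_def)
  ultimately have "((\<lambda>t. laplacian (\<lambda>y. u y t) x) has_integral
      u x b - u x a - integral {a..b} (\<lambda>t. f (u x t))) {a..b}"
    by (rule has_integral_eq[rotated])
  then show ?thesis
    using time_integral_C2(2)[OF \<Omega> C21 ab(1) x] by (simp add: integral_unique)
qed

section \<open>The concavity argument for a real function\<close>

lemma within_deriv_nonneg_imp_le:
  fixes \<phi> :: "real \<Rightarrow> real"
  assumes "a \<le> b"
    and der: "\<And>t. t \<in> {a..b} \<Longrightarrow> (\<phi> has_real_derivative \<phi>' t) (at t within {a..b})"
    and nonneg: "\<And>t. t \<in> {a<..<b} \<Longrightarrow> 0 \<le> \<phi>' t"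
  shows "\<phi> a \<le> \<phi> b"
proof (rule DERIV_nonneg_imp_increasing_open[OF \<open>a \<le> b\<close>])
  show "\<exists>y. (\<phi> has_real_derivative y) (at x) \<and> 0 \<le> y" if "a < x" "x < b" for x
  proof -
    have "at x within {a..b} = at x"
      using that by (intro at_within_interior) (auto simp: interior_atLeastAtMost_real)
    then show ?thesis
      using der[of x] nonneg[of x] that by auto
  qed
  show "continuous_on {a..b} \<phi>"
    by (rule DERIV_continuous_on[OF der])
qed

lemma four_mult_le_sum_square: "4 * x * y \<le> (x + y)\<^sup>2" for x y :: real
  using zero_le_power2[of "x - y"] by (simp add: power2_eq_square algebra_simps)

text \<open>Optimising over \<open>l\<close> turns a family of arithmetic-geometric mean bounds back into a
  product bound. This gives Cauchy-Schwarz inequalities from pointwise estimates, without square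
  roots.\<close>

lemma square_le_of_affine_bounds:
  fixes x p q :: real
  assumes "0 \<le> x" "0 \<le> p" "0 \<le> q"
    and bound: "\<And>l. 0 < l \<Longrightarrow> x \<le> l * p + q / l"
  shows "x\<^sup>2 \<le> 4 * p * q"
proof (cases "x = 0")
  case True
  then show ?thesis using assms by simp
next
  case False
  then have x: "0 < x" using \<open>0 \<le> x\<close> by simp
  show ?thesis
  proof (cases "p = 0")
    case True
    have "x \<le> q * x / (2 * (q + 1))"
      using bound[of "2 * (q + 1) / x"] True x \<open>0 \<le> q\<close> by simp
    then have "x * (2 * (q + 1)) \<le> q * x"
      using \<open>0 \<le> q\<close> by (simp add: field_simps)
    then have "x * (q + 2) \<le> 0"
      by (simp add: algebra_simps)
    then have False
      using x \<open>0 \<le> q\<close> by (simp add: mult_le_0_iff)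
    then show ?thesis ..
  next
    case False
    then have p: "0 < p" using \<open>0 \<le> p\<close> by simp
    have "x \<le> x / (2 * p) * p + q / (x / (2 * p))"
      using x p by (intro bound) simp
    also have "\<dots> = x / 2 + 2 * p * q / x"
      using p by (simp add: field_simps)
    finally have "x / 2 * x \<le> (2 * p * q / x) * x"
      using x by (intro mult_right_mono) auto
    then show ?thesis
      using x by (simp add: power2_eq_square)
  qed
qed

text \<open>Levine's argument. Think of \<open>a\<close> as the square norm of a curve and of
  \<open>d\<close> as the square norm of its velocity; \<open>I = M + \<integral>a\<close> and
  \<open>I' = a\<close>. The hypotheses give \<open>I I'' \<ge> (1 + \<delta>)
  (I')\<^sup>2\<close>, so \<open>I\<close> to the power \<open>- \<delta>\<close> is concave. It
  starts at \<open>M\<close> to the power \<open>- \<delta>\<close> with a slope that would bring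
  it to zero by time \<open>M / (\<delta> a(0))\<close>.\<close>

lemma concavity_contradiction:
  fixes a a' P d :: "real \<Rightarrow> real"
  assumes a': "\<And>t. t \<in> {0..S} \<Longrightarrow> (a has_real_derivative a' t) (at t within {0..S})"
    and P': "\<And>t. t \<in> {0..S} \<Longrightarrow> (P has_real_derivative d t) (at t within {0..S})"
    and P0: "P 0 = 0"
    and a_nonneg: "\<And>t. t \<in> {0..S} \<Longrightarrow> 0 \<le> a t"
    and d_nonneg: "\<And>t. t \<in> {0..S} \<Longrightarrow> 0 \<le> d t"
    and cauchy: "\<And>t. t \<in> {0..S} \<Longrightarrow> (a' t)\<^sup>2 \<le> 4 * a t * d t"
    and growth: "\<And>t. t \<in> {0..S} \<Longrightarrow> 2 * \<alpha> * (j + \<kappa> * P t) \<le> a' t"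
    and pos: "0 < \<alpha>" "0 < j" "0 < \<delta>" "0 < M" "0 < a 0"
    and exponent: "2 * (1 + \<delta>)\<^sup>2 \<le> \<alpha> * \<kappa>"
    and M: "(1 + \<delta>) * (1 + 1 / \<delta>) * (a 0)\<^sup>2 \<le> 2 * \<alpha> * j * M"
    and long: "M / (\<delta> * a 0) \<le> S"
  shows False
proof -
  have S: "0 < S"
    using long pos by (smt (verit) divide_pos_pos mult_pos_pos)
  have a_cont: "continuous_on {0..S} a"
    by (rule DERIV_continuous_on[OF a'])
  define I where "I t = M + integral {0..t} a" for t
  have I': "(I has_real_derivative a t) (at t within {0..S})" if "t \<in> {0..S}" for t
    unfolding I_def using that a_cont
    by (auto intro!: derivative_eq_intros integral_has_real_derivative)
  have sub: "(\<phi> has_real_derivative y) (at s within {0..t})"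
    if "(\<phi> has_real_derivative y) (at s within {0..S})" "t \<in> {0..S}" for \<phi> y s t
    using that by (auto intro: DERIV_subset)
  have I0: "I 0 = M" by (simp add: I_def)
  have \<kappa>: "0 < \<kappa>"
  proof -
    have "0 < \<alpha> * \<kappa>"
      using exponent pos by (smt (verit) zero_less_power)
    then show ?thesis using pos by (simp add: zero_less_mult_iff)
  qed
  have P_nonneg: "0 \<le> P t" if t: "t \<in> {0..S}" for t
    using within_deriv_nonneg_imp_le[of 0 t P d] t P' d_nonneg sub P0 by auto
  have a'_pos: "0 < a' t" if t: "t \<in> {0..S}" for t
  proof -
    have "0 < j + \<kappa> * P t"
      using P_nonneg[OF t] \<kappa> pos by (simp add: add_pos_nonneg)
    then show ?thesis
      using growth[OF t] pos by (smt (verit) mult_pos_pos)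
  qed
  have a_ge: "a 0 \<le> a t" if t: "t \<in> {0..S}" for t
    using within_deriv_nonneg_imp_le[of 0 t a a'] t a' a'_pos sub by (auto simp: less_imp_le)
  have I_ge: "M \<le> I t" if t: "t \<in> {0..S}" for t
    using within_deriv_nonneg_imp_le[of 0 t I a] t I' a_nonneg sub I0 by auto
  have cs: "(a t - a 0)\<^sup>2 \<le> 4 * (I t - M) * P t" if t: "t \<in> {0..S}" for t
  proof (rule square_le_of_affine_bounds)
    fix l :: real
    assume l: "0 < l"
    have "l * I 0 + P 0 / l - a 0 \<le> l * I t + P t / l - a t"
    proof (rule within_deriv_nonneg_imp_le[where \<phi> = "\<lambda>s. l * I s + P s / l - a s"
            and \<phi>' = "\<lambda>s. l * a s + d s / l - a' s"])
      fix s assume s: "s \<in> {0..t}"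
      then have s': "s \<in> {0..S}" using t by auto
      show "((\<lambda>s. l * I s + P s / l - a s) has_real_derivative l * a s + d s / l - a' s)
              (at s within {0..t})"
        using l sub[OF I'[OF s'] t] sub[OF P'[OF s'] t] sub[OF a'[OF s'] t]
        by (auto intro!: derivative_eq_intros)
    next
      fix s assume s: "s \<in> {0<..<t}"
      then have s': "s \<in> {0..S}" using t by auto
      have "4 * a s * d s = 4 * (l * a s) * (d s / l)"
        using l by simp
      also have "\<dots> \<le> (l * a s + d s / l)\<^sup>2"
        by (rule four_mult_le_sum_square)
      finally have "(a' s)\<^sup>2 \<le> (l * a s + d s / l)\<^sup>2"
        using cauchy[OF s'] by linarith
      moreover have "0 \<le> l * a s + d s / l"
        using l a_nonneg[OF s'] d_nonneg[OF s'] by simp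
      ultimately have "a' s \<le> l * a s + d s / l"
        by (rule power2_le_imp_le)
      then show "0 \<le> l * a s + d s / l - a' s" by simp
    qed (use t in auto)
    then show "a t - a 0 \<le> l * (I t - M) + P t / l"
      using I0 P0 by (simp add: algebra_simps)
  qed (use t a_ge I_ge P_nonneg in auto)
  have key: "(1 + \<delta>) * (a t)\<^sup>2 \<le> a' t * I t" if t: "t \<in> {0..S}" for t
  proof -
    define x where "x = a t - a 0"
    have "0 \<le> (\<delta> * x - a 0)\<^sup>2 / \<delta>"
      using pos by simp
    also have "\<dots> = \<delta> * x\<^sup>2 + (a 0)\<^sup>2 / \<delta> - 2 * x * a 0"
      using pos by (simp add: power2_eq_square field_simps)
    finally have "(x + a 0)\<^sup>2 \<le> (1 + \<delta>) * x\<^sup>2 + (1 + 1 / \<delta>) * (a 0)\<^sup>2"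
      by (simp add: power2_eq_square algebra_simps)
    then have "(1 + \<delta>) * (a t)\<^sup>2 \<le> (1 + \<delta>) * ((1 + \<delta>) * x\<^sup>2 + (1 + 1 / \<delta>) * (a 0)\<^sup>2)"
      using pos by (intro mult_left_mono) (auto simp: x_def)
    also have "\<dots> = (1 + \<delta>)\<^sup>2 * x\<^sup>2 + (1 + \<delta>) * (1 + 1 / \<delta>) * (a 0)\<^sup>2"
      by (simp add: power2_eq_square algebra_simps)
    also have "\<dots> \<le> \<alpha> * \<kappa> / 2 * x\<^sup>2 + 2 * \<alpha> * j * M"
      using exponent M by (intro add_mono mult_right_mono) auto
    also have "\<dots> \<le> \<alpha> * \<kappa> / 2 * (4 * (I t - M) * P t) + 2 * \<alpha> * j * M"
      using cs[OF t] pos \<kappa> by (intro add_mono mult_left_mono) (auto simp: x_def)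
    also have "\<dots> = 2 * \<alpha> * (j + \<kappa> * P t) * I t - 2 * \<alpha> * (j * (I t - M) + \<kappa> * P t * M)"
      by (simp add: algebra_simps)
    also have "\<dots> \<le> 2 * \<alpha> * (j + \<kappa> * P t) * I t"
      using pos \<kappa> P_nonneg[OF t] I_ge[OF t] by simp
    also have "\<dots> \<le> a' t * I t"
      using growth[OF t] I_ge[OF t] pos by (intro mult_right_mono) auto
    finally show ?thesis .
  qed
  have I_pos: "0 < I t" if t: "t \<in> {0..S}" for t
    using I_ge[OF t] pos by simp
  \<comment> \<open>up to the factor \<open>- \<delta>\<close> the derivative of \<open>I\<close> to the power \<open>- \<delta>\<close>\<close>
  define R where "R t = a t * I t powr (- 1 - \<delta>)" for t
  have R_ge: "R 0 \<le> R t" if t: "t \<in> {0..S}" for t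
  proof (rule within_deriv_nonneg_imp_le[where \<phi> = R and \<phi>' =
        "\<lambda>s. (a' s * I s - (1 + \<delta>) * (a s)\<^sup>2) * I s powr (- 2 - \<delta>)"])
    fix s assume s: "s \<in> {0..t}"
    then have s': "s \<in> {0..S}" using t by auto
    have e: "I s powr (- 1 - \<delta>) = I s * I s powr (- 2 - \<delta>)"
      using I_pos[OF s'] powr_add[of "I s" 1 "- 2 - \<delta>"] by simp
    have "(R has_real_derivative
        a' s * I s powr (- 1 - \<delta>) + a s * ((- 1 - \<delta>) * I s powr (- 1 - \<delta> - 1) * a s))
        (at s within {0..t})"
      unfolding R_def
      using sub[OF I'[OF s'] t] sub[OF a'[OF s'] t] I_pos[OF s']
      by (auto intro!: derivative_eq_intros)
    moreover have "- 1 - \<delta> - 1 = - 2 - \<delta>" by simp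
    ultimately show "(R has_real_derivative
        (a' s * I s - (1 + \<delta>) * (a s)\<^sup>2) * I s powr (- 2 - \<delta>)) (at s within {0..t})"
      by (simp only: e) (simp add: power2_eq_square algebra_simps)
  next
    fix s assume "s \<in> {0<..<t}"
    then have "s \<in> {0..S}" using t by auto
    then show "0 \<le> (a' s * I s - (1 + \<delta>) * (a s)\<^sup>2) * I s powr (- 2 - \<delta>)"
      using key[of s] by simp
  qed (use t in auto)
  have "- (I 0 powr (- \<delta>)) - \<delta> * R 0 * 0 \<le> - (I S powr (- \<delta>)) - \<delta> * R 0 * S"
  proof (rule within_deriv_nonneg_imp_le[where \<phi> = "\<lambda>s. - (I s powr (- \<delta>)) - \<delta> * R 0 * s"
        and \<phi>' = "\<lambda>s. \<delta> * R s - \<delta> * R 0"])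
    fix s assume s: "s \<in> {0..S}"
    have "((\<lambda>s. - (I s powr (- \<delta>)) - \<delta> * R 0 * s) has_real_derivative
        - ((- \<delta>) * I s powr (- \<delta> - 1) * a s) - \<delta> * R 0) (at s within {0..S})"
      using I'[OF s] I_pos[OF s] by (auto intro!: derivative_eq_intros)
    moreover have "- \<delta> - 1 = - 1 - \<delta>" by simp
    ultimately show "((\<lambda>s. - (I s powr (- \<delta>)) - \<delta> * R 0 * s) has_real_derivative
        \<delta> * R s - \<delta> * R 0) (at s within {0..S})"
      by (simp add: R_def algebra_simps)
  next
    fix s assume "s \<in> {0<..<S}"
    then show "0 \<le> \<delta> * R s - \<delta> * R 0"
      using R_ge[of s] pos by simp
  qed (use S in auto)
  moreover have "0 < I S powr (- \<delta>)"
    using I_pos[of S] S by simp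
  ultimately have "\<delta> * R 0 * S < M powr (- \<delta>)"
    unfolding I0 by linarith
  also have "\<dots> = M * M powr (- 1 - \<delta>)"
    using pos powr_add[of M 1 "- 1 - \<delta>"] by simp
  finally have "M powr (- 1 - \<delta>) * (\<delta> * a 0 * S) < M powr (- 1 - \<delta>) * M"
    using I0 by (simp add: R_def mult_ac)
  then have "\<delta> * a 0 * S < M"
    by (rule mult_left_less_imp_less) simp
  then show False
    using long pos by (simp add: field_simps)
qed

section \<open>Energy estimates for curves in a Banach space\<close>

locale semi_inner_product = bounded_bilinear ip
  for ip :: "'b::banach \<Rightarrow> 'b \<Rightarrow> real" +
  assumes sym: "ip x y = ip y x" and nonneg: "0 \<le> ip x x"
begin

lemma young: "0 < \<theta> \<Longrightarrow> - (ip x y) \<le> \<theta> * ip y y + ip x x / (4 * \<theta>)"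
proof -
  assume \<theta>: "0 < \<theta>"
  have "0 \<le> ip (x + (2 * \<theta>) *\<^sub>R y) (x + (2 * \<theta>) *\<^sub>R y)" by (rule nonneg)
  also have "\<dots> = 4 * \<theta> * (ip x y + (\<theta> * ip y y + ip x x / (4 * \<theta>)))"
    using \<theta> sym[of y x] by (simp add: add_left add_right scaleR_left scaleR_right algebra_simps)
  finally show ?thesis using \<theta> by (simp add: zero_le_mult_iff)
qed

lemma cauchy_schwarz: "(ip x y)\<^sup>2 \<le> ip x x * ip y y"
proof -
  have "\<bar>ip x y\<bar> \<le> l * ip x x + (ip y y / 4) / l" if l: "0 < l" for l
    using young[of "1 / (4 * l)" x y] young[of "1 / (4 * l)" "- x" y] l
    by (simp add: minus_left minus_right abs_le_iff mult.commute)
  then have "\<bar>ip x y\<bar>\<^sup>2 \<le> 4 * ip x x * (ip y y / 4)"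
    using nonneg by (intro square_le_of_affine_bounds) auto
  then show ?thesis by simp
qed

end

lemma integral_has_vector_derivative_atLeast:
  fixes u :: "real \<Rightarrow> 'b::banach"
  assumes u: "continuous_on {0..} u" and t: "0 \<le> t"
  shows "((\<lambda>t. integral {0..t} u) has_vector_derivative u t) (at t within {0..})"
proof -
  have "((\<lambda>t. integral {0..t} u) has_vector_derivative u t) (at t within {0..t + 1})"
    using t by (intro integral_has_vector_derivative continuous_on_subset[OF u]) auto
  moreover have "at t within {0..t + 1} = at t within {0..}"
    using t by (intro at_within_nhd[of t "{..<t + 1}"]) auto
  ultimately show ?thesis by simp
qed

lemma integral_shift_eq_diff:
  fixes u :: "real \<Rightarrow> 'b::banach"
  assumes u: "continuous_on {0..} u" and "0 \<le> t" "0 \<le> h"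
  shows "integral {t..t + h} u = integral {0..t + h} u - integral {0..t} u"
proof -
  have "u integrable_on {0..t + h}"
    by (intro integrable_continuous_real continuous_on_subset[OF u]) auto
  from Henstock_Kurzweil_Integration.integral_combine[OF _ _ this, of t] assms show ?thesis
    by (simp add: algebra_simps)
qed

lemma integral_shift_has_vector_derivative:
  fixes u :: "real \<Rightarrow> 'b::banach"
  assumes u: "continuous_on {0..} u" and "0 \<le> t" "0 \<le> h"
  shows "((\<lambda>t. integral {t..t + h} u) has_vector_derivative u (t + h) - u t) (at t within {0..})"
proof -
  let ?I = "\<lambda>t. integral {0..t} u"
  have "((\<lambda>t. t + h) has_vector_derivative 1) (at t within {0..})"
    by (auto intro!: derivative_eq_intros)
  moreover have "(?I has_vector_derivative u (t + h)) (at (t + h) within (\<lambda>t. t + h) ` {0..})"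
    by (rule has_vector_derivative_within_subset[OF integral_has_vector_derivative_atLeast[OF u]])
      (use assms in auto)
  ultimately have "((?I \<circ> (\<lambda>t. t + h)) has_vector_derivative 1 *\<^sub>R u (t + h)) (at t within {0..})"
    by (rule vector_diff_chain_within)
  then have "((\<lambda>t. ?I (t + h) - ?I t) has_vector_derivative u (t + h) - u t) (at t within {0..})"
    using has_vector_derivative_diff[OF _ integral_has_vector_derivative_atLeast[OF u \<open>0 \<le> t\<close>]]
    by (simp add: o_def)
  then show ?thesis
    by (rule has_vector_derivative_transform[rotated 2])
      (use assms in \<open>auto simp: integral_shift_eq_diff[OF u]\<close>)
qed

lemma integral_shift_continuous:
  fixes u :: "real \<Rightarrow> 'b::banach"
  assumes "continuous_on {0..} u" "0 \<le> h"
  shows "continuous_on {0..} (\<lambda>t. integral {t..t + h} u)"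
  using integral_shift_has_vector_derivative[OF assms(1) _ assms(2)]
  by (auto simp: continuous_on_eq_continuous_within intro: has_vector_derivative_continuous)

text \<open>Uniform continuity of \<open>u\<close> on \<open>[0, S + 1]\<close>; the extra unit of time
  makes room for the averaging window.\<close>

lemma average_close:
  fixes u :: "real \<Rightarrow> 'b::banach"
  assumes u: "continuous_on {0..} u" and \<eta>: "0 < \<eta>"
  shows "\<exists>h\<^sub>0>0. \<forall>h t. 0 < h \<longrightarrow> h < h\<^sub>0 \<longrightarrow> t \<in> {0..S} \<longrightarrow>
    norm ((1 / h) *\<^sub>R integral {t..t + h} u - u t) \<le> \<eta>"
proof -
  have "uniformly_continuous_on {0..S + 1} u"
    by (intro compact_uniformly_continuous continuous_on_subset[OF u]) auto
  then obtain d where d: "0 < d"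
    "\<And>s t. s \<in> {0..S + 1} \<Longrightarrow> t \<in> {0..S + 1} \<Longrightarrow> dist t s < d \<Longrightarrow> dist (u t) (u s) < \<eta>"
    using \<eta> unfolding uniformly_continuous_on_def by metis
  have "norm ((1 / h) *\<^sub>R integral {t..t + h} u - u t) \<le> \<eta>"
    if h: "0 < h" "h < min d 1" and t: "t \<in> {0..S}" for h t
  proof -
    have c: "continuous_on {t..t + h} u"
      using t h by (intro continuous_on_subset[OF u]) auto
    have "integral {t..t + h} (\<lambda>s. u s - u t) = integral {t..t + h} u - h *\<^sub>R u t"
      using h by (subst integral_diff) (auto intro!: integrable_continuous_real c)
    moreover have "norm (integral {t..t + h} (\<lambda>s. u s - u t)) \<le> \<eta> * (t + h - t)"
    proof (rule integral_bound)
      show "norm (u s - u t) \<le> \<eta>" if "s \<in> {t..t + h}" for s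
        using d(2)[of t s] that t h by (auto simp: dist_norm)
    qed (use h c in \<open>auto intro!: continuous_intros\<close>)
    ultimately have "norm (integral {t..t + h} u - h *\<^sub>R u t) \<le> \<eta> * h" by simp
    moreover have "(1 / h) *\<^sub>R integral {t..t + h} u - u t =
        (1 / h) *\<^sub>R (integral {t..t + h} u - h *\<^sub>R u t)"
      using h by (simp add: algebra_simps)
    then have "norm ((1 / h) *\<^sub>R integral {t..t + h} u - u t) =
        norm (integral {t..t + h} u - h *\<^sub>R u t) / h"
      using h by simp
    ultimately show ?thesis using h by (simp add: divide_le_eq)
  qed
  then show ?thesis using d(1) by (intro exI[of _ "min d 1"]) auto
qed

context semi_inner_product
begin

text \<open>Here \<open>Y(h) = \<integral>\<^sub>0\<^sup>h g - (u(h) - u(0))\<close> stands for minus the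
  Laplacian of \<open>W(h) = \<integral>\<^sub>0\<^sup>h u\<close>, so that \<open>ip (Y h) (W h)
  / h\<^sup>2\<close> is twice the energy of the average \<open>W(h) / h\<close>, and
  \<open>E\<close> is twice the energy of \<open>u 0\<close>; the hypothesis is convexity of the
  energy. Let \<open>Z(h) = W(h) - h u(0)\<close>, whose derivative is \<open>u(h) - u(0) =
  \<integral>\<^sub>0\<^sup>h g - Y(h)\<close>. If the energies of all averages over short
  intervals exceeded that of \<open>u 0\<close> by a fixed amount, convexity would bound \<open>ip
  (Y h) (Z h)\<close> from below by a multiple of \<open>h\<^sup>2\<close>, whereas the
  contribution of \<open>g\<close> is \<open>o(h\<^sup>2)\<close>. So the square norm of
  \<open>Z\<close> would strictly decrease from its value \<open>0\<close> at \<open>h =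
  0\<close>.\<close>

lemma initial_energy_of_averages:
  fixes u g :: "real \<Rightarrow> 'b" and E :: real
  assumes u: "continuous_on {0..} u" and g: "continuous_on {0..} g"
    and convex: "\<And>h. 0 < h \<Longrightarrow>
      ip (integral {0..h} g - (u h - u 0)) (h *\<^sub>R u 0) \<le>
        (E * h\<^sup>2 + ip (integral {0..h} g - (u h - u 0)) (integral {0..h} u)) / 2"
    and pos: "0 < \<epsilon>" "0 < h\<^sub>0"
  shows "\<exists>h>0. h < h\<^sub>0 \<and>
    ip (integral {0..h} g - (u h - u 0)) (integral {0..h} u) \<le> (E + \<epsilon>) * h\<^sup>2"
proof (rule ccontr)
  define W where "W h = integral {0..h} u" for h
  define G where "G h = integral {0..h} g" for h
  define Y where "Y h = G h - (u h - u 0)" for h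
  define Z where "Z h = W h - h *\<^sub>R u 0" for h
  assume "\<not> ?thesis"
  then have large: "(E + \<epsilon>) * h\<^sup>2 < ip (Y h) (W h)" if "0 < h" "h < h\<^sub>0" for h
    using that by (auto simp: Y_def W_def G_def not_le)
  obtain K where K: "0 < K" "\<And>x y. norm (ip x y) \<le> norm x * norm y * K"
    using pos_bounded by blast
  have "bounded (g ` {0..1})"
    by (intro compact_imp_bounded compact_continuous_image continuous_on_subset[OF g]) auto
  then obtain C where C: "\<And>s. s \<in> {0..1} \<Longrightarrow> norm (g s) \<le> C"
    unfolding bounded_iff by (metis imageI)
  have C0: "0 \<le> C" using C[of 0] norm_ge_zero[of "g 0"] by (simp del: norm_ge_zero)
  \<comment> \<open>chosen so that the contribution of \<open>G\<close> to \<open>slope\<close> is at most \<open>\<epsilon> / 4 * h\<^sup>2\<close>\<close>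
  define \<omega> where "\<omega> = \<epsilon> / (4 * K * (C + 1))"
  have \<omega>: "0 < \<omega>" using pos K C0 by (simp add: \<omega>_def)
  obtain d where d: "0 < d" "\<And>s. 0 \<le> s \<Longrightarrow> s < d \<Longrightarrow> norm (u s - u 0) \<le> \<omega>"
  proof -
    have "continuous (at 0 within {0..}) u"
      using u by (simp add: continuous_on_eq_continuous_within)
    then obtain d where "0 < d" "\<And>s. s \<in> {0..} \<Longrightarrow> dist s 0 < d \<Longrightarrow> dist (u s) (u 0) < \<omega>"
      using \<omega> unfolding continuous_within_eps_delta by metis
    then show ?thesis
      by (intro that[of d]) (auto simp: dist_norm intro: less_imp_le)
  qed
  define h\<^sub>1 where "h\<^sub>1 = min (min d 1) h\<^sub>0 / 2"
  have h1: "0 < h\<^sub>1" "h\<^sub>1 < d" "h\<^sub>1 < 1" "h\<^sub>1 < h\<^sub>0"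
    using d(1) pos by (auto simp: h\<^sub>1_def)
  have Z': "(Z has_vector_derivative u h - u 0) (at h within {0..})" if "0 \<le> h" for h
    unfolding Z_def W_def
    by (auto intro!: derivative_eq_intros integral_has_vector_derivative_atLeast[OF u that])
  have Z_bound: "norm (Z h) \<le> \<omega> * h" if h: "h \<in> {0..h\<^sub>1}" for h
  proof -
    have c: "continuous_on {0..h} u" by (intro continuous_on_subset[OF u]) auto
    have "Z h = integral {0..h} (\<lambda>s. u s - u 0)"
      unfolding Z_def W_def
      using h by (subst integral_diff) (auto intro!: integrable_continuous_real c)
    moreover have "norm (integral {0..h} (\<lambda>s. u s - u 0)) \<le> \<omega> * (h - 0)"
      by (rule integral_bound) (use h h1 d(2) c in \<open>auto intro!: continuous_intros\<close>)
    ultimately show ?thesis by simp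
  qed
  have G_bound: "norm (G h) \<le> C * h" if h: "h \<in> {0..h\<^sub>1}" for h
  proof -
    have "norm (integral {0..h} g) \<le> C * (h - 0)"
      by (rule integral_bound) (use h h1 C in \<open>auto intro!: continuous_on_subset[OF g]\<close>)
    then show ?thesis by (simp add: G_def)
  qed
  have slope: "ip (Z h) (u h - u 0) \<le> - (\<epsilon> / 4) * h\<^sup>2" if h: "h \<in> {0<..<h\<^sub>1}" for h
  proof -
    have "norm (ip (Z h) (G h)) \<le> norm (Z h) * norm (G h) * K" by (rule K(2))
    also have "\<dots> \<le> (\<omega> * h) * (C * h) * K"
      using Z_bound[of h] G_bound[of h] h K \<omega> C0 by (intro mult_mono) auto
    also have "\<dots> = (\<omega> * C * K) * h\<^sup>2" by (simp add: power2_eq_square)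
    also have "\<dots> \<le> (\<epsilon> / 4) * h\<^sup>2"
    proof (rule mult_right_mono)
      have "\<omega> * C * K \<le> \<omega> * (C + 1) * K"
        using \<omega> K by simp
      also have "\<dots> = \<epsilon> / 4"
      proof -
        have "4 * K * (C + 1) \<noteq> 0" using K C0 by simp
        then have "\<epsilon> = \<omega> * (4 * K * (C + 1))" by (simp add: \<omega>_def)
        then show ?thesis by simp
      qed
      finally show "\<omega> * C * K \<le> \<epsilon> / 4" .
    qed simp
    finally have "ip (Z h) (G h) \<le> (\<epsilon> / 4) * h\<^sup>2" by simp
    moreover have "\<epsilon> / 2 * h\<^sup>2 \<le> ip (Z h) (Y h)"
    proof -
      have "ip (Y h) (h *\<^sub>R u 0) \<le> (E * h\<^sup>2 + ip (Y h) (W h)) / 2"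
        using convex[of h] h by (simp add: Y_def G_def W_def)
      moreover have "(E + \<epsilon>) * h\<^sup>2 \<le> ip (Y h) (W h)"
        using large[of h] h h1 by simp
      ultimately have "\<epsilon> / 2 * h\<^sup>2 \<le> ip (Y h) (W h) - ip (Y h) (h *\<^sub>R u 0)"
        by (simp add: algebra_simps)
      then show ?thesis using sym[of "Z h" "Y h"] by (simp add: Z_def diff_right)
    qed
    moreover have "ip (Z h) (u h - u 0) = ip (Z h) (G h) - ip (Z h) (Y h)"
      by (simp add: Y_def diff_right)
    ultimately show ?thesis by simp
  qed
  have "- (ip (Z 0) (Z 0)) - \<epsilon> / 6 * 0 ^ 3 \<le> - (ip (Z h\<^sub>1) (Z h\<^sub>1)) - \<epsilon> / 6 * h\<^sub>1 ^ 3"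
  proof (rule within_deriv_nonneg_imp_le[where \<phi> = "\<lambda>h. - (ip (Z h) (Z h)) - \<epsilon> / 6 * h ^ 3"
        and \<phi>' = "\<lambda>h. - (2 * ip (Z h) (u h - u 0)) - \<epsilon> / 2 * h\<^sup>2"])
    fix h assume h: "h \<in> {0..h\<^sub>1}"
    then have "(Z has_vector_derivative u h - u 0) (at h within {0..h\<^sub>1})"
      by (auto intro: has_vector_derivative_within_subset[OF Z'])
    from has_vector_derivative[OF this this]
    have "((\<lambda>h. ip (Z h) (Z h)) has_real_derivative 2 * ip (Z h) (u h - u 0)) (at h within {0..h\<^sub>1})"
      using sym[of "u h - u 0" "Z h"] by (simp add: has_real_derivative_iff_has_vector_derivative)
    then show "((\<lambda>h. - (ip (Z h) (Z h)) - \<epsilon> / 6 * h ^ 3) has_real_derivative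
        - (2 * ip (Z h) (u h - u 0)) - \<epsilon> / 2 * h\<^sup>2) (at h within {0..h\<^sub>1})"
      by (auto intro!: derivative_eq_intros simp: power2_eq_square)
  next
    fix h assume "h \<in> {0<..<h\<^sub>1}"
    from slope[OF this] show "0 \<le> - (2 * ip (Z h) (u h - u 0)) - \<epsilon> / 2 * h\<^sup>2" by simp
  qed (use h1 in auto)
  then have "ip (Z h\<^sub>1) (Z h\<^sub>1) + \<epsilon> / 6 * h\<^sub>1 ^ 3 \<le> 0"
    by (simp add: Z_def W_def zero_left)
  moreover have "0 < \<epsilon> / 6 * h\<^sub>1 ^ 3" using pos h1 by simp
  ultimately show False using nonneg[of "Z h\<^sub>1"] by linarith
qed

text \<open>\<open>Y\<close> plays the role of the derivative of a convex quadratic energy at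
  \<open>U\<close>, whose value there is \<open>ip (Y t) (U t) / 2\<close>. It need not be
  differentiable in time: convexity at \<open>s\<close> and at \<open>t\<close> encloses the
  increment of the energy between \<open>ip (Y t) (U s - U t)\<close> and \<open>ip (Y s) (U s - U
  t)\<close>.\<close>

lemma energy_has_derivative:
  fixes U D Y :: "real \<Rightarrow> 'b"
  assumes U': "(U has_vector_derivative D t) (at t within T)"
    and Y: "(Y \<longlongrightarrow> Y t) (at t within T)"
    and t: "t \<in> T"
    and convex: "\<And>s r. s \<in> T \<Longrightarrow> r \<in> T \<Longrightarrow> ip (Y s) (U r) \<le> (ip (Y r) (U r) + ip (Y s) (U s)) / 2"
  shows "((\<lambda>s. ip (Y s) (U s) / 2) has_real_derivative ip (Y t) (D t)) (at t within T)"
proof -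
  define \<Delta> where "\<Delta> s = (1 / (s - t)) *\<^sub>R (U s - U t)" for s
  have \<Delta>: "(\<Delta> \<longlongrightarrow> D t) (at t within T)"
  proof (rule LIM_zero_cancel, rule tendsto_norm_zero_cancel)
    have "((\<lambda>s. norm ((1 / norm (s - t)) *\<^sub>R (U s - (U t + (s - t) *\<^sub>R D t)))) \<longlongrightarrow> 0) (at t within T)"
      using U' unfolding has_vector_derivative_def has_derivative_within
      by (intro tendsto_norm_zero) simp
    moreover have "norm ((1 / norm (s - t)) *\<^sub>R (U s - (U t + (s - t) *\<^sub>R D t))) = norm (\<Delta> s - D t)"
      if "s \<noteq> t" for s
    proof -
      have "\<Delta> s - D t = (1 / (s - t)) *\<^sub>R (U s - (U t + (s - t) *\<^sub>R D t))"
        using that by (simp add: \<Delta>_def scaleR_diff_right scaleR_add_right)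
      then show ?thesis by (simp add: abs_divide)
    qed
    then have "\<forall>\<^sub>F s in at t within T.
        norm ((1 / norm (s - t)) *\<^sub>R (U s - (U t + (s - t) *\<^sub>R D t))) = norm (\<Delta> s - D t)"
      by (auto simp: eventually_at_filter)
    ultimately show "((\<lambda>s. norm (\<Delta> s - D t)) \<longlongrightarrow> 0) (at t within T)"
      by (rule Lim_transform_eventually)
  qed
  define q where "q s = (ip (Y s) (U s) / 2 - ip (Y t) (U t) / 2) / (s - t)" for s
  have "((\<lambda>s. q s - ip (Y t) (\<Delta> s)) \<longlongrightarrow> 0) (at t within T)"
  proof (rule Lim_null_comparison)
    show "\<forall>\<^sub>F s in at t within T. norm (q s - ip (Y t) (\<Delta> s)) \<le> norm (ip (Y s - Y t) (\<Delta> s))"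
      unfolding eventually_at_filter
    proof (intro always_eventually allI impI)
      fix s assume s: "s \<noteq> t" "s \<in> T"
      have 1: "0 \<le> (ip (Y s) (U s) / 2 - ip (Y t) (U t) / 2) - ip (Y t) (U s - U t)"
        using convex[OF t s(2)] by (simp add: diff_right field_simps)
      have 2: "(ip (Y s) (U s) / 2 - ip (Y t) (U t) / 2) - ip (Y t) (U s - U t)
          \<le> ip (Y s - Y t) (U s - U t)"
        using convex[OF s(2) t] by (simp add: diff_right diff_left field_simps)
      have "q s - ip (Y t) (\<Delta> s) =
          ((ip (Y s) (U s) / 2 - ip (Y t) (U t) / 2) - ip (Y t) (U s - U t)) / (s - t)"
        by (simp add: q_def \<Delta>_def scaleR_right diff_divide_distrib)
      moreover have "ip (Y s - Y t) (\<Delta> s) = ip (Y s - Y t) (U s - U t) / (s - t)"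
        by (simp add: \<Delta>_def scaleR_right)
      ultimately show "norm (q s - ip (Y t) (\<Delta> s)) \<le> norm (ip (Y s - Y t) (\<Delta> s))"
        using 1 2 by (simp add: divide_right_mono)
    qed
    have "((\<lambda>s. ip (Y s - Y t) (\<Delta> s)) \<longlongrightarrow> ip (Y t - Y t) (D t)) (at t within T)"
      by (intro tendsto tendsto_intros Y \<Delta>)
    then show "((\<lambda>s. norm (ip (Y s - Y t) (\<Delta> s))) \<longlongrightarrow> 0) (at t within T)"
      by (intro tendsto_norm_zero) (simp add: zero_left)
  qed
  moreover have "((\<lambda>s. ip (Y t) (\<Delta> s)) \<longlongrightarrow> ip (Y t) (D t)) (at t within T)"
    by (intro tendsto tendsto_const \<Delta>)
  ultimately have "((\<lambda>s. (q s - ip (Y t) (\<Delta> s)) + ip (Y t) (\<Delta> s)) \<longlongrightarrow> 0 + ip (Y t) (D t)) (at t within T)"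
    by (rule tendsto_add)
  then show ?thesis
    by (simp add: has_field_derivative_iff q_def)
qed

text \<open>The curve \<open>U\<close> solves \<open>D = G - Y\<close> with \<open>D\<close> its velocity,
  \<open>Y\<close> the derivative of the convex energy and \<open>G\<close> a forcing that is only
  close to the gradient \<open>q\<close> of the potential \<open>N\<close>. With \<open>J = N - ip
  Y U / 2 - \<Gamma>\<close>, the derivative of \<open>J\<close> is \<open>ip D D + ip (q - G)
  D\<close>. Giving up the fraction \<open>1 - \<kappa>\<close> of the dissipation \<open>ip D
  D\<close> absorbs the error term, and the margin \<open>3 j\<close> at the start covers the
  accumulated loss and the corresponding error in the derivative of \<open>ip U U\<close>. What
  remains are the hypotheses of \<open>concavity_contradiction\<close>.\<close>

lemma smoothed_flow_contradiction:
  fixes U D G q :: "real \<Rightarrow> 'b" and N :: "real \<Rightarrow> real"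
  defines "Y \<equiv> \<lambda>t. G t - D t"
  assumes U': "\<And>t. t \<in> {0..S} \<Longrightarrow> (U has_vector_derivative D t) (at t within {0..S})"
    and D: "continuous_on {0..S} D" and G: "continuous_on {0..S} G"
    and convex: "\<And>s r. s \<in> {0..S} \<Longrightarrow> r \<in> {0..S} \<Longrightarrow>
      ip (Y s) (U r) \<le> (ip (Y r) (U r) + ip (Y s) (U s)) / 2"
    and poincare: "\<And>t. t \<in> {0..S} \<Longrightarrow> lam * ip (U t) (U t) \<le> ip (Y t) (U t)"
    and N': "\<And>t. t \<in> {0..S} \<Longrightarrow> (N has_real_derivative ip (q t) (D t)) (at t within {0..S})"
    and superlinear: "\<And>t. t \<in> {0..S} \<Longrightarrow> \<alpha> * N t \<le> ip (q t) (U t) + \<beta> * ip (U t) (U t) + \<Gamma>"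
    and near: "\<And>t. t \<in> {0..S} \<Longrightarrow> ip (U t) (q t - G t) \<le> \<alpha> * j"
      "\<And>t. t \<in> {0..S} \<Longrightarrow> ip (q t - G t) (q t - G t) * S \<le> 4 * (1 - \<kappa>) * j"
    and start: "3 * j \<le> N 0 - ip (Y 0) (U 0) / 2 - \<Gamma>"
    and const: "2 < \<alpha>" "\<beta> \<le> (\<alpha> - 2) * lam / 2" "0 \<le> \<Gamma>" "0 < j" "\<kappa> < 1" "0 < \<delta>" "0 < M"
    and init_pos: "0 < ip (U 0) (U 0)"
    and exponent: "2 * (1 + \<delta>)\<^sup>2 \<le> \<alpha> * \<kappa>"
    and M: "(1 + \<delta>) * (1 + 1 / \<delta>) * (ip (U 0) (U 0))\<^sup>2 \<le> 2 * \<alpha> * j * M"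
    and long: "M / (\<delta> * ip (U 0) (U 0)) \<le> S"
  shows False
proof -
  define P where "P t = integral {0..t} (\<lambda>s. ip (D s) (D s))" for t
  have S: "0 < S"
    using long const init_pos by (smt (verit) divide_pos_pos mult_pos_pos)
  have dd: "continuous_on {0..S} (\<lambda>s. ip (D s) (D s))"
    by (intro continuous_on D)
  have P': "(P has_real_derivative ip (D t) (D t)) (at t within {0..S})" if "t \<in> {0..S}" for t
    unfolding P_def using integral_has_real_derivative[OF dd that] .
  have a': "((\<lambda>t. ip (U t) (U t)) has_real_derivative 2 * ip (U t) (D t)) (at t within {0..S})"
    if "t \<in> {0..S}" for t
    using has_vector_derivative[OF U'[OF that] U'[OF that]] sym[of "D t" "U t"]
    by (simp add: has_real_derivative_iff_has_vector_derivative)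
  define J where "J t = N t - ip (Y t) (U t) / 2 - \<Gamma>" for t
  have J': "(J has_real_derivative ip (q t) (D t) - ip (Y t) (D t)) (at t within {0..S})"
    if t: "t \<in> {0..S}" for t
  proof -
    have "continuous_on {0..S} Y" unfolding Y_def by (intro continuous_intros D G)
    then have "(Y \<longlongrightarrow> Y t) (at t within {0..S})" using t by (simp add: continuous_on_def)
    then have "((\<lambda>s. ip (Y s) (U s) / 2) has_real_derivative ip (Y t) (D t)) (at t within {0..S})"
      by (intro energy_has_derivative U' t convex)
    from DERIV_diff[OF DERIV_diff[OF N'[OF t] this] DERIV_const[of \<Gamma>]] show ?thesis
      unfolding J_def by simp
  qed
  \<comment> \<open>the rate of loss that \<open>near\<close> permits, which adds up to at most \<open>j\<close> over the interval\<close>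
  define c where "c = j / S"
  have J_ge: "2 * j + \<kappa> * P t \<le> J t" if t: "t \<in> {0..S}" for t
  proof -
    have "J 0 - \<kappa> * P 0 + c * 0 \<le> J t - \<kappa> * P t + c * t"
    proof (rule within_deriv_nonneg_imp_le[where \<phi> = "\<lambda>t. J t - \<kappa> * P t + c * t" and
          \<phi>' = "\<lambda>t. ip (q t) (D t) - ip (Y t) (D t) - \<kappa> * ip (D t) (D t) + c"])
      fix s assume s: "s \<in> {0..t}"
      then have s': "s \<in> {0..S}" using t by auto
      show "((\<lambda>t. J t - \<kappa> * P t + c * t) has_real_derivative
          ip (q s) (D s) - ip (Y s) (D s) - \<kappa> * ip (D s) (D s) + c) (at s within {0..t})"
        by (rule DERIV_subset[where s = "{0..S}"])
          (use t in \<open>auto intro!: derivative_eq_intros J'[OF s'] P'[OF s']\<close>)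
    next
      fix s assume s: "s \<in> {0<..<t}"
      then have s': "s \<in> {0..S}" using t by auto
      have "- (ip (q s - G s) (D s)) \<le>
          (1 - \<kappa>) * ip (D s) (D s) + ip (q s - G s) (q s - G s) / (4 * (1 - \<kappa>))"
        using const by (intro young) simp
      also have "ip (q s - G s) (q s - G s) / (4 * (1 - \<kappa>)) \<le> c"
        using near(2)[OF s'] S const by (simp add: c_def field_simps)
      finally show "0 \<le> ip (q s) (D s) - ip (Y s) (D s) - \<kappa> * ip (D s) (D s) + c"
        by (simp add: Y_def diff_left algebra_simps)
    qed (use t in auto)
    moreover have "c * t \<le> j"
      using t S const by (simp add: c_def field_simps mult_left_mono)
    ultimately show ?thesis using start by (simp add: J_def P_def)
  qed
  show False
  proof (rule concavity_contradiction[OF a' P'])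
    show "(2 * ip (U t) (D t))\<^sup>2 \<le> 4 * ip (U t) (U t) * ip (D t) (D t)" for t
      using cauchy_schwarz[of "U t" "D t"] by (simp add: power_mult_distrib)
    show "2 * \<alpha> * (j + \<kappa> * P t) \<le> 2 * ip (U t) (D t)" if t: "t \<in> {0..S}" for t
    proof -
      let ?a = "ip (U t) (U t)" and ?e = "ip (Y t) (U t)"
      have 1: "ip (U t) (D t) = ip (q t) (U t) - ip (U t) (q t - G t) - ?e"
        using sym[of "U t" "q t"] sym[of "U t" "G t"] sym[of "U t" "D t"]
        by (simp add: Y_def diff_left diff_right)
      have 2: "\<beta> * ?a \<le> (\<alpha> - 2) / 2 * ?e"
      proof -
        have "\<beta> * ?a \<le> (\<alpha> - 2) * lam / 2 * ?a"
          using const nonneg by (intro mult_right_mono) auto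
        also have "\<dots> = (\<alpha> - 2) / 2 * (lam * ?a)" by simp
        also have "\<dots> \<le> (\<alpha> - 2) / 2 * ?e"
          using const poincare[OF t] by (intro mult_left_mono) auto
        finally show ?thesis .
      qed
      have 3: "\<Gamma> \<le> \<alpha> * \<Gamma>"
        using const mult_right_mono[of 1 \<alpha> \<Gamma>] by simp
      have "\<alpha> * (2 * j + \<kappa> * P t) \<le> \<alpha> * J t"
        using J_ge[OF t] const by (intro mult_left_mono) auto
      also have "\<dots> = \<alpha> * N t - \<alpha> / 2 * ?e - \<alpha> * \<Gamma>"
        by (simp add: J_def algebra_simps)
      finally have "\<alpha> * (2 * j + \<kappa> * P t) - \<alpha> * j \<le> ip (U t) (D t)"
        using 1 2 3 superlinear[OF t] near(1)[OF t] by (simp add: algebra_simps diff_divide_distrib)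
      then show ?thesis by (simp add: algebra_simps)
    qed
    show "P 0 = 0" by (simp add: P_def)
  qed (use const init_pos exponent M long nonneg in auto)
qed

end

section \<open>Square integrals of bounded continuous functions\<close>

instance bcontfun :: (metric_space, banach) banach ..

definition zero_ext :: "'a::euclidean_space set \<Rightarrow> ('a \<Rightarrow> real) \<Rightarrow> 'a \<Rightarrow>\<^sub>C real" where
  "zero_ext \<Omega> v = Bcontfun (\<lambda>x. if x \<in> \<Omega> then v x else 0)"

text \<open>Zero boundary values make the extension by zero continuous on the whole space, so that functions
  on \<open>\<Omega>\<close> become elements of one Banach space and curves of such functions can
  be integrated and differentiated there.\<close>

lemma zero_ext_apply:
  fixes v :: "'a::euclidean_space \<Rightarrow> real"
  assumes \<Omega>: "open \<Omega>" "bounded \<Omega>"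
    and v: "continuous_on (closure \<Omega>) v" "\<And>x. x \<in> frontier \<Omega> \<Longrightarrow> v x = 0"
  shows "apply_bcontfun (zero_ext \<Omega> v) x = (if x \<in> \<Omega> then v x else 0)"
proof -
  let ?v = "\<lambda>x. if x \<in> \<Omega> then v x else 0"
  have "continuous_on (closure \<Omega>) ?v"
    using v(1) by (rule continuous_on_eq) (use v(2) \<Omega> in \<open>auto simp: frontier_def interior_open\<close>)
  moreover have "continuous_on (- \<Omega>) ?v"
    by (rule continuous_on_eq[OF continuous_on_const[of _ 0]]) auto
  ultimately have "continuous_on (closure \<Omega> \<union> - \<Omega>) ?v"
    using \<Omega> by (intro continuous_on_closed_Un) (auto simp: closed_Compl)
  moreover have "closure \<Omega> \<union> - \<Omega> = UNIV" using closure_subset by auto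
  ultimately have cont: "continuous_on UNIV ?v" by simp
  have "bounded (v ` closure \<Omega>)"
    using \<Omega> v by (intro compact_imp_bounded compact_continuous_image) auto
  then obtain B where B: "\<And>x. x \<in> closure \<Omega> \<Longrightarrow> norm (v x) \<le> B"
    unfolding bounded_iff by (metis imageI)
  have "norm (?v x) \<le> max 0 B" for x
    using B[of x] closure_subset[of \<Omega>] by (auto simp: le_max_iff_disj)
  with cont have "?v \<in> bcontfun" by (rule bcontfun_normI)
  then show ?thesis by (simp add: zero_ext_def Bcontfun_inverse)
qed

lemma zero_ext_continuous:
  fixes \<phi> :: "'a::euclidean_space \<Rightarrow> real \<Rightarrow> real"
  assumes \<Omega>: "open \<Omega>" "bounded \<Omega>"
    and cont: "continuous_on (closure \<Omega> \<times> J) (\<lambda>(x, t). \<phi> x t)"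
    and zero: "\<And>x t. x \<in> frontier \<Omega> \<Longrightarrow> t \<in> J \<Longrightarrow> \<phi> x t = 0"
  shows "t \<in> J \<Longrightarrow> apply_bcontfun (zero_ext \<Omega> (\<lambda>x. \<phi> x t)) x = (if x \<in> \<Omega> then \<phi> x t else 0)"
    and "continuous_on J (\<lambda>t. zero_ext \<Omega> (\<lambda>x. \<phi> x t))"
proof -
  have val: "apply_bcontfun (zero_ext \<Omega> (\<lambda>x. \<phi> x t)) x = (if x \<in> \<Omega> then \<phi> x t else 0)"
    if "t \<in> J" for t x
  proof (rule zero_ext_apply[OF \<Omega>])
    have "continuous_on (closure \<Omega>) (\<lambda>x. case (x, t) of (x, t) \<Rightarrow> \<phi> x t)"
      using that by (intro continuous_on_compose2[OF cont] continuous_intros) auto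
    then show "continuous_on (closure \<Omega>) (\<lambda>x. \<phi> x t)" by simp
  qed (use zero that in auto)
  then show "t \<in> J \<Longrightarrow> apply_bcontfun (zero_ext \<Omega> (\<lambda>x. \<phi> x t)) x = (if x \<in> \<Omega> then \<phi> x t else 0)" .
  have swap: "continuous_on (J \<times> closure \<Omega>) (\<lambda>(t, x). \<phi> x t)"
  proof -
    have "continuous_on (J \<times> closure \<Omega>) (\<lambda>p. (\<lambda>(x, t). \<phi> x t) (snd p, fst p))"
      by (intro continuous_on_compose2[OF cont] continuous_intros) auto
    then show ?thesis by (simp add: split_beta)
  qed
  show "continuous_on J (\<lambda>t. zero_ext \<Omega> (\<lambda>x. \<phi> x t))"
    unfolding continuous_on_iff
  proof (intro ballI allI impI)
    fix t and e :: real
    assume t: "t \<in> J" and e: "0 < e"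
    obtain X where X: "t \<in> X" "open X"
      "\<forall>s\<in>X \<inter> J. \<forall>x\<in>closure \<Omega>. dist (case (s, x) of (t, x) \<Rightarrow> \<phi> x t) (case (t, x) of (t, x) \<Rightarrow> \<phi> x t) \<le> e / 2"
      using continuous_on_prod_compactE[OF swap _ t, of "e / 2"] \<Omega> e by auto
    obtain d where d: "0 < d" "ball t d \<subseteq> X"
      using X by (auto simp: open_contains_ball)
    have "dist (zero_ext \<Omega> (\<lambda>x. \<phi> x s)) (zero_ext \<Omega> (\<lambda>x. \<phi> x t)) < e"
      if s: "s \<in> J" "dist s t < d" for s
    proof -
      have "s \<in> X" using d s by (auto simp: dist_commute)
      then have "dist (zero_ext \<Omega> (\<lambda>x. \<phi> x s)) (zero_ext \<Omega> (\<lambda>x. \<phi> x t)) \<le> e / 2"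
        using X(3) s(1) e closure_subset[of \<Omega>]
        by (intro dist_bound) (auto simp: val t)
      then show ?thesis using e by simp
    qed
    then show "\<exists>d>0. \<forall>s\<in>J. dist s t < d \<longrightarrow>
        dist (zero_ext \<Omega> (\<lambda>x. \<phi> x s)) (zero_ext \<Omega> (\<lambda>x. \<phi> x t)) < e"
      using d(1) by blast
  qed
qed

lemma set_integrable_product_bcontfun:
  fixes v w :: "'a::euclidean_space \<Rightarrow>\<^sub>C real"
  assumes "open \<Omega>" "bounded \<Omega>"
  shows "set_integrable lborel \<Omega> (\<lambda>x. v x * w x)"
proof (rule set_integrable_bounded[OF assms])
  show "\<bar>v x * w x\<bar> \<le> norm v * norm w" for x
    unfolding abs_mult using norm_bounded[of v x] norm_bounded[of w x] by (intro mult_mono) auto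
qed (intro continuous_intros, auto)

lemma set_integral_abs_le:
  fixes F :: "'a::euclidean_space \<Rightarrow> real"
  assumes \<Omega>: "open \<Omega>" "bounded \<Omega>" and F: "set_integrable lborel \<Omega> F"
    and B: "\<And>x. x \<in> \<Omega> \<Longrightarrow> \<bar>F x\<bar> \<le> B"
  shows "\<bar>LINT x:\<Omega>|lborel. F x\<bar> \<le> B * measure lborel \<Omega>"
proof -
  have c: "set_integrable lborel \<Omega> (\<lambda>_. B)" for B :: real
    by (rule set_integrable_bounded[OF \<Omega>]) auto
  have m: "(LINT x:\<Omega>|lborel. C) = C * measure lborel \<Omega>" for C :: real
    using \<Omega> emeasure_bounded_finite[of \<Omega>] by (simp add: set_lebesgue_integral_def mult.commute)
  have "(LINT x:\<Omega>|lborel. F x) \<le> (LINT x:\<Omega>|lborel. B)"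
    using B by (intro set_integral_mono F c) (auto simp: abs_le_iff)
  moreover have "(LINT x:\<Omega>|lborel. - B) \<le> (LINT x:\<Omega>|lborel. F x)"
    by (intro set_integral_mono F c) (use B in \<open>force simp: abs_le_iff\<close>)
  ultimately show ?thesis by (simp add: m abs_le_iff)
qed

definition L2_ip :: "'a::euclidean_space set \<Rightarrow> ('a \<Rightarrow>\<^sub>C real) \<Rightarrow> ('a \<Rightarrow>\<^sub>C real) \<Rightarrow> real" where
  "L2_ip \<Omega> v w = (LINT x:\<Omega>|lborel. v x * w x)"

lemma semi_inner_product_L2_ip:
  fixes \<Omega> :: "'a::euclidean_space set"
  assumes \<Omega>: "open \<Omega>" "bounded \<Omega>"
  shows "semi_inner_product (L2_ip \<Omega>)"
proof
  note int = set_integrable_product_bcontfun[OF \<Omega>]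
  fix a b c :: "'a \<Rightarrow>\<^sub>C real" and r :: real
  show "L2_ip \<Omega> (a + b) c = L2_ip \<Omega> a c + L2_ip \<Omega> b c"
    using set_integral_add(2)[OF int[of a c] int[of b c]] by (simp add: L2_ip_def distrib_right)
  show "L2_ip \<Omega> a (b + c) = L2_ip \<Omega> a b + L2_ip \<Omega> a c"
    using set_integral_add(2)[OF int[of a b] int[of a c]] by (simp add: L2_ip_def distrib_left)
  show "L2_ip \<Omega> (r *\<^sub>R a) b = r *\<^sub>R L2_ip \<Omega> a b"
    by (simp add: L2_ip_def mult.assoc)
  show "L2_ip \<Omega> a (r *\<^sub>R b) = r *\<^sub>R L2_ip \<Omega> a b"
    by (simp add: L2_ip_def mult.left_commute)
  show "\<exists>K. \<forall>a b. norm (L2_ip \<Omega> a b) \<le> norm a * norm b * K"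
  proof (intro exI allI)
    fix a b :: "'a \<Rightarrow>\<^sub>C real"
    have "\<bar>a x * b x\<bar> \<le> norm a * norm b" for x
      unfolding abs_mult using norm_bounded[of a x] norm_bounded[of b x] by (intro mult_mono) auto
    then show "norm (L2_ip \<Omega> a b) \<le> norm a * norm b * measure lborel \<Omega>"
      unfolding L2_ip_def real_norm_def by (intro set_integral_abs_le \<Omega> int)
  qed
  show "L2_ip \<Omega> a b = L2_ip \<Omega> b a" by (simp add: L2_ip_def mult.commute)
  show "0 \<le> L2_ip \<Omega> a a"
    unfolding L2_ip_def set_lebesgue_integral_def by (intro Bochner_Integration.integral_nonneg) auto
qed

lemma integral_apply_bcontfun:
  fixes u :: "real \<Rightarrow> 'a::metric_space \<Rightarrow>\<^sub>C real"
  assumes "continuous_on {a..b} u"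
  shows "apply_bcontfun (integral {a..b} u) x = integral {a..b} (\<lambda>t. u t x)"
proof -
  have "bounded_linear (\<lambda>v::'a \<Rightarrow>\<^sub>C real. apply_bcontfun v x)"
  proof (rule bounded_linear_intro[where K = 1])
    show "norm (apply_bcontfun v x) \<le> norm v * 1" for v :: "'a \<Rightarrow>\<^sub>C real"
      using norm_bounded[of v x] by simp
  qed auto
  from integral_linear[OF integrable_continuous_real[OF assms] this] show ?thesis
    by (simp add: o_def)
qed

definition superposition :: "(real \<Rightarrow> real) \<Rightarrow> ('a::euclidean_space \<Rightarrow>\<^sub>C real) \<Rightarrow> 'a \<Rightarrow>\<^sub>C real" where
  "superposition f v = Bcontfun (\<lambda>x. f (v x))"

lemma superposition_apply:
  assumes f: "continuous_on UNIV f"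
  shows "apply_bcontfun (superposition f v) x = f (v x)"
proof -
  have "bounded (f ` cball 0 (norm v))"
    by (intro compact_imp_bounded compact_continuous_image continuous_on_subset[OF f]) auto
  then obtain B where B: "\<forall>z\<in>f ` cball 0 (norm v). norm z \<le> B"
    unfolding bounded_iff by blast
  have "(\<lambda>x. f (v x)) \<in> bcontfun"
  proof (rule bcontfun_normI)
    show "continuous_on UNIV (\<lambda>x. f (v x))"
      by (rule continuous_on_compose2[OF f]) auto
    show "norm (f (v x)) \<le> B" for x
      using B norm_bounded[of v x] by simp
  qed
  then show ?thesis by (simp add: superposition_def Bcontfun_inverse)
qed

lemma uniform_continuity_modulus:
  fixes f :: "real \<Rightarrow> real"
  assumes f: "continuous_on UNIV f" and "0 < \<eta>"
  shows "\<exists>d>0. \<forall>p q. \<bar>p\<bar> \<le> R \<longrightarrow> \<bar>q\<bar> \<le> R \<longrightarrow> \<bar>p - q\<bar> < d \<longrightarrow> \<bar>f p - f q\<bar> \<le> \<eta>"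
proof -
  have "uniformly_continuous_on (cball 0 R) f"
    by (intro compact_uniformly_continuous continuous_on_subset[OF f]) auto
  then obtain d where "0 < d"
    "\<And>p q. q \<in> cball 0 R \<Longrightarrow> p \<in> cball 0 R \<Longrightarrow> dist p q < d \<Longrightarrow> dist (f p) (f q) < \<eta>"
    using assms unfolding uniformly_continuous_on_def by metis
  then show ?thesis by (intro exI[of _ d]) (auto simp: dist_real_def intro: less_imp_le)
qed

lemma superposition_uniformly_continuous:
  fixes f :: "real \<Rightarrow> real"
  assumes f: "continuous_on UNIV f" and "0 < \<eta>"
  shows "\<exists>d>0. \<forall>v w :: 'a::euclidean_space \<Rightarrow>\<^sub>C real. norm v \<le> R \<longrightarrow> norm w \<le> R \<longrightarrow>
    norm (v - w) < d \<longrightarrow> norm (superposition f v - superposition f w) \<le> \<eta>"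
proof -
  obtain d where d: "0 < d"
    "\<And>p q. \<bar>p\<bar> \<le> R \<Longrightarrow> \<bar>q\<bar> \<le> R \<Longrightarrow> \<bar>p - q\<bar> < d \<Longrightarrow> \<bar>f p - f q\<bar> \<le> \<eta>"
    using uniform_continuity_modulus[OF assms, of R] by blast
  have "norm (superposition f v - superposition f w) \<le> \<eta>"
    if "norm v \<le> R" "norm w \<le> R" "norm (v - w) < d" for v w :: "'a \<Rightarrow>\<^sub>C real"
  proof (rule norm_bound)
    fix x
    show "norm (apply_bcontfun (superposition f v - superposition f w) x) \<le> \<eta>"
      using d(2)[of "v x" "w x"] norm_bounded[of v x] norm_bounded[of w x] norm_bounded[of "v - w" x] that
      by (simp add: superposition_apply[OF f])
  qed
  then show ?thesis using d(1) by blast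
qed

lemma superposition_continuous:
  assumes f: "continuous_on UNIV f"
  shows "continuous_on UNIV (superposition f :: ('a::euclidean_space \<Rightarrow>\<^sub>C real) \<Rightarrow> _)"
  unfolding continuous_on_iff
proof (intro ballI allI impI)
  fix v :: "'a \<Rightarrow>\<^sub>C real" and e :: real
  assume "0 < e"
  then have "0 < e / 2" by simp
  from superposition_uniformly_continuous[OF f this, of "norm v + 1", where 'a = 'a]
  obtain d where d: "0 < d" "\<And>w v' :: 'a \<Rightarrow>\<^sub>C real. norm w \<le> norm v + 1 \<Longrightarrow> norm v' \<le> norm v + 1 \<Longrightarrow>
      norm (w - v') < d \<Longrightarrow> norm (superposition f w - superposition f v') \<le> e / 2"
    by blast
  have "dist (superposition f w) (superposition f v) < e" if "dist w v < min d 1" for w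
  proof -
    have "norm w \<le> norm v + 1"
      using that norm_triangle_ineq2[of w v] by (simp add: dist_norm)
    then have "norm (superposition f w - superposition f v) \<le> e / 2"
      using that by (intro d(2)) (auto simp: dist_norm)
    then show ?thesis using \<open>0 < e\<close> by (simp add: dist_norm)
  qed
  then show "\<exists>d>0. \<forall>w\<in>UNIV. dist w v < d \<longrightarrow> dist (superposition f w) (superposition f v) < e"
    using d(1) by (intro exI[of _ "min d 1"]) auto
qed

lemma LINT_primitive:
  assumes "continuous_on UNIV (f :: real \<Rightarrow> real)"
  shows "(LINT s:{a..b}|lborel. f s) = integral {a..b} f"
  using assms by (intro set_borel_integral_eq_integral borel_integrable_atLeastAtMost')
    (auto intro: continuous_on_subset)

definition primitive_integral :: "'a::euclidean_space set \<Rightarrow> (real \<Rightarrow> real) \<Rightarrow> ('a \<Rightarrow>\<^sub>C real) \<Rightarrow> real" where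
  "primitive_integral \<Omega> f v = (LINT x:\<Omega>|lborel. LINT s:{0..v x}|lborel. f s)"

lemma set_integrable_primitive:
  fixes v :: "'a::euclidean_space \<Rightarrow>\<^sub>C real" and f :: "real \<Rightarrow> real"
  assumes \<Omega>: "open \<Omega>" "bounded \<Omega>" and f: "continuous_on UNIV f" and v: "\<And>x. 0 \<le> v x"
  shows "set_integrable lborel \<Omega> (\<lambda>x. LINT s:{0..v x}|lborel. f s)"
proof -
  let ?F = "\<lambda>p. integral {0..p} f"
  have F: "continuous_on {0..norm v} ?F"
    by (rule DERIV_continuous_on, rule integral_has_real_derivative)
      (auto intro: continuous_on_subset[OF f])
  have range: "v x \<in> {0..norm v}" for x
    using v norm_bounded[of v x] by (auto simp: abs_le_iff)
  have "bounded (?F ` {0..norm v})"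
    by (intro compact_imp_bounded compact_continuous_image F) auto
  then obtain B where "\<And>p. p \<in> {0..norm v} \<Longrightarrow> norm (?F p) \<le> B"
    unfolding bounded_iff by (metis imageI)
  moreover have "continuous_on \<Omega> (\<lambda>x. ?F (v x))"
    by (rule continuous_on_compose2[OF F]) (use range in auto)
  ultimately show ?thesis
    unfolding LINT_primitive[OF f] using range by (intro set_integrable_bounded[OF \<Omega>]) auto
qed

text \<open>The derivative is taken within the cone of nonnegative functions because \<open>{0..p}\<close>
  is empty for \<open>p < 0\<close>: the integral over it is a primitive of \<open>f\<close> only
  on \<open>[0,\<infinity>)\<close>.\<close>

lemma primitive_integral_has_derivative:
  fixes v :: "'a::euclidean_space \<Rightarrow>\<^sub>C real" and f :: "real \<Rightarrow> real"
  assumes \<Omega>: "open \<Omega>" "bounded \<Omega>" and f: "continuous_on UNIV f" and v: "\<And>x. 0 \<le> v x"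
  shows "(primitive_integral \<Omega> f has_derivative L2_ip \<Omega> (superposition f v))
    (at v within {w. \<forall>x. 0 \<le> apply_bcontfun w x})"
  unfolding has_derivative_within_alt
proof (intro conjI allI impI)
  interpret semi_inner_product "L2_ip \<Omega>" by (rule semi_inner_product_L2_ip[OF \<Omega>])
  show "bounded_linear (L2_ip \<Omega> (superposition f v))" by (rule bounded_linear_right)
  fix e :: real
  assume e: "0 < e"
  define \<eta> where "\<eta> = e / (measure lborel \<Omega> + 1)"
  have \<eta>: "0 < \<eta>" "\<eta> * measure lborel \<Omega> \<le> e"
    using e measure_nonneg[of lborel \<Omega>] by (auto simp: \<eta>_def field_simps add_pos_nonneg)
  obtain d where d: "0 < d"
    "\<And>p q. \<bar>p\<bar> \<le> norm v + 1 \<Longrightarrow> \<bar>q\<bar> \<le> norm v + 1 \<Longrightarrow> \<bar>p - q\<bar> < d \<Longrightarrow> \<bar>f p - f q\<bar> \<le> \<eta>"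
    using uniform_continuity_modulus[OF f \<eta>(1), of "norm v + 1"] by blast
  let ?F = "\<lambda>p. integral {0..p} f"
  have F': "(?F has_real_derivative f p) (at p within {0..R})" if "p \<in> {0..R}" for p R
    by (rule integral_has_real_derivative[OF _ that]) (rule continuous_on_subset[OF f], simp)
  have est: "\<bar>?F q - ?F p - f p * (q - p)\<bar> \<le> \<eta> * \<bar>q - p\<bar>"
    if pq: "0 \<le> p" "p \<le> norm v + 1" "0 \<le> q" "q \<le> norm v + 1" "\<bar>q - p\<bar> < d" for p q
  proof -
    let ?S = "{min p q..max p q}"
    have "norm ((?F q - f p * q) - (?F p - f p * p)) \<le> \<eta> * norm (q - p)"
    proof (rule field_differentiable_bound[where S = ?S and f' = "\<lambda>s. f s - f p"])
      show "((\<lambda>s. ?F s - f p * s) has_field_derivative f s - f p) (at s within ?S)" if "s \<in> ?S" for s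
      proof -
        have "(?F has_real_derivative f s) (at s within ?S)"
          by (rule DERIV_subset[OF F'[of s "max p q"]]) (use that pq in auto)
        then show ?thesis by (auto intro!: derivative_eq_intros)
      qed
      show "norm (f s - f p) \<le> \<eta>" if "s \<in> ?S" for s
        unfolding real_norm_def by (rule d(2)) (use that pq in \<open>auto simp: min_def max_def split: if_splits\<close>)
    qed auto
    then show ?thesis by (simp add: algebra_simps)
  qed
  have "norm (primitive_integral \<Omega> f w - primitive_integral \<Omega> f v - L2_ip \<Omega> (superposition f v) (w - v))
      \<le> e * norm (w - v)" if w: "\<forall>x. 0 \<le> apply_bcontfun w x" "norm (w - v) < min d 1" for w
  proof -
    have Fw: "set_integrable lborel \<Omega> (\<lambda>x. ?F (w x))" and Fv: "set_integrable lborel \<Omega> (\<lambda>x. ?F (v x))"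
      using set_integrable_primitive[OF \<Omega> f] w(1) v unfolding LINT_primitive[OF f] by blast+
    note ip = set_integrable_product_bcontfun[OF \<Omega>, of "superposition f v" "w - v"]
    have "primitive_integral \<Omega> f w - primitive_integral \<Omega> f v - L2_ip \<Omega> (superposition f v) (w - v) =
      (LINT x:\<Omega>|lborel. ?F (w x) - ?F (v x) - superposition f v x * (w - v) x)"
      unfolding primitive_integral_def LINT_primitive[OF f] L2_ip_def
      by (simp only: set_integral_diff[OF set_integral_diff(1)[OF Fw Fv] ip] set_integral_diff[OF Fw Fv])
    also have "\<bar>\<dots>\<bar> \<le> (\<eta> * norm (w - v)) * measure lborel \<Omega>"
    proof (rule set_integral_abs_le[OF \<Omega>])
      show "set_integrable lborel \<Omega> (\<lambda>x. ?F (w x) - ?F (v x) - superposition f v x * (w - v) x)"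
        by (intro set_integral_diff(1) Fw Fv ip)
      fix x
      have wv: "\<bar>w x - v x\<bar> \<le> norm (w - v)" using norm_bounded[of "w - v" x] by simp
      have "\<bar>?F (w x) - ?F (v x) - f (v x) * (w x - v x)\<bar> \<le> \<eta> * \<bar>w x - v x\<bar>"
        using est[of "v x" "w x"] wv w v norm_bounded[of v x] by fastforce
      also have "\<dots> \<le> \<eta> * norm (w - v)" using wv \<eta> by simp
      finally show "\<bar>?F (w x) - ?F (v x) - superposition f v x * (w - v) x\<bar> \<le> \<eta> * norm (w - v)"
        by (simp add: superposition_apply[OF f])
    qed
    also have "\<dots> = (\<eta> * measure lborel \<Omega>) * norm (w - v)" by simp
    also have "\<dots> \<le> e * norm (w - v)" using \<eta>(2) by (intro mult_right_mono) auto
    finally show ?thesis by simp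
  qed
  then show "\<exists>d>0. \<forall>w\<in>{w. \<forall>x. 0 \<le> apply_bcontfun w x}. norm (w - v) < d \<longrightarrow>
      norm (primitive_integral \<Omega> f w - primitive_integral \<Omega> f v - L2_ip \<Omega> (superposition f v) (w - v))
        \<le> e * norm (w - v)"
    using d(1) by (intro exI[of _ "min d 1"]) auto
qed

section \<open>Global solutions\<close>

lemma nonneg_at_0_if_nonneg_after:
  fixes \<phi> :: "real \<Rightarrow> real"
  assumes "continuous_on {0..} \<phi>" "\<And>t. 0 < t \<Longrightarrow> 0 \<le> \<phi> t" "0 \<le> t"
  shows "0 \<le> \<phi> t"
  using continuous_ge_on_closure[of "{0<..}" \<phi> t 0] assms by (simp add: closure_greaterThan)

text \<open>In this locale \<open>v\<close> is the solution as a curve of bounded continuous functions,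
  \<open>g\<close> the reaction term along it, and \<open>W h\<close> the integral of
  \<open>v\<close> over a moving window of length \<open>h\<close>. By the equation \<open>Y
  h\<close> equals \<open>- \<Delta>(W h)\<close> on \<open>\<Omega>\<close> (lemma
  \<open>laplacian_W\<close>); unlike the Laplacian, it is defined and continuous down to time
  \<open>0\<close>.\<close>

locale global_solution =
  fixes \<Omega> :: "'a::euclidean_space set" and f :: "real \<Rightarrow> real"
    and u\<^sub>0 :: "'a \<Rightarrow> real" and u :: "'a \<Rightarrow> real \<Rightarrow> real" and lam :: real
  assumes \<Omega>: "open \<Omega>" "bounded \<Omega>"
    and lam: "first_dirichlet_eigenvalue \<Omega> lam" "0 < lam"
    and f: "continuous_on UNIV f"
    and u0: "Ck_on 1 u\<^sub>0 \<Omega>" "set_integrable lborel \<Omega> (\<lambda>x. (norm (gradient u\<^sub>0 x))\<^sup>2)"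
    and u: "nonneg_classical_solution \<Omega> \<infinity> f u\<^sub>0 u"
begin

sublocale semi_inner_product "L2_ip \<Omega>"
  by (rule semi_inner_product_L2_ip[OF \<Omega>])

abbreviation ip where "ip \<equiv> L2_ip \<Omega>"

definition v :: "real \<Rightarrow> 'a \<Rightarrow>\<^sub>C real" where "v t = zero_ext \<Omega> (\<lambda>x. u x t)"
definition g :: "real \<Rightarrow> 'a \<Rightarrow>\<^sub>C real" where "g t = superposition f (v t)"
definition W :: "real \<Rightarrow> real \<Rightarrow> 'a \<Rightarrow>\<^sub>C real" where "W h t = integral {t..t + h} v"
definition Y :: "real \<Rightarrow> real \<Rightarrow> 'a \<Rightarrow>\<^sub>C real" where
  "Y h t = integral {t..t + h} g - (v (t + h) - v t)"
definition E :: real where "E = (LINT x:\<Omega>|lborel. (norm (gradient u\<^sub>0 x))\<^sup>2)"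

lemma u_continuous: "continuous_on (closure \<Omega> \<times> {0..}) (\<lambda>(x, t). u x t)"
proof -
  have "{t. 0 \<le> t \<and> ereal t < \<infinity>} = {0..}" by auto
  then show ?thesis using u by (simp add: nonneg_classical_solution_def)
qed

lemma u_nonneg: "x \<in> closure \<Omega> \<Longrightarrow> 0 \<le> t \<Longrightarrow> 0 \<le> u x t"
  and u_frontier: "x \<in> frontier \<Omega> \<Longrightarrow> 0 \<le> t \<Longrightarrow> u x t = 0"
  and u_initial: "x \<in> closure \<Omega> \<Longrightarrow> u x 0 = u\<^sub>0 x"
  using u by (auto simp: nonneg_classical_solution_def)

lemma v_apply: "0 \<le> t \<Longrightarrow> v t x = (if x \<in> \<Omega> then u x t else 0)"
  and v_continuous: "continuous_on {0..} v"
  using zero_ext_continuous[OF \<Omega> u_continuous] u_frontier by (auto simp: v_def)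

lemma g_continuous: "continuous_on {0..} g"
  unfolding g_def by (rule continuous_on_compose2[OF superposition_continuous[OF f] v_continuous]) auto

lemma g_apply: "g t x = f (v t x)"
  by (simp add: g_def superposition_apply[OF f])

lemma v_nonneg: "0 \<le> t \<Longrightarrow> 0 \<le> v t x"
  using u_nonneg closure_subset[of \<Omega>] by (auto simp: v_apply)

lemma W_continuous: "0 \<le> h \<Longrightarrow> continuous_on {0..} (W h)"
  unfolding W_def by (rule integral_shift_continuous[OF v_continuous])

lemma Y_continuous: "0 \<le> h \<Longrightarrow> continuous_on {0..} (Y h)"
  unfolding Y_def
  by (intro continuous_intros integral_shift_continuous[OF g_continuous] v_continuous
      continuous_on_compose2[OF v_continuous, where f = "\<lambda>t. t + h"]) auto

lemma W_apply:
  assumes "0 \<le> t"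
  shows "W h t x = (if x \<in> \<Omega> then integral {t..t + h} (u x) else 0)"
proof -
  have "W h t x = integral {t..t + h} (\<lambda>s. v s x)"
    unfolding W_def using assms
    by (intro integral_apply_bcontfun continuous_on_subset[OF v_continuous]) auto
  also have "\<dots> = integral {t..t + h} (\<lambda>s. if x \<in> \<Omega> then u x s else 0)"
    using assms by (intro integral_cong) (auto simp: v_apply)
  finally show ?thesis by simp
qed

lemma W_nonneg: "0 \<le> t \<Longrightarrow> 0 \<le> W h t x"
  using u_nonneg closure_subset[of \<Omega>] not_integrable_integral[of "u x" "{t..t + h}"]
  by (cases "u x integrable_on {t..t + h}")
    (auto simp: W_apply intro!: Henstock_Kurzweil_Integration.integral_nonneg)

lemma nonneg_zero_trace_W:
  assumes "0 \<le> t"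
  shows "nonneg_zero_trace \<Omega> (W h t)"
proof -
  have "W h t x = 0" if "x \<in> frontier \<Omega>" for x
    using that assms \<Omega> by (simp add: W_apply frontier_def interior_open)
  then show ?thesis
    using W_nonneg[OF assms] by (simp add: nonneg_zero_trace_def)
qed

lemma Ck_on_2_W:
  assumes "0 < t"
  shows "Ck_on 2 (W h t) \<Omega>"
proof -
  have "Ck_on 2 (\<lambda>x. integral {t..t + h} (u x)) \<Omega>"
    using u assms by (intro time_integral_C2 \<Omega>) (auto simp: nonneg_classical_solution_def)
  then show ?thesis
    using Ck_on_2_cong_open[OF \<Omega>(1), of "W h t" "\<lambda>x. integral {t..t + h} (u x)"] assms
    by (simp add: W_apply)
qed

lemma laplacian_W:
  assumes "0 < t" "0 \<le> h" "x \<in> \<Omega>"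
  shows "laplacian (W h t) x = - Y h t x"
proof -
  have "laplacian (W h t) x = laplacian (\<lambda>x. integral {t..t + h} (u x)) x"
    using assms by (intro laplacian_cong_open[OF \<Omega>(1)]) (auto simp: W_apply)
  also have "\<dots> = u x (t + h) - u x t - integral {t..t + h} (\<lambda>s. f (u x s))"
    using assms by (intro time_integral_laplacian[OF \<Omega>(1) u f]) auto
  also have "integral {t..t + h} (\<lambda>s. f (u x s)) = integral {t..t + h} (\<lambda>s. g s x)"
    using assms by (intro integral_cong) (auto simp: g_apply v_apply)
  also have "\<dots> = (integral {t..t + h} g) x"
    using assms by (intro integral_apply_bcontfun[symmetric] continuous_on_subset[OF g_continuous]) auto
  finally show ?thesis using assms by (simp add: Y_def v_apply)
qed

lemma laplacian_W_bound:
  "0 < t \<Longrightarrow> 0 \<le> h \<Longrightarrow> x \<in> \<Omega> \<Longrightarrow> \<bar>laplacian (W h t) x\<bar> \<le> norm (Y h t)"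
  using norm_bounded[of "Y h t" x] by (simp add: laplacian_W)

lemma integral_laplacian_W:
  assumes "0 < t" "0 \<le> h"
  shows "- (LINT x:\<Omega>|lborel. apply_bcontfun w x * laplacian (W h t) x) = ip (Y h t) w"
proof -
  have "(LINT x:\<Omega>|lborel. w x * laplacian (W h t) x) = (LINT x:\<Omega>|lborel. - (Y h t x * w x))"
    using assms \<Omega> by (intro set_lebesgue_integral_cong) (auto simp: laplacian_W)
  then show ?thesis by (simp add: L2_ip_def set_lebesgue_integral_def)
qed

lemma convexity_pos:
  fixes w :: "'a \<Rightarrow>\<^sub>C real"
  assumes "0 < t" "0 \<le> h" "nonneg_zero_trace \<Omega> w" "Ck_on 1 w \<Omega>"
    "set_integrable lborel \<Omega> (\<lambda>x. (norm (gradient w x))\<^sup>2)"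
  shows "ip (Y h t) w \<le> ((LINT x:\<Omega>|lborel. (norm (gradient w x))\<^sup>2) + ip (Y h t) (W h t)) / 2"
proof -
  have t: "0 \<le> t" using assms by simp
  show ?thesis
    using dirichlet_convexity[OF \<Omega> nonneg_zero_trace_W[OF t] Ck_on_2_W[OF assms(1)]
        laplacian_W_bound[OF assms(1,2)] assms(3-5)]
      integral_laplacian_W[OF assms(1,2), of w] integral_laplacian_W[OF assms(1,2), of "W h t"]
    by simp
qed

text \<open>The spatial regularity needed for Green's identity is available at positive times only. The
  inequality extends to time \<open>0\<close> because every term is continuous there, first in
  \<open>t\<close> and then in \<open>s\<close>.\<close>

lemma convexity_averages:
  assumes h: "0 \<le> h" and "0 \<le> s" "0 \<le> t"
  shows "ip (Y h t) (W h s) \<le> (ip (Y h s) (W h s) + ip (Y h t) (W h t)) / 2"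
proof -
  have pos: "0 \<le> (ip (Y h s) (W h s) + ip (Y h t) (W h t)) / 2 - ip (Y h t) (W h s)"
    if st: "0 < s" "0 < t" for s t
  proof -
    have trace: "nonneg_zero_trace \<Omega> (W h s)" using st by (simp add: nonneg_zero_trace_W)
    note e = dirichlet_energy[OF \<Omega> trace Ck_on_2_W[OF st(1)] laplacian_W_bound[OF st(1) h]]
    show ?thesis
      using convexity_pos[OF st(2) h trace Ck_on_2_imp_1[OF Ck_on_2_W[OF st(1)]] e(1)] e(2)
        integral_laplacian_W[OF st(1) h, of "W h s"]
      by simp
  qed
  note cont = continuous_on[OF Y_continuous[OF h] W_continuous[OF h]]
  have "0 \<le> (ip (Y h s) (W h s) + ip (Y h t) (W h t)) / 2 - ip (Y h t) (W h s)"
    if st: "0 < s" "0 \<le> t" for s t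
    by (rule nonneg_at_0_if_nonneg_after[where \<phi> =
        "\<lambda>t. (ip (Y h s) (W h s) + ip (Y h t) (W h t)) / 2 - ip (Y h t) (W h s)"])
      (use st pos in \<open>auto intro!: continuous_intros cont continuous_on[OF Y_continuous[OF h]]\<close>)
  then have "0 \<le> (ip (Y h s) (W h s) + ip (Y h t) (W h t)) / 2 - ip (Y h t) (W h s)"
    by (intro nonneg_at_0_if_nonneg_after[where t = s and \<phi> =
        "\<lambda>s. (ip (Y h s) (W h s) + ip (Y h t) (W h t)) / 2 - ip (Y h t) (W h s)"])
      (use assms in \<open>auto intro!: continuous_intros cont continuous_on[OF _ W_continuous[OF h]]\<close>)
  then show ?thesis by simp
qed

text \<open>The gradient of the initial datum enters only through its energy. It is compared with the
  averages through convexity, so no continuity of the gradient of \<open>u\<close> at time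
  \<open>0\<close> is needed.\<close>

lemma convexity_initial:
  assumes h: "0 < h"
  shows "ip (Y h 0) (h *\<^sub>R v 0) \<le> (E * h\<^sup>2 + ip (Y h 0) (W h 0)) / 2"
proof -
  let ?w = "h *\<^sub>R v 0"
  have w: "?w x = h * u\<^sub>0 x" if "x \<in> \<Omega>" for x
    using that u_initial closure_subset[of \<Omega>] by (auto simp: v_apply)
  have grad: "gradient ?w x = h *\<^sub>R gradient u\<^sub>0 x" if "x \<in> \<Omega>" for x
    using gradient_cong_open[OF \<Omega>(1) that, of ?w "\<lambda>x. h * u\<^sub>0 x"] w gradient_scale[of u\<^sub>0 x h] u0(1) that
    by (simp add: Ck_on_1_iff)
  have sq: "(norm (gradient ?w x))\<^sup>2 = h\<^sup>2 * (norm (gradient u\<^sub>0 x))\<^sup>2" if "x \<in> \<Omega>" for x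
    unfolding grad[OF that] by (simp add: power_mult_distrib)
  have trace: "nonneg_zero_trace \<Omega> ?w"
    unfolding nonneg_zero_trace_def
  proof (intro conjI ballI)
    show "?w x = 0" if "x \<in> frontier \<Omega>" for x
      using that \<Omega> by (simp add: v_apply frontier_def interior_open)
    show "0 \<le> ?w x" if "x \<in> \<Omega>" for x
      using h v_nonneg[of 0 x] by simp
  qed (rule continuous_on_apply_bcontfun)
  have C1: "Ck_on 1 ?w \<Omega>"
    using Ck_on_1_cong_open[OF \<Omega>(1), of ?w "\<lambda>x. h * u\<^sub>0 x"] w Ck_on_1_scale[OF u0(1)] by blast
  have "set_integrable lborel \<Omega> (\<lambda>x. (norm (gradient ?w x))\<^sup>2) \<longleftrightarrow>
      set_integrable lborel \<Omega> (\<lambda>x. h\<^sup>2 * (norm (gradient u\<^sub>0 x))\<^sup>2)"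
    by (intro set_integrable_cong refl sq)
  then have int: "set_integrable lborel \<Omega> (\<lambda>x. (norm (gradient ?w x))\<^sup>2)"
    using u0(2) by simp
  have "(LINT x:\<Omega>|lborel. (norm (gradient ?w x))\<^sup>2) = (LINT x:\<Omega>|lborel. h\<^sup>2 * (norm (gradient u\<^sub>0 x))\<^sup>2)"
    using \<Omega> by (intro set_lebesgue_integral_cong allI impI sq) auto
  then have energy: "(LINT x:\<Omega>|lborel. (norm (gradient ?w x))\<^sup>2) = E * h\<^sup>2"
    by (simp add: E_def)
  have "0 \<le> (E * h\<^sup>2 + ip (Y h t) (W h t)) / 2 - ip (Y h t) ?w" if "0 < t" for t
    using convexity_pos[OF that _ trace C1 int, of h] energy h by simp
  then have "0 \<le> (E * h\<^sup>2 + ip (Y h 0) (W h 0)) / 2 - ip (Y h 0) ?w"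
    by (intro nonneg_at_0_if_nonneg_after[where t = 0 and \<phi> =
        "\<lambda>t. (E * h\<^sup>2 + ip (Y h t) (W h t)) / 2 - ip (Y h t) ?w"])
      (use h in \<open>auto intro!: continuous_intros continuous_on W_continuous Y_continuous\<close>)
  then show ?thesis by simp
qed

lemma poincare_averages:
  assumes h: "0 \<le> h" and t: "0 \<le> t"
  shows "lam * ip (W h t) (W h t) \<le> ip (Y h t) (W h t)"
proof -
  have "0 \<le> ip (Y h t) (W h t) - lam * ip (W h t) (W h t)" if "0 < t" for t
    using poincare_inequality[OF \<Omega> lam nonneg_zero_trace_W[OF less_imp_le[OF that]]
        Ck_on_2_W[OF that] laplacian_W_bound[OF that h]] integral_laplacian_W[OF that h, of "W h t"]
    by (simp add: L2_ip_def power2_eq_square)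
  then have "0 \<le> ip (Y h t) (W h t) - lam * ip (W h t) (W h t)"
    by (intro nonneg_at_0_if_nonneg_after[where t = t and \<phi> =
        "\<lambda>t. ip (Y h t) (W h t) - lam * ip (W h t) (W h t)"])
      (use h t in \<open>auto intro!: continuous_intros continuous_on W_continuous Y_continuous\<close>)
  then show ?thesis by simp
qed

end

context global_solution
begin

text \<open>The parameters are chosen in the order \<open>\<kappa>, \<delta>, M, S\<close>, then the
  tolerances \<open>\<eta>\<close> and \<open>\<rho>\<close>, and last the window length
  \<open>h\<close>. In particular the length \<open>S\<close> of the time interval depends on
  bounds for the square norm of the initial average that hold for all small \<open>h\<close>.\<close>

lemma initial_energy_not_positive:
  assumes const: "0 < \<beta>" "0 < \<gamma>" "\<beta> \<le> (\<alpha> - 2) * lam / 2"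
    and condition: "\<And>p. 0 < p \<Longrightarrow> \<alpha> * (LINT s:{0..p}|lborel. f s) \<le> p * f p + \<beta> * p\<^sup>2 + \<gamma>"
  shows "primitive_integral \<Omega> f (v 0) - \<gamma> * measure lborel \<Omega> \<le> E / 2"
proof (rule ccontr)
  let ?N = "primitive_integral \<Omega> f"
  define \<Gamma> where "\<Gamma> = \<gamma> * measure lborel \<Omega>"
  define j where "j = (?N (v 0) - \<Gamma> - E / 2) / 4"
  assume "\<not> ?thesis"
  then have j: "0 < j" by (simp add: j_def \<Gamma>_def)
  have \<Gamma>: "0 \<le> \<Gamma>" using const by (simp add: \<Gamma>_def)
  have E: "0 \<le> E"
    unfolding E_def set_lebesgue_integral_def by (auto intro!: Bochner_Integration.integral_nonneg)
  have \<alpha>: "2 < \<alpha>"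
  proof -
    have "0 < (\<alpha> - 2) * lam" using const by simp
    then show ?thesis using lam(2) by (simp add: zero_less_mult_iff)
  qed
  define A where "A = ip (v 0) (v 0)"
  have A: "0 < A"
  proof (rule ccontr)
    assume "\<not> 0 < A"
    then have "A = 0" using nonneg[of "v 0"] unfolding A_def by linarith
    then have "(LINT x|lborel. indicat_real \<Omega> x *\<^sub>R (v 0 x * v 0 x)) = 0"
      by (simp add: A_def L2_ip_def set_lebesgue_integral_def)
    then have "AE x in lborel. indicat_real \<Omega> x *\<^sub>R (v 0 x * v 0 x) = 0"
      using set_integrable_product_bcontfun[OF \<Omega>, of "v 0" "v 0"]
      by (subst (asm) integral_nonneg_eq_0_iff_AE) (auto simp: set_integrable_def)
    then have "AE x in lborel. indicat_real \<Omega> x *\<^sub>R (LINT s:{0..v 0 x}|lborel. f s) = 0"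
      by eventually_elim (auto simp: LINT_primitive[OF f])
    then have "?N (v 0) = 0"
      unfolding primitive_integral_def set_lebesgue_integral_def[of _ \<Omega>]
      by (rule integral_eq_zero_AE)
    then show False using j \<Gamma> E by (simp add: j_def)
  qed
  define \<mu> where "\<mu> = (\<alpha> - 2) / 4"
  \<comment> \<open>then \<open>\<alpha> \<kappa>\<close> is the mean of \<open>2\<close> and \<open>\<alpha>\<close>\<close>
  define \<kappa> where "\<kappa> = (\<alpha> + 2) / (2 * \<alpha>)"
  define \<delta> where "\<delta> = min 1 (\<mu> / 3)"
  define M where "M = (1 + \<delta>) * (1 + 1 / \<delta>) * (2 * A)\<^sup>2 / (2 * \<alpha> * j)"
  \<comment> \<open>\<open>M\<close> and \<open>S\<close> use that the initial average has square norm between \<open>A / 2\<close> and \<open>2 A\<close>\<close>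
  define S where "S = M / (\<delta> * (A / 2))"
  have \<mu>: "0 < \<mu>" using \<alpha> by (simp add: \<mu>_def)
  have \<delta>: "0 < \<delta>" "\<delta> \<le> 1" "3 * \<delta> \<le> \<mu>" using \<mu> by (auto simp: \<delta>_def)
  have \<kappa>: "\<kappa> < 1" using \<alpha> by (simp add: \<kappa>_def field_simps)
  have exponent: "2 * (1 + \<delta>)\<^sup>2 \<le> \<alpha> * \<kappa>"
  proof -
    have "\<delta> * \<delta> \<le> \<delta>" using \<delta> by (simp add: mult_left_le)
    then have "(1 + \<delta>)\<^sup>2 \<le> 1 + 3 * \<delta>" by (simp add: power2_eq_square algebra_simps)
    moreover have "\<alpha> * \<kappa> = 2 * (1 + \<mu>)" using \<alpha> by (simp add: \<kappa>_def \<mu>_def field_simps)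
    ultimately show ?thesis using \<delta> by simp
  qed
  have M: "0 < M" "2 * \<alpha> * j * M = (1 + \<delta>) * (1 + 1 / \<delta>) * (2 * A)\<^sup>2"
    using \<delta> A \<alpha> j by (auto simp: M_def add_pos_pos)
  have S: "0 < S" using M A \<delta> by (simp add: S_def)

  obtain K where K: "0 < K" "\<And>x y. norm (ip x y) \<le> norm x * norm y * K"
    using pos_bounded by blast
  have "bounded (v ` {0..S})"
    by (intro compact_imp_bounded compact_continuous_image continuous_on_subset[OF v_continuous]) auto
  then obtain R where R: "0 < R" "\<And>t. t \<in> {0..S} \<Longrightarrow> norm (v t) \<le> R"
    unfolding bounded_pos by (metis imageI)
  define \<eta> where "\<eta> = min 1 (min (\<alpha> * j / (K * (R + 1))) (4 * (1 - \<kappa>) * j / (K * S)))"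
  have \<eta>: "0 < \<eta>" "\<eta> \<le> 1" "(R + 1) * \<eta> * K \<le> \<alpha> * j" "\<eta> * K * S \<le> 4 * (1 - \<kappa>) * j"
  proof -
    show "0 < \<eta>" using \<alpha> j K R S \<kappa> by (simp add: \<eta>_def)
    show "\<eta> \<le> 1" by (simp add: \<eta>_def)
    have "\<eta> \<le> \<alpha> * j / (K * (R + 1))" "\<eta> \<le> 4 * (1 - \<kappa>) * j / (K * S)"
      by (simp_all add: \<eta>_def)
    then have "\<eta> * (K * (R + 1)) \<le> \<alpha> * j" "\<eta> * (K * S) \<le> 4 * (1 - \<kappa>) * j"
      using K R S by (simp_all add: pos_le_divide_eq)
    then show "(R + 1) * \<eta> * K \<le> \<alpha> * j" "\<eta> * K * S \<le> 4 * (1 - \<kappa>) * j"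
      by (simp_all add: mult_ac)
  qed
  have "0 < \<eta> / 2" using \<eta> by simp
  from superposition_uniformly_continuous[OF f this, of "R + 1", where 'a = 'a]
  obtain d\<^sub>1 where d1: "0 < d\<^sub>1" "\<And>w w' :: 'a \<Rightarrow>\<^sub>C real. norm w \<le> R + 1 \<Longrightarrow> norm w' \<le> R + 1 \<Longrightarrow>
      norm (w - w') < d\<^sub>1 \<Longrightarrow> norm (superposition f w - superposition f w') \<le> \<eta> / 2"
    by blast
  let ?cone = "{w :: 'a \<Rightarrow>\<^sub>C real. \<forall>x. 0 \<le> apply_bcontfun w x}"
  obtain d\<^sub>2 where d2: "0 < d\<^sub>2" "\<And>w. w \<in> ?cone \<Longrightarrow> norm (w - v 0) < d\<^sub>2 \<Longrightarrow> \<bar>?N w - ?N (v 0)\<bar> < j / 2"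
  proof -
    have "continuous (at (v 0) within ?cone) ?N"
      using primitive_integral_has_derivative[OF \<Omega> f, of "v 0"] v_nonneg[of 0]
      by (auto intro: has_derivative_continuous)
    then show ?thesis
      using that j unfolding continuous_within_eps_delta dist_norm real_norm_def
      by (metis half_gt_zero)
  qed
  obtain d\<^sub>3 where d3: "0 < d\<^sub>3" "\<And>w. norm (w - v 0) < d\<^sub>3 \<Longrightarrow> \<bar>ip w w - A\<bar> < A / 2"
  proof -
    have "continuous (at (v 0)) (\<lambda>w. ip w w)" by (intro continuous continuous_ident)
    then show ?thesis
      using that A unfolding continuous_at_eps_delta dist_norm real_norm_def A_def
      by (metis half_gt_zero)
  qed
  define \<rho> where "\<rho> = min 1 (min (d\<^sub>1 / 2) (min (d\<^sub>2 / 2) (d\<^sub>3 / 2)))"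
  have \<rho>: "0 < \<rho>" "\<rho> \<le> 1" "\<rho> < d\<^sub>1" "\<rho> < d\<^sub>2" "\<rho> < d\<^sub>3"
    using d1(1) d2(1) d3(1) by (auto simp: \<rho>_def min_def)
  obtain h\<^sub>1 where h1: "0 < h\<^sub>1" "\<And>h t. 0 < h \<Longrightarrow> h < h\<^sub>1 \<Longrightarrow> t \<in> {0..S} \<Longrightarrow>
      norm ((1 / h) *\<^sub>R integral {t..t + h} v - v t) \<le> \<rho>"
    using average_close[OF v_continuous \<rho>(1), of S] by blast
  obtain h\<^sub>2 where h2: "0 < h\<^sub>2" "\<And>h t. 0 < h \<Longrightarrow> h < h\<^sub>2 \<Longrightarrow> t \<in> {0..S} \<Longrightarrow>
      norm ((1 / h) *\<^sub>R integral {t..t + h} g - g t) \<le> \<eta> / 2"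
    using average_close[OF g_continuous \<open>0 < \<eta> / 2\<close>, of S] by blast
  have "\<exists>h>0. h < min h\<^sub>1 h\<^sub>2 \<and>
      ip (integral {0..h} g - (v h - v 0)) (integral {0..h} v) \<le> (E + j) * h\<^sup>2"
  proof (rule initial_energy_of_averages[OF v_continuous g_continuous _ j])
    show "ip (integral {0..h} g - (v h - v 0)) (h *\<^sub>R v 0) \<le>
        (E * h\<^sup>2 + ip (integral {0..h} g - (v h - v 0)) (integral {0..h} v)) / 2" if "0 < h" for h
      using convexity_initial[OF that] by (simp add: Y_def W_def)
  qed (use h1 h2 in simp)
  then obtain h where h: "0 < h" "h < h\<^sub>1" "h < h\<^sub>2" and h_energy: "ip (Y h 0) (W h 0) \<le> (E + j) * h\<^sup>2"
    by (auto simp: Y_def W_def)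

  define U where "U t = (1 / h) *\<^sub>R W h t" for t
  define D where "D t = (1 / h) *\<^sub>R (v (t + h) - v t)" for t
  define G where "G t = (1 / h) *\<^sub>R integral {t..t + h} g" for t
  define q where "q t = superposition f (U t)" for t
  have GD: "G t - D t = (1 / h) *\<^sub>R Y h t" for t
    by (simp add: G_def D_def Y_def scaleR_diff_right)
  have ip_scale: "ip ((1 / h) *\<^sub>R x) ((1 / h) *\<^sub>R y) = ip x y / h\<^sup>2" for x y
    by (simp add: scaleR_left scaleR_right power2_eq_square)
  have U_cone: "U t \<in> ?cone" if "t \<in> {0..S}" for t
    using W_nonneg[of t h] that h by (auto simp: U_def)
  have U_near: "norm (U t - v t) \<le> \<rho>" if "t \<in> {0..S}" for t
    using h1(2)[OF h(1,2) that] by (simp add: U_def W_def)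
  have U_bound: "norm (U t) \<le> R + 1" if "t \<in> {0..S}" for t
    using U_near[OF that] R(2)[OF that] \<rho>(2) norm_triangle_ineq2[of "U t" "v t"] by linarith
  have qG: "norm (q t - G t) \<le> \<eta>" if t: "t \<in> {0..S}" for t
  proof -
    have "norm (q t - g t) \<le> \<eta> / 2"
      unfolding q_def g_def using U_bound[OF t] R(2)[OF t] U_near[OF t] \<rho>(3) by (intro d1(2)) auto
    moreover have "norm (G t - g t) \<le> \<eta> / 2"
      using h2(2)[OF h(1,3) t] by (simp add: G_def)
    ultimately show ?thesis
      using norm_triangle_ineq4[of "q t - g t" "G t - g t"] by simp
  qed
  have U0: "\<bar>?N (U 0) - ?N (v 0)\<bar> < j / 2" "\<bar>ip (U 0) (U 0) - A\<bar> < A / 2"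
    using d2(2)[OF U_cone] d3(2) U_near[of 0] \<rho> S by auto
  have U0': "A / 2 \<le> ip (U 0) (U 0)" "ip (U 0) (U 0) \<le> 2 * A"
    using U0(2) A unfolding abs_less_iff by linarith+
  have U': "(U has_vector_derivative D t) (at t within {0..S})" if "t \<in> {0..S}" for t
  proof -
    have "(W h has_vector_derivative v (t + h) - v t) (at t within {0..S})"
      unfolding W_def
      by (rule has_vector_derivative_within_subset[OF
            integral_shift_has_vector_derivative[OF v_continuous]]) (use that h in auto)
    then show ?thesis
      unfolding U_def D_def by (auto intro!: derivative_eq_intros)
  qed
  show False
  proof (rule smoothed_flow_contradiction[where U = U and D = D and G = G and q = q and
        N = "\<lambda>t. ?N (U t)" and \<alpha> = \<alpha> and \<beta> = \<beta> and \<Gamma> = \<Gamma> and lam = lam and j = j and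
        \<kappa> = \<kappa> and \<delta> = \<delta> and M = M and S = S])
    fix t assume t: "t \<in> {0..S}"
    then have t0: "0 \<le> t" by simp
    show "(U has_vector_derivative D t) (at t within {0..S})" by (rule U'[OF t])
    show "lam * ip (U t) (U t) \<le> ip (G t - D t) (U t)"
      unfolding GD U_def ip_scale
      using poincare_averages[OF less_imp_le[OF h(1)] t0] h by (simp add: divide_right_mono)
    show "((\<lambda>t. ?N (U t)) has_real_derivative ip (q t) (D t)) (at t within {0..S})"
    proof -
      have "(?N has_derivative ip (q t)) (at (U t) within U ` {0..S})"
        unfolding q_def
        by (rule has_derivative_subset[OF primitive_integral_has_derivative[OF \<Omega> f]])
          (use U_cone t in auto)
      with U'[OF t] have "((\<lambda>t. ?N (U t)) has_derivative (\<lambda>s. ip (q t) (s *\<^sub>R D t))) (at t within {0..S})"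
        unfolding has_vector_derivative_def by (rule has_derivative_in_compose)
      moreover have "(\<lambda>s. ip (q t) (s *\<^sub>R D t)) = (*) (ip (q t) (D t))"
        by (auto simp: scaleR_right)
      ultimately show ?thesis by (simp add: has_field_derivative_def)
    qed
    show "\<alpha> * ?N (U t) \<le> ip (q t) (U t) + \<beta> * ip (U t) (U t) + \<Gamma>"
    proof -
      note int = set_integrable_product_bcontfun[OF \<Omega>]
      have F: "set_integrable lborel \<Omega> (\<lambda>x. LINT s:{0..U t x}|lborel. f s)"
        using U_cone[OF t] by (intro set_integrable_primitive[OF \<Omega> f]) auto
      have c: "set_integrable lborel \<Omega> (\<lambda>_. \<gamma>)"
        by (rule set_integrable_bounded[OF \<Omega>]) auto
      have rhs: "set_integrable lborel \<Omega> (\<lambda>x. q t x * U t x + \<beta> * (U t x * U t x))"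
        by (intro set_integral_add(1) set_integrable_mult_right int)
      have "\<alpha> * ?N (U t) = (LINT x:\<Omega>|lborel. \<alpha> * (LINT s:{0..U t x}|lborel. f s))"
        by (simp add: primitive_integral_def)
      also have "\<dots> \<le> (LINT x:\<Omega>|lborel. (q t x * U t x + \<beta> * (U t x * U t x)) + \<gamma>)"
      proof (rule set_integral_mono)
        show "set_integrable lborel \<Omega> (\<lambda>x. \<alpha> * (LINT s:{0..U t x}|lborel. f s))"
          using F by (rule set_integrable_mult_right)
        show "set_integrable lborel \<Omega> (\<lambda>x. (q t x * U t x + \<beta> * (U t x * U t x)) + \<gamma>)"
          by (intro set_integral_add(1) rhs c)
        show "\<alpha> * (LINT s:{0..U t x}|lborel. f s) \<le> (q t x * U t x + \<beta> * (U t x * U t x)) + \<gamma>" for x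
        proof (cases "U t x = 0")
          case True
          have zero: "(LINT s:{0..U t x}|lborel. f s) = 0"
            unfolding LINT_primitive[OF f] True by simp
          show ?thesis unfolding zero using True const by simp
        next
          case False
          then have "0 < U t x" using U_cone[OF t] by (simp add: less_le)
          from condition[OF this] show ?thesis
            by (simp add: q_def superposition_apply[OF f] power2_eq_square mult.commute)
        qed
      qed
      also have "\<dots> = ip (q t) (U t) + \<beta> * ip (U t) (U t) + \<Gamma>"
        using \<Omega> emeasure_bounded_finite[of \<Omega>] set_integral_add(2)[OF rhs c]
          set_integral_add(2)[OF int[of "q t" "U t"] set_integrable_mult_right[OF int[of "U t" "U t"], of \<beta>]]
        by (simp add: L2_ip_def \<Gamma>_def set_integral_const)
      finally show ?thesis .
    qed
    show "ip (U t) (q t - G t) \<le> \<alpha> * j"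
    proof -
      have "norm (ip (U t) (q t - G t)) \<le> norm (U t) * norm (q t - G t) * K" by (rule K(2))
      also have "\<dots> \<le> (R + 1) * \<eta> * K"
        using U_bound[OF t] qG[OF t] K R by (intro mult_mono mult_right_mono) auto
      also have "\<dots> \<le> \<alpha> * j" by (rule \<eta>(3))
      finally show ?thesis by simp
    qed
    show "ip (q t - G t) (q t - G t) * S \<le> 4 * (1 - \<kappa>) * j"
    proof -
      have "norm (ip (q t - G t) (q t - G t)) \<le> norm (q t - G t) * norm (q t - G t) * K" by (rule K(2))
      also have "\<dots> \<le> 1 * \<eta> * K"
        using qG[OF t] \<eta> K by (intro mult_mono mult_right_mono) auto
      finally have "ip (q t - G t) (q t - G t) * S \<le> \<eta> * K * S"
        using S by (intro mult_right_mono) auto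
      then show ?thesis using \<eta>(4) by simp
    qed
  next
    show "continuous_on {0..S} D"
      unfolding D_def
      by (intro continuous_intros continuous_on_subset[OF v_continuous]
          continuous_on_compose2[OF v_continuous, where f = "\<lambda>t. t + h"]) (use h in auto)
    show "continuous_on {0..S} G"
      unfolding G_def
      by (intro continuous_intros continuous_on_subset[OF integral_shift_continuous[OF g_continuous]])
        (use h in auto)
    show "ip (G s - D s) (U r) \<le> (ip (G r - D r) (U r) + ip (G s - D s) (U s)) / 2"
      if "s \<in> {0..S}" "r \<in> {0..S}" for s r
    proof -
      have "ip (Y h s) (W h r) / h\<^sup>2 \<le> (ip (Y h r) (W h r) + ip (Y h s) (W h s)) / 2 / h\<^sup>2"
        using that h by (intro divide_right_mono convexity_averages) auto
      then show ?thesis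
        unfolding GD U_def ip_scale by (simp add: add_divide_distrib)
    qed
    have "ip (G 0 - D 0) (U 0) \<le> E + j"
      unfolding GD U_def ip_scale using h_energy h by (simp add: divide_le_eq)
    moreover have "?N (v 0) - \<Gamma> - E / 2 = 4 * j" by (simp add: j_def)
    ultimately show "3 * j \<le> ?N (U 0) - ip (G 0 - D 0) (U 0) / 2 - \<Gamma>"
      using U0(1) unfolding abs_less_iff by linarith
    show "0 < ip (U 0) (U 0)" using U0' A by simp
    have "(1 + \<delta>) * (1 + 1 / \<delta>) * (ip (U 0) (U 0))\<^sup>2 \<le> (1 + \<delta>) * (1 + 1 / \<delta>) * (2 * A)\<^sup>2"
      using U0' A \<delta> by (intro mult_left_mono power_mono) auto
    then show "(1 + \<delta>) * (1 + 1 / \<delta>) * (ip (U 0) (U 0))\<^sup>2 \<le> 2 * \<alpha> * j * M"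
      unfolding M(2) .
    show "M / (\<delta> * ip (U 0) (U 0)) \<le> S"
      unfolding S_def using U0' A M \<delta> by (intro divide_left_mono mult_left_mono mult_pos_pos) auto
  qed (use \<alpha> const \<Gamma> j \<kappa> \<delta> M exponent in auto)
qed

end

section \<open>Blow-up\<close>

lemma spacetime_sq_integral_mono:
  assumes \<Omega>: "open \<Omega>" "bounded \<Omega>"
    and u: "nonneg_classical_solution \<Omega> T f u\<^sub>0 u"
    and st: "0 \<le> s" "s \<le> t" "ereal t < T"
  shows "spacetime_sq_integral \<Omega> u s \<le> spacetime_sq_integral \<Omega> u t"
proof -
  interpret semi_inner_product "L2_ip \<Omega>" by (rule semi_inner_product_L2_ip[OF \<Omega>])
  define a where "a s = (LINT x:\<Omega>|lborel. (u x s)\<^sup>2)" for s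
  define v where "v s = zero_ext \<Omega> (\<lambda>x. u x s)" for s
  have sub: "{0..t} \<subseteq> {s. 0 \<le> s \<and> ereal s < T}"
    using st by (auto intro: le_less_trans[OF _ st(3)])
  then have cont: "continuous_on (closure \<Omega> \<times> {0..t}) (\<lambda>(x, t). u x t)"
    using u by (auto simp: nonneg_classical_solution_def intro: continuous_on_subset)
  have zero: "u x s = 0" if "x \<in> frontier \<Omega>" "s \<in> {0..t}" for x s
    using u that sub by (auto simp: nonneg_classical_solution_def)
  have val: "v s x = u x s" if "s \<in> {0..t}" "x \<in> \<Omega>" for s x
    unfolding v_def using zero_ext_continuous(1)[OF \<Omega> cont zero that(1)] that(2) by simp
  have v: "continuous_on {0..t} v"
    unfolding v_def by (rule zero_ext_continuous(2)[OF \<Omega> cont zero])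
  have "a s = L2_ip \<Omega> (v s) (v s)" if "s \<in> {0..t}" for s
    unfolding a_def L2_ip_def using \<Omega> that
    by (intro set_lebesgue_integral_cong) (auto simp: val power2_eq_square)
  then have a: "continuous_on {0..t} a"
    using continuous_on_cong[OF refl, of "{0..t}" a "\<lambda>s. L2_ip \<Omega> (v s) (v s)"]
      continuous_on[OF v v] by simp
  have int: "spacetime_sq_integral \<Omega> u r = integral {0..r} a" if "r \<le> t" for r
    unfolding spacetime_sq_integral_def a_def[symmetric]
    using that
    by (intro set_borel_integral_eq_integral borel_integrable_atLeastAtMost' continuous_on_subset[OF a]) auto
  have "0 \<le> a r" for r
    unfolding a_def set_lebesgue_integral_def by (intro Bochner_Integration.integral_nonneg) auto
  then have "integral {0..s} a \<le> integral {0..t} a"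
    using st by (intro integral_subset_le integrable_continuous_real continuous_on_subset[OF a]) auto
  then show ?thesis using int st by simp
qed

lemma locally_lipschitz_imp_continuous:
  fixes f :: "real \<Rightarrow> real"
  assumes "\<And>x. \<exists>e>0. \<exists>L. L-lipschitz_on (ball x e) f"
  shows "continuous_on UNIV f"
proof (rule continuous_at_imp_continuous_on, rule ballI)
  fix x
  obtain e L where "0 < e" "L-lipschitz_on (ball x e) f" using assms by blast
  then show "isCont f x"
    using lipschitz_on_continuous_on[of L "ball x e" f]
    by (simp add: continuous_on_eq_continuous_at)
qed

theorem mainTheorem1:
  fixes \<Omega> :: "'a::euclidean_space set"
    and f :: "real \<Rightarrow> real"
    and u\<^sub>0 :: "'a \<Rightarrow> real"
    and u :: "'a \<Rightarrow> real \<Rightarrow> real"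
    and T :: ereal
    and lam\<^sub>0 \<alpha> \<beta> \<gamma> :: real
  assumes domain: "bounded_smooth_domain \<Omega>"
    and eigenvalue: "0 < lam\<^sub>0" "first_dirichlet_eigenvalue \<Omega> lam\<^sub>0"
    and f_lipschitz: "\<And>x. \<exists>e>0. \<exists>L. L-lipschitz_on (ball x e) f"
    and f_zero: "f 0 = 0"
    and f_pos: "\<And>v. 0 < v \<Longrightarrow> 0 < f v"
    and u0_C1: "C1_closure u\<^sub>0 \<Omega>"
    and u0_nonneg: "\<And>x. x \<in> closure \<Omega> \<Longrightarrow> 0 \<le> u\<^sub>0 x"
    and u0_boundary: "\<And>x. x \<in> frontier \<Omega> \<Longrightarrow> u\<^sub>0 x = 0"
    and constants: "0 < \<alpha>" "0 < \<beta>" "0 < \<gamma>" "\<beta> \<le> (\<alpha> - 2) * lam\<^sub>0 / 2"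
    and condition: "\<And>v. 0 < v \<Longrightarrow>
          \<alpha> * (LINT s:{0..v}|lborel. f s) \<le> v * f v + \<beta> * v\<^sup>2 + \<gamma>"
    and energy: "0 < - 1/2 * (LINT x:\<Omega>|lborel. (norm (gradient u\<^sub>0 x))\<^sup>2)
          + (LINT x:\<Omega>|lborel. (LINT s:{0..u\<^sub>0 x}|lborel. f s) - \<gamma>)"
    and solution: "0 < T" "nonneg_classical_solution \<Omega> T f u\<^sub>0 u"
    and lifespan: "lives_until_blow_up \<Omega> T u"
  shows "\<exists>Tstar. 0 < Tstar \<and> T = ereal Tstar \<and>
           filterlim (spacetime_sq_integral \<Omega> u) at_top (at_left Tstar)"
proof -
  have \<Omega>: "open \<Omega>" "bounded \<Omega>" using domain by (auto simp: bounded_smooth_domain_def)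
  have f_cont: "continuous_on UNIV f"
    by (rule locally_lipschitz_imp_continuous[OF f_lipschitz])
  have "T \<noteq> \<infinity>"
  proof
    assume "T = \<infinity>"
    have u0: "Ck_on 1 u\<^sub>0 \<Omega>" using u0_C1 by (simp add: C1_closure_def)
    obtain H where H: "continuous_on (closure \<Omega>) H" "\<And>x. x \<in> \<Omega> \<Longrightarrow> gradient u\<^sub>0 x = H x"
      using u0_C1 by (auto simp: C1_closure_def)
    have "bounded (H ` closure \<Omega>)"
      using \<Omega> H(1) by (intro compact_imp_bounded compact_continuous_image) auto
    then obtain B where B: "\<And>x. x \<in> closure \<Omega> \<Longrightarrow> norm (H x) \<le> B"
      unfolding bounded_iff by (metis imageI)
    have u0_energy: "set_integrable lborel \<Omega> (\<lambda>x. (norm (gradient u\<^sub>0 x))\<^sup>2)"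
    proof (rule set_integrable_bounded[OF \<Omega>])
      show "continuous_on \<Omega> (\<lambda>x. (norm (gradient u\<^sub>0 x))\<^sup>2)"
        by (intro continuous_intros gradient_continuous u0)
      show "\<bar>(norm (gradient u\<^sub>0 x))\<^sup>2\<bar> \<le> B\<^sup>2" if "x \<in> \<Omega>" for x
        using B[of x] H(2)[OF that] that closure_subset[of \<Omega>] by (auto intro!: power_mono)
    qed
    interpret global_solution \<Omega> f u\<^sub>0 u lam\<^sub>0
      using \<Omega> eigenvalue f_cont u0 u0_energy solution(2) \<open>T = \<infinity>\<close> by unfold_locales auto
    have v0: "v 0 x = u\<^sub>0 x" if "x \<in> \<Omega>" for x
      using that u_initial closure_subset[of \<Omega>] by (auto simp: v_apply)
    have int: "set_integrable lborel \<Omega> (\<lambda>x. LINT s:{0..v 0 x}|lborel. f s)"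
      by (rule set_integrable_primitive[OF \<Omega> f_cont v_nonneg]) simp
    have c: "set_integrable lborel \<Omega> (\<lambda>_. \<gamma>)"
      by (rule set_integrable_bounded[OF \<Omega>]) auto
    have "(LINT x:\<Omega>|lborel. (LINT s:{0..u\<^sub>0 x}|lborel. f s) - \<gamma>) =
        (LINT x:\<Omega>|lborel. (LINT s:{0..v 0 x}|lborel. f s) - \<gamma>)"
      using \<Omega> by (intro set_lebesgue_integral_cong) (auto simp: v0)
    also have "\<dots> = primitive_integral \<Omega> f (v 0) - \<gamma> * measure lborel \<Omega>"
      using set_integral_diff(2)[OF int c] \<Omega> emeasure_bounded_finite[of \<Omega>]
      by (simp add: primitive_integral_def set_integral_const)
    finally show False
      using energy initial_energy_not_positive[OF constants(2-4) condition] by (simp add: E_def)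
  qed
  then obtain r where r: "T = ereal r" "0 < r"
    using solution(1) by (cases T) auto
  let ?I = "spacetime_sq_integral \<Omega> u"
  have "\<not> bdd_above (?I ` {0..<r})"
    using lifespan r by (auto simp: lives_until_blow_up_def)
  then have unbounded: "\<exists>s\<in>{0..<r}. C < ?I s" for C
    by (auto simp: bdd_above_def not_le)
  have "filterlim ?I at_top (at_left r)"
    unfolding filterlim_at_top
  proof
    fix C
    obtain s where s: "0 \<le> s" "s < r" "C < ?I s" using unbounded[of C] by auto
    have "C \<le> ?I t" if "s < t" "t < r" for t
      using spacetime_sq_integral_mono[OF \<Omega> solution(2), of s t] s that r by simp
    then show "\<forall>\<^sub>F t in at_left r. C \<le> ?I t"
      using s(2) unfolding eventually_at_left_field by (intro exI[of _ s]) auto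
  qed
  then show ?thesis using r by blast
qed

end
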